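(* For each $\Theta\in\left(-\frac{\pi}{2},\frac{\pi}{2}\right)$ and each integer $m\in\{2,3,4,\dots\}$ there exists a viscosity solution $u^{m}$ on $B_{1}\subset\mathbb{R}^{3}$ of the special Lagrangian equation $$\sum_{i=1}^{3}\arctan\lambda_{i}=\Theta ,$$ where $\lambda_1,\lambda_2,\lambda_3$ are the eigenvalues of $D^{2}u$, such that $$u^{m}\in C^{1,1/(2m-1)}(B_{1})\cap C^{\infty}(B_{1}\setminus\{0\}),$$ but $u^{m}\notin C^{1,\delta}(B_1)$ for any $\delta>1/(2m-1)$.
   Context: $B_{1}$ is the open unit ball of $\mathbb{R}^{3}$ centered at the origin. $C^{1,\alpha}$ denotes $C^1$ functions whose gradient is Hölder continuous with exponent $\alpha$. A continuous function $u$ on $B_1$ is a viscosity solution of $\sum_{i=1}^3\arctan\lambda_i(D^2u)=\Theta$ if, for every point $x_0\in B_1$ and every quadratic polynomial (equivalently, $C^2$ function) $Q$: whenever $Q$ touches $u$ at $x_0$ from below (i.e. $Q(x_0)=u(x_0)$ and $Q\le u$ near $x_0$) one has $\sum_{i=1}^3\arctan\lambda_i(D^2Q(x_0))\le\Theta$, and whenever $Q$ touches $u$ at $x_0$ from above (i.e. $Q(x_0)=u(x_0)$ and $Q\ge u$ near $x_0$) one has $\sum_{i=1}^3\arctan\lambda_i(D^2Q(x_0))\ge\Theta$. Here $\lambda_i(M)$ are the eigenvalues of the symmetric matrix $M$ and $\arctan$ takes values in $(-\pi/2,\pi/2)$. *)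

theory Defs
  imports "HOL-Analysis.Analysis" "HOL-Computational_Algebra.Polynomial"
begin

definition charpoly :: "real ^ 'n ^ 'n \<Rightarrow> real poly" where
  "charpoly M = det (\<chi> i j. (if i = j then [:0, 1:] else 0) - [:M $ i $ j:])"

text \<open>Real eigenvalues, repeated according to algebraic multiplicity. For symmetric \<open>M\<close>, the only
  case used, these are all \<open>CARD('n)\<close> eigenvalues.\<close>

definition eigenvalues :: "real ^ 'n ^ 'n \<Rightarrow> real multiset" where
  "eigenvalues M = proots (charpoly M)"

definition sum_arctan_eigenvalues :: "real ^ 'n ^ 'n \<Rightarrow> real" where
  "sum_arctan_eigenvalues M = (\<Sum>l\<in>#eigenvalues M. arctan l)"

definition partial_deriv :: "'n::finite \<Rightarrow> (real ^ 'n \<Rightarrow> real) \<Rightarrow> real ^ 'n \<Rightarrow> real" where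
  "partial_deriv i f x = frechet_derivative f (at x) (axis i 1)"

definition hessian :: "(real ^ 'n \<Rightarrow> real) \<Rightarrow> real ^ 'n \<Rightarrow> real ^ 'n ^ 'n" where
  "hessian f x = (\<chi> i j. partial_deriv i (partial_deriv j f) x)"

text \<open>Meant for open \<open>U\<close>: all derivatives are full derivatives at points of \<open>U\<close>.\<close>

fun Ck_on :: "nat \<Rightarrow> (real ^ 'n) set \<Rightarrow> (real ^ 'n \<Rightarrow> real) \<Rightarrow> bool" where
  "Ck_on 0 U f \<longleftrightarrow> continuous_on U f"
| "Ck_on (Suc k) U f \<longleftrightarrow>
     (\<forall>x\<in>U. f differentiable (at x)) \<and> (\<forall>i. Ck_on k U (partial_deriv i f))"

definition C_infinity_on :: "(real ^ 'n) set \<Rightarrow> (real ^ 'n \<Rightarrow> real) \<Rightarrow> bool" where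
  "C_infinity_on U f \<longleftrightarrow> (\<forall>k. Ck_on k U f)"

text \<open>\<open>C\<^bsup>1,\<alpha>\<^esup>(U)\<close> for open \<open>U\<close> and \<open>\<alpha> > 0\<close>, with the Hoelder condition on the gradient required
  uniformly on \<open>U\<close>. Because of this uniformity, failure of membership on a ball could come from the
  boundary alone; to express a singularity at the centre, one denies membership on every smaller
  concentric ball as well.\<close>

definition C1_Hoelder_on :: "real \<Rightarrow> (real ^ 'n) set \<Rightarrow> (real ^ 'n \<Rightarrow> real) \<Rightarrow> bool" where
  "C1_Hoelder_on \<alpha> U f \<longleftrightarrow>
     (\<exists>g. (\<forall>x\<in>U. GDERIV f x :> g x) \<and> continuous_on U g \<and>
          (\<exists>C. \<forall>x\<in>U. \<forall>y\<in>U. norm (g x - g y) \<le> C * norm (x - y) powr \<alpha>))"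

text \<open>Quadratic polynomials in the sense of polynomials of degree at most two; \<open>A\<close> need not be
  symmetric.\<close>

definition quadratic_polynomial :: "(real ^ 'n \<Rightarrow> real) \<Rightarrow> bool" where
  "quadratic_polynomial Q \<longleftrightarrow> (\<exists>c b A. \<forall>x. Q x = c + b \<bullet> x + x \<bullet> (A *v x))"

definition touches_from_below ::
  "('a::topological_space \<Rightarrow> real) \<Rightarrow> ('a \<Rightarrow> real) \<Rightarrow> 'a \<Rightarrow> bool" where
  "touches_from_below Q u x0 \<longleftrightarrow> Q x0 = u x0 \<and> (\<forall>\<^sub>F x in nhds x0. Q x \<le> u x)"

definition touches_from_above ::
  "('a::topological_space \<Rightarrow> real) \<Rightarrow> ('a \<Rightarrow> real) \<Rightarrow> 'a \<Rightarrow> bool" where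
  "touches_from_above Q u x0 \<longleftrightarrow> Q x0 = u x0 \<and> (\<forall>\<^sub>F x in nhds x0. Q x \<ge> u x)"

definition special_lagrangian_viscosity_solution ::
  "real \<Rightarrow> (real ^ 'n) set \<Rightarrow> (real ^ 'n \<Rightarrow> real) \<Rightarrow> bool" where
  "special_lagrangian_viscosity_solution \<Theta> U u \<longleftrightarrow>
     continuous_on U u \<and>
     (\<forall>x0\<in>U. \<forall>Q. quadratic_polynomial Q \<longrightarrow>
        (touches_from_below Q u x0 \<longrightarrow> sum_arctan_eigenvalues (hessian Q x0) \<le> \<Theta>) \<and>
        (touches_from_above Q u x0 \<longrightarrow> sum_arctan_eigenvalues (hessian Q x0) \<ge> \<Theta>))"

end

theory Submission
  imports Defs
begin

text \<open>
  Put \<open>\<theta> = (\<Theta> + \<pi>/2)/2\<close>, so that \<open>0 < \<theta> < \<pi>/2\<close>. A smooth solution \<open>v\<close> of the special Lagrangian equation of phase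
  \<open>2\<theta> = \<Theta> + \<pi>/2\<close> near the origin with \<open>D\<^sup>2v(0) = diag(tan \<theta>, tan \<theta>, 0)\<close> and \<open>v\<^sub>3\<^sub>3 \<ge> c\<bar>x\<bar>\<^bsup>2m-2\<^esup>\<close> is turned by the
  partial Legendre transform \<open>x\<^sub>3 \<mapsto> y = v\<^sub>3\<close>, \<open>u(x\<^sub>1, x\<^sub>2, y) = v - x\<^sub>3 y\<close>, into a solution of phase \<open>\<Theta>\<close>: this rotates the
  gradient graph by a quarter turn in the third complex direction. Since \<open>\<partial>u/\<partial>y = - x\<^sub>3\<close> and \<open>v\<^sub>3\<close> is comparable to
  \<open>x\<^sub>3\<^bsup>2m-1\<^esup>\<close> on the axis, the gradient of \<open>u\<close> is Hoelder continuous with exponent \<open>1/(2m-1)\<close> and not better. At the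
  origin no quadratic polynomial touches \<open>u\<close> from below, and one touching from above has Hessian at least \<open>tan \<theta>\<close> on
  the plane \<open>y = 0\<close>, hence a sum of arctangents at least \<open>2\<theta> - \<pi>/2 = \<Theta>\<close>.

  Positivity of \<open>v\<^sub>3\<^sub>3\<close> cannot come from harmonic polynomials alone; it is produced by the quadratic interaction
  in the equation: if \<open>v\<close> starts with \<open>e x\<^sub>3 f\<close>, \<open>f = Re (x\<^sub>1 + i x\<^sub>2)\<^sup>m\<close>, then \<open>v\<^sub>3\<^sub>3\<close> contains
  \<open>sin \<theta> cos \<theta> e\<^sup>2 \<bar>\<nabla>f\<bar>\<^sup>2\<close>, which vanishes only on the axis, where a multiple of
  \<open>Re (x\<^sub>3 + i x\<^sub>1 / cos \<theta>)\<^bsup>2m\<^esup>\<close> takes over. The exact solution is obtained from this approximation by a contraction in a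
  weighted \<open>\<ell>\<^sup>1\<close> algebra of power series. With the weights \<open>i! j! k! / (i + j + k)!\<close> the operators
  \<open>\<partial>\<^sub>i \<partial>\<^sub>3\<^sup>-\<^sup>1\<close> are bounded, so no derivatives are lost.
\<close>

section \<open>Smooth functions\<close>

text \<open>Solved for \<open>w_zz\<close>, the equation is a Cauchy problem in the third variable.
  Its linear part \<open>w_zz = - c^2 (w_xx + w_yy)\<close> is elliptic, so the problem is ill-posed
  for merely smooth data; this is the reason for working with power series. The unknown of the
  contraction is the correction \<open>\<omega>\<close> of \<open>w_zz\<close>, and the corrections
  of the other second derivatives are bounded operators applied to it. A further factor
  \<open>2^-k\<close> in the weights gives \<open>\<partial>_i \<partial>_3^-1\<close> norm at most
  1/2. The linear term then has Lipschitz constant at most 1/4 + 1/4, and small second derivatives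
  keep the nonlinear terms below the remaining margin. Requiring \<open>\<omega>\<close> to vanish
  to order 2m - 1 leaves the leading part of \<open>w_zz\<close>, of degree 2m - 2, intact. On the
  transformed side the polynomial form of the equation determines the phase only modulo pi. The
  branch is found from the signs of the eigenvalues and an upper bound of the Hessian, and for this
  the second derivatives of \<open>w\<close> are kept small both absolutely and relative to
  \<open>tan \<theta>\<close>.\<close>

lemma has_derivative_cong_open:
  assumes "open U" "x \<in> U" "\<And>y. y \<in> U \<Longrightarrow> f y = g y"
  shows "(f has_derivative D) (at x) \<longleftrightarrow> (g has_derivative D) (at x)"
  using has_derivative_transform_within_open[OF _ assms(1,2)] assms(3) by metis

lemma partial_deriv_cong_open:
  assumes "open U" "x \<in> U" "\<And>y. y \<in> U \<Longrightarrow> f y = g y"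
  shows "partial_deriv i f x = partial_deriv i g x"
  unfolding partial_deriv_def frechet_derivative_def
  by (simp add: has_derivative_cong_open[OF assms])

lemma Ck_on_cong:
  assumes "open U" "\<And>x. x \<in> U \<Longrightarrow> f x = g x"
  shows "Ck_on k U f \<longleftrightarrow> Ck_on k U g"
  using assms(2)
proof (induction k arbitrary: f g)
  case 0
  then show ?case by (simp cong: continuous_on_cong)
next
  case (Suc k)
  have "f differentiable (at x) \<longleftrightarrow> g differentiable (at x)" if "x \<in> U" for x
    using has_derivative_cong_open[OF assms(1) that Suc.prems] by (simp add: differentiable_def)
  moreover have "Ck_on k U (partial_deriv i f) \<longleftrightarrow> Ck_on k U (partial_deriv i g)" for i
    by (rule Suc.IH) (use partial_deriv_cong_open[OF assms(1) _ Suc.prems] in auto)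
  ultimately show ?case by simp
qed

lemma Ck_on_Suc_imp: "Ck_on (Suc k) U f \<Longrightarrow> Ck_on k U f"
proof (induction k arbitrary: f)
  case 0
  then show ?case
    by (simp add: differentiable_imp_continuous_on differentiable_on_def differentiable_at_withinI)
next
  case (Suc k)
  then show ?case by (metis Ck_on.simps(2))
qed

lemma partial_deriv_GDERIV: "GDERIV f x :> g \<Longrightarrow> partial_deriv i f x = g $ i"
  unfolding partial_deriv_def gderiv_def
  by (simp add: frechet_derivative_at[symmetric] inner_commute cart_eq_inner_axis)

lemma linear_eq_inner_axis:
  fixes F :: "real ^ 'n \<Rightarrow> real"
  assumes "linear F"
  shows "F h = h \<bullet> (\<chi> i. F (axis i 1))"
proof -
  have "F h = F (\<Sum>i\<in>UNIV. h $ i *\<^sub>R axis i 1)"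
    by (subst basis_expansion[of h, unfolded scalar_mult_eq_scaleR]) (rule refl)
  also have "\<dots> = (\<Sum>i\<in>UNIV. F (h $ i *\<^sub>R axis i 1))"
    by (rule linear_sum[OF assms])
  also have "\<dots> = (\<Sum>i\<in>UNIV. h $ i * F (axis i 1))"
    by (intro sum.cong refl) (simp only: linear_scale[OF assms] real_scaleR_def)
  also have "\<dots> = h \<bullet> (\<chi> i. F (axis i 1))"
    by (simp only: inner_vec_def vec_lambda_beta inner_real_def)
  finally show ?thesis .
qed

lemma GDERIV_partial_deriv:
  assumes "f differentiable (at x)"
  shows "GDERIV f x :> (\<chi> i. partial_deriv i f x)"
proof -
  have d: "(f has_derivative frechet_derivative f (at x)) (at x)"
    using assms by (simp add: frechet_derivative_works)
  have "frechet_derivative f (at x) = (\<lambda>h. h \<bullet> (\<chi> i. partial_deriv i f x))"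
    unfolding partial_deriv_def
    by (rule ext, rule linear_eq_inner_axis) (rule linear_frechet_derivative[OF assms])
  with d show ?thesis unfolding gderiv_def by (rule subst[rotated])
qed

text \<open>Off \<open>U\<close> the total function \<open>partial_deriv i f\<close> has no
  controlled values. As \<open>U\<close> is open, congruence on \<open>U\<close> lets any gradient
  \<open>g\<close> computed on \<open>U\<close> take its place, so the closure rules below reduce to
  gradient formulas.\<close>

lemma Ck_on_SucI:
  assumes "open U" "\<And>x. x \<in> U \<Longrightarrow> GDERIV f x :> g x" "\<And>i. Ck_on k U (\<lambda>x. g x $ i)"
  shows "Ck_on (Suc k) U f"
proof -
  have "Ck_on k U (partial_deriv i f)" for i
    using assms(3)[of i] partial_deriv_GDERIV[OF assms(2), of _ i]
    by (subst Ck_on_cong[OF assms(1)]) auto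
  moreover have "f differentiable (at x)" if "x \<in> U" for x
    using assms(2)[OF that] by (auto simp: gderiv_def differentiable_def)
  ultimately show ?thesis by simp
qed

lemma Ck_on_const:
  fixes U :: "(real ^ 'n) set"
  shows "Ck_on k U (\<lambda>x. c)"
proof (induction k arbitrary: c)
  case (Suc k)
  have "partial_deriv i (\<lambda>x. c) = (\<lambda>x. 0)" for i :: 'n
    using partial_deriv_GDERIV[OF GDERIV_const] by (auto simp: fun_eq_iff)
  then show ?case by (simp only: Ck_on.simps Suc.IH) simp
qed simp

lemma GDERIV_component: "GDERIV (\<lambda>x. x $ j) x :> axis j 1"
proof -
  have "((\<lambda>x. x $ j) has_derivative (\<lambda>h. h $ j)) (at x)"
    by (rule bounded_linear.has_derivative[OF bounded_linear_vec_nth has_derivative_ident])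
  then show ?thesis by (simp add: gderiv_def inner_axis)
qed

lemma Ck_on_component: 
  assumes "open U"
  shows "Ck_on k U (\<lambda>x. x $ j)"
proof (cases k)
  case 0
  then show ?thesis by (auto intro: continuous_intros)
next
  case (Suc n)
  show ?thesis unfolding Suc
    by (rule Ck_on_SucI[OF assms GDERIV_component]) (rule Ck_on_const)
qed

lemma Ck_on_add:
  assumes "open U" "Ck_on k U f" "Ck_on k U g"
  shows "Ck_on k U (\<lambda>x. f x + g x)"
  using assms(2,3)
proof (induction k arbitrary: f g)
  case 0
  then show ?case by (auto intro: continuous_intros)
next
  case (Suc k)
  show ?case
    by (rule Ck_on_SucI[OF assms(1) GDERIV_add[OF GDERIV_partial_deriv GDERIV_partial_deriv]])
      (use Suc in auto)
qed

lemma Ck_on_mult: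
  assumes "open U" "Ck_on k U f" "Ck_on k U g"
  shows "Ck_on k U (\<lambda>x. f x * g x)"
  using assms(2,3)
proof (induction k arbitrary: f g)
  case 0
  then show ?case by (auto intro: continuous_intros)
next
  case (Suc k)
  show ?case
  proof (rule Ck_on_SucI[OF assms(1) GDERIV_mult[OF GDERIV_partial_deriv GDERIV_partial_deriv]])
    show "Ck_on k U (\<lambda>x. (f x *\<^sub>R (\<chi> i. partial_deriv i g x) + g x *\<^sub>R (\<chi> i. partial_deriv i f x)) $ i)" for i
      using Suc Ck_on_Suc_imp[of k U] by (auto intro!: Ck_on_add[OF assms(1)])
  qed (use Suc in auto)
qed

lemma Ck_on_minus:
  assumes "open U" "Ck_on k U f" 
  shows "Ck_on k U (\<lambda>x. - f x)"
  using Ck_on_mult[OF assms(1) Ck_on_const[of k U "-1"] assms(2)] by simp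

lemma Ck_on_diff:
  assumes "open U" "Ck_on k U f" "Ck_on k U g"
  shows "Ck_on k U (\<lambda>x. f x - g x)"
  using Ck_on_add[OF assms(1,2) Ck_on_minus[OF assms(1,3)]] by simp

lemma Ck_on_inverse:
  assumes "open U" "Ck_on k U f" "\<And>x. x \<in> U \<Longrightarrow> f x \<noteq> 0"
  shows "Ck_on k U (\<lambda>x. inverse (f x))"
  using assms(2)
proof (induction k)
  case 0
  then show ?case using assms(3) by (auto intro!: continuous_intros)
next
  case (Suc k)
  then have IH: "Ck_on k U (\<lambda>x. inverse (f x))" using Ck_on_Suc_imp by blast
  show ?case
  proof (rule Ck_on_SucI[OF assms(1) GDERIV_inverse[OF GDERIV_partial_deriv]])
    show "Ck_on k U (\<lambda>x. (- (inverse (f x))\<^sup>2 *\<^sub>R (\<chi> i. partial_deriv i f x)) $ i)" for i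
      using Suc IH by (auto simp: power2_eq_square intro!: Ck_on_mult[OF assms(1)] Ck_on_minus[OF assms(1)])
  qed (use Suc assms(3) in auto)
qed

lemma C_infinity_on_differentiable: "C_infinity_on U f \<Longrightarrow> x \<in> U \<Longrightarrow> f differentiable (at x)"
  unfolding C_infinity_on_def by (metis Ck_on.simps(2))

lemma C_infinity_on_partial_deriv: "C_infinity_on U f \<Longrightarrow> C_infinity_on U (partial_deriv i f)"
  unfolding C_infinity_on_def by (metis Ck_on.simps(2))

lemma C_infinity_on_continuous: "C_infinity_on U f \<Longrightarrow> continuous_on U f"
  unfolding C_infinity_on_def using Ck_on.simps(1) by blast

lemma C_infinity_on_intros:
  assumes "open U"
  shows "C_infinity_on U (\<lambda>x. c)" "C_infinity_on U (\<lambda>x. x $ j)"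
    "C_infinity_on U f \<Longrightarrow> C_infinity_on U g \<Longrightarrow> C_infinity_on U (\<lambda>x. f x + g x)"
    "C_infinity_on U f \<Longrightarrow> C_infinity_on U g \<Longrightarrow> C_infinity_on U (\<lambda>x. f x - g x)"
    "C_infinity_on U f \<Longrightarrow> C_infinity_on U g \<Longrightarrow> C_infinity_on U (\<lambda>x. f x * g x)"
    "C_infinity_on U f \<Longrightarrow> (\<And>x. x \<in> U \<Longrightarrow> f x \<noteq> 0) \<Longrightarrow> C_infinity_on U (\<lambda>x. inverse (f x))"
  using assms unfolding C_infinity_on_def
  by (auto intro!: Ck_on_const Ck_on_component Ck_on_add Ck_on_diff Ck_on_mult Ck_on_inverse)

lemma C_infinity_on_cong:
  assumes "open U" "\<And>x. x \<in> U \<Longrightarrow> f x = g x"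
  shows "C_infinity_on U f \<longleftrightarrow> C_infinity_on U g"
  unfolding C_infinity_on_def using Ck_on_cong[OF assms(1), of f g] assms(2) by simp

lemma Ck_on_subset: "Ck_on k U f \<Longrightarrow> V \<subseteq> U \<Longrightarrow> Ck_on k V f"
  by (induction k arbitrary: f) (auto intro: continuous_on_subset)

lemma C_infinity_on_subset: "C_infinity_on U f \<Longrightarrow> V \<subseteq> U \<Longrightarrow> C_infinity_on V f"
  unfolding C_infinity_on_def using Ck_on_subset by blast

section \<open>A Banach algebra of power series\<close>

type_synonym idx = "nat \<times> nat \<times> nat"

text \<open>The reciprocal of the multinomial coefficient, times \<open>2^-k\<close>.
  Differentiating in the first or second variable and integrating in the third keeps the total
  degree and multiplies a coefficient by \<open>(i + 1) / k\<close> or \<open>(j + 1) / k\<close>,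
  which is the ratio of two neighbouring reciprocals. The power of 2 makes the norms of these
  operators at most 1/2.\<close>

definition wt :: "idx \<Rightarrow> real" where
  "wt = (\<lambda>(i, j, k). fact i * fact j * fact k / (fact (i + j + k) * 2 ^ k))"

definition splits :: "idx \<Rightarrow> (idx \<times> idx) set" where
  "splits c = {(a, b). a + b = c}"

lemma wt_pos: "wt a > 0"
  by (cases a) (simp add: wt_def)

lemma wt_nonneg [simp]: "wt a \<ge> 0"
  using wt_pos less_imp_le by blast

lemma wt_zero [simp]: "wt 0 = 1"
  by (simp add: wt_def zero_prod_def)

text \<open>The left side is a single summand of Vandermonde's sum for the right side.\<close>

lemma binomial_mult_le: "(n choose k) * (m choose l) \<le> (n + m) choose (k + l)"
proof -
  have "(n choose k) * (m choose l) = (n choose k) * (m choose (k + l - k))" by simp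
  also have "\<dots> \<le> (\<Sum>i\<le>k + l. (n choose i) * (m choose (k + l - i)))"
    by (rule member_le_sum) auto
  also have "\<dots> = (n + m) choose (k + l)" by (rule vandermonde)
  finally show ?thesis .
qed

lemma wt_binomial:
  "wt (i, j, k) = 1 / (real ((i + j + k) choose k) * real ((i + j) choose i) * 2 ^ k)"
  by (simp add: wt_def binomial_fact field_simps)

text \<open>Submultiplicative weights make the weighted l1 space an algebra. Multinomial
  coefficients, written as two binomial factors, are supermultiplicative, and the powers of 2
  multiply exactly.\<close>

lemma wt_add_le: "wt (a + b) \<le> wt a * wt b"
proof -
  obtain i j k where a: "a = (i, j, k)" by (cases a)
  obtain p q r where b: "b = (p, q, r)" by (cases b)
  have 1: "real ((i + j + k) choose k) * real ((p + q + r) choose r)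
      \<le> real ((i + p + (j + q) + (k + r)) choose (k + r))"
    using binomial_mult_le[of "i + j + k" k "p + q + r" r]
    by (simp add: algebra_simps flip: of_nat_mult)
  have 2: "real ((i + j) choose i) * real ((p + q) choose p)
      \<le> real ((i + p + (j + q)) choose (i + p))"
    using binomial_mult_le[of "i + j" i "p + q" p]
    by (simp add: algebra_simps flip: of_nat_mult)
  have pos: "real ((i + j + k) choose k) > 0" "real ((p + q + r) choose r) > 0"
    "real ((i + j) choose i) > 0" "real ((p + q) choose p) > 0"
    by (auto simp: zero_less_binomial)
  have "(real ((i + j + k) choose k) * real ((p + q + r) choose r)) *
        (real ((i + j) choose i) * real ((p + q) choose p))
      \<le> real ((i + p + (j + q) + (k + r)) choose (k + r)) * real ((i + p + (j + q)) choose (i + p))"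
    by (intro mult_mono 1 2) (use pos in auto)
  then have "1 / (real ((i + p + (j + q) + (k + r)) choose (k + r)) *
        real ((i + p + (j + q)) choose (i + p)) * 2 ^ (k + r))
      \<le> 1 / ((real ((i + j + k) choose k) * real ((p + q + r) choose r)) *
        (real ((i + j) choose i) * real ((p + q) choose p)) * 2 ^ (k + r))"
    by (intro divide_left_mono mult_right_mono mult_pos_pos) (use pos in \<open>auto simp: zero_less_binomial\<close>)
  then show ?thesis
    by (simp add: a b wt_binomial power_add mult_ac)
qed

lemma finite_splits [simp]: "finite (splits c)"
proof -
  obtain i j k where c: "c = (i, j, k)" by (cases c)
  have "splits c \<subseteq> ({..i} \<times> {..j} \<times> {..k}) \<times> ({..i} \<times> {..j} \<times> {..k})"
    by (auto simp: splits_def c)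
  then show ?thesis by (rule finite_subset) auto
qed

lemma bij_betw_splits:
  "bij_betw (\<lambda>(a, b). (a + b, (a, b))) UNIV (Sigma UNIV splits)"
  by (rule bij_betwI[where g = snd]) (auto simp: splits_def)

text \<open>Every pair \<open>(a, b)\<close> lies in exactly one finite fibre
  \<open>splits (a + b)\<close>, so an absolutely convergent double sum may be grouped by fibres.
  This is the Cauchy product, used both for the norm and for evaluation.\<close>

lemma sum_splits_infsum:
  fixes f :: "idx \<times> idx \<Rightarrow> real"
  assumes "f summable_on UNIV"
  shows "(\<lambda>c. \<Sum>x\<in>splits c. f x) summable_on UNIV"
    and "infsum (\<lambda>c. \<Sum>x\<in>splits c. f x) UNIV = infsum f UNIV"
proof -
  have eq: "(\<lambda>x. (f \<circ> snd) ((\<lambda>(a, b). (a + b, (a, b))) x)) = f"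
    by auto
  have s: "(f \<circ> snd) summable_on Sigma UNIV splits"
    using summable_on_reindex_bij_betw[OF bij_betw_splits, of "f \<circ> snd"] assms
    by (simp only: eq)
  then show "(\<lambda>c. \<Sum>x\<in>splits c. f x) summable_on UNIV"
    using summable_on_Sigma_banach[of "\<lambda>c x. f x" UNIV splits]
    by (simp add: comp_def case_prod_unfold)
  have "infsum f UNIV = infsum (f \<circ> snd) (Sigma UNIV splits)"
    using infsum_reindex_bij_betw[OF bij_betw_splits, of "f \<circ> snd"] by (simp only: eq)
  also have "\<dots> = infsum (\<lambda>c. \<Sum>x\<in>splits c. f x) UNIV"
    using infsum_Sigma_banach[OF s] by simp
  finally show "infsum (\<lambda>c. \<Sum>x\<in>splits c. f x) UNIV = infsum f UNIV" by simp
qed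

lemma summable_on_product_real:
  fixes p :: "'a \<Rightarrow> real" and q :: "'b \<Rightarrow> real"
  assumes "p summable_on UNIV" "q summable_on UNIV"
  shows "(\<lambda>(a, b). p a * q b) summable_on UNIV"
    and "infsum (\<lambda>(a, b). p a * q b) UNIV = infsum p UNIV * infsum q UNIV"
proof -
  have P: "(\<lambda>a. \<bar>p a\<bar>) summable_on UNIV" and Q: "(\<lambda>a. \<bar>q a\<bar>) summable_on UNIV"
    using assms summable_on_iff_abs_summable_on_real by (auto simp: real_norm_def)
  have "(\<lambda>x. norm (case x of (a, b) \<Rightarrow> p a * q b)) summable_on (UNIV \<times> UNIV)"
    using P Q by (subst Infinite_Sum.abs_summable_on_Sigma_iff)
      (auto simp: abs_mult infsum_cmult_right' infsum_nonneg intro!: summable_on_cmult_left summable_on_cmult_right)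
  then have s: "(\<lambda>(a, b). p a * q b) summable_on (UNIV \<times> UNIV)"
    by (rule Infinite_Sum.abs_summable_summable)
  then show "(\<lambda>(a, b). p a * q b) summable_on UNIV" by simp
  show "infsum (\<lambda>(a, b). p a * q b) UNIV = infsum p UNIV * infsum q UNIV"
    using infsum_Sigma_banach[OF s] by (simp add: infsum_cmult_right' infsum_cmult_left')
qed

section \<open>The weighted l1 space as a Banach algebra\<close>

typedef wps = "{c :: idx \<Rightarrow> real. (\<lambda>a. \<bar>c a\<bar> * wt a) summable_on UNIV}"
  morphisms coeff wps_of
  by (rule exI[of _ "\<lambda>_. 0"]) simp

setup_lifting type_definition_wps

lemma wps_eqI: "(\<And>a. coeff p a = coeff q a) \<Longrightarrow> p = q"
  by (simp add: coeff_inject[symmetric] ext)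

lemma summable_coeff: "(\<lambda>a. \<bar>coeff p a\<bar> * wt a) summable_on UNIV"
  using coeff[of p] by simp

lemma summable_le:
  fixes f g :: "idx \<Rightarrow> real"
  assumes "g summable_on UNIV" "\<And>a. 0 \<le> f a" "\<And>a. f a \<le> g a"
  shows "f summable_on UNIV"
  by (rule summable_on_comparison_test[OF assms(1)]) (use assms in auto)

instantiation wps :: real_vector
begin

lift_definition zero_wps :: wps is "\<lambda>_. 0" by simp

lift_definition plus_wps :: "wps \<Rightarrow> wps \<Rightarrow> wps" is "\<lambda>p q a. p a + q a"
proof -
  fix p q :: "idx \<Rightarrow> real"
  assume *: "(\<lambda>a. \<bar>p a\<bar> * wt a) summable_on UNIV" "(\<lambda>a. \<bar>q a\<bar> * wt a) summable_on UNIV"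
  show "(\<lambda>a. \<bar>p a + q a\<bar> * wt a) summable_on UNIV"
    by (rule summable_le[OF summable_on_add[OF *]])
      (auto simp: mult_right_mono simp flip: distrib_right)
qed

lift_definition uminus_wps :: "wps \<Rightarrow> wps" is "\<lambda>p a. - p a" by simp

lift_definition minus_wps :: "wps \<Rightarrow> wps \<Rightarrow> wps" is "\<lambda>p q a. p a - q a"
proof -
  fix p q :: "idx \<Rightarrow> real"
  assume *: "(\<lambda>a. \<bar>p a\<bar> * wt a) summable_on UNIV" "(\<lambda>a. \<bar>q a\<bar> * wt a) summable_on UNIV"
  show "(\<lambda>a. \<bar>p a - q a\<bar> * wt a) summable_on UNIV"
    by (rule summable_le[OF summable_on_add[OF *]])
      (auto simp: mult_right_mono simp flip: distrib_right)
qed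

lift_definition scaleR_wps :: "real \<Rightarrow> wps \<Rightarrow> wps" is "\<lambda>r p a. r * p a"
  by (simp add: abs_mult mult.assoc summable_on_cmult_right)

instance
proof
  fix p q r :: wps and s t :: real
  show "p + q + r = p + (q + r)" by transfer (simp add: add.assoc)
  show "p + q = q + p" by transfer (simp add: add.commute)
  show "0 + p = p" by transfer simp
  show "- p + p = 0" by transfer simp
  show "p - q = p + - q" by transfer simp
  show "s *\<^sub>R (p + q) = s *\<^sub>R p + s *\<^sub>R q" by transfer (simp add: algebra_simps)
  show "(s + t) *\<^sub>R p = s *\<^sub>R p + t *\<^sub>R p" by transfer (simp add: algebra_simps)
  show "s *\<^sub>R t *\<^sub>R p = (s * t) *\<^sub>R p" by transfer (simp add: mult.assoc)
  show "1 *\<^sub>R p = p" by transfer simp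
qed

end

instantiation wps :: real_normed_vector
begin

definition norm_wps :: "wps \<Rightarrow> real" where
  "norm_wps p = infsum (\<lambda>a. \<bar>coeff p a\<bar> * wt a) UNIV"

definition dist_wps :: "wps \<Rightarrow> wps \<Rightarrow> real" where "dist_wps p q = norm (p - q)"

definition uniformity_wps :: "(wps \<times> wps) filter" where
  "uniformity_wps = (INF e\<in>{0 <..}. principal {(x, y). dist x y < e})"

definition open_wps :: "wps set \<Rightarrow> bool" where
  "open_wps S = (\<forall>x\<in>S. \<forall>\<^sub>F (x', y) in uniformity. x' = x \<longrightarrow> y \<in> S)"

definition sgn_wps :: "wps \<Rightarrow> wps" where "sgn_wps p = p /\<^sub>R norm p"

instance
proof
  fix p q r :: wps and s t :: real
  show "dist p q = norm (p - q)" by (rule dist_wps_def)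
  show "sgn p = p /\<^sub>R norm p" by (rule sgn_wps_def)
  show "uniformity = (INF e\<in>{0<..}. principal {(x, y :: wps). dist x y < e})"
    by (rule uniformity_wps_def)
  show "open U = (\<forall>x\<in>U. \<forall>\<^sub>F (x', y) in uniformity. x' = x \<longrightarrow> y \<in> U)" for U :: "wps set"
    by (rule open_wps_def)
  show "norm p = 0 \<longleftrightarrow> p = 0"
  proof
    assume "norm p = 0"
    then have "\<bar>coeff p a\<bar> * wt a = 0" for a
      using nonneg_infsum_le_0D[OF _ summable_coeff[of p], of a] by (auto simp: norm_wps_def)
    then have "coeff p a = 0" for a using wt_pos[of a] by (metis abs_eq_0 less_irrefl mult_eq_0_iff)
    then show "p = 0" by (intro wps_eqI) (simp add: zero_wps.rep_eq)
  qed (simp add: norm_wps_def zero_wps.rep_eq)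
  have "norm (p + q) \<le> infsum (\<lambda>a. \<bar>coeff p a\<bar> * wt a + \<bar>coeff q a\<bar> * wt a) UNIV"
    unfolding norm_wps_def
    by (intro infsum_mono summable_coeff summable_on_add)
      (auto simp: plus_wps.rep_eq mult_right_mono simp flip: distrib_right)
  also have "\<dots> = norm p + norm q"
    unfolding norm_wps_def by (intro infsum_add summable_coeff)
  finally show "norm (p + q) \<le> norm p + norm q" .
  show "norm (s *\<^sub>R p) = \<bar>s\<bar> * norm p"
    by (simp add: norm_wps_def scaleR_wps.rep_eq abs_mult mult.assoc infsum_cmult_right')
qed

end

lemma conv_weighted_le:
  "\<bar>\<Sum>(a, b)\<in>splits c. p a * q b\<bar> * wt c
    \<le> (\<Sum>x\<in>splits c. case x of (a, b) \<Rightarrow> (\<bar>p a\<bar> * wt a) * (\<bar>q b\<bar> * wt b))"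
proof -
  have "\<bar>\<Sum>(a, b)\<in>splits c. p a * q b\<bar> * wt c \<le> (\<Sum>x\<in>splits c. \<bar>case x of (a, b) \<Rightarrow> p a * q b\<bar>) * wt c"
    by (intro mult_right_mono sum_abs) auto
  also have "\<dots> = (\<Sum>x\<in>splits c. \<bar>case x of (a, b) \<Rightarrow> p a * q b\<bar> * wt c)"
    by (rule sum_distrib_right)
  also have "\<dots> \<le> (\<Sum>x\<in>splits c. case x of (a, b) \<Rightarrow> (\<bar>p a\<bar> * wt a) * (\<bar>q b\<bar> * wt b))"
  proof (rule sum_mono)
    fix x assume x: "x \<in> splits c"
    obtain a b where ab: "x = (a, b)" by (cases x)
    with x have "wt c \<le> wt a * wt b" using wt_add_le[of a b] by (auto simp: splits_def)
    then have "\<bar>p a * q b\<bar> * wt c \<le> \<bar>p a * q b\<bar> * (wt a * wt b)"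
      by (rule mult_left_mono) simp
    then show "\<bar>case x of (a, b) \<Rightarrow> p a * q b\<bar> * wt c
        \<le> (case x of (a, b) \<Rightarrow> (\<bar>p a\<bar> * wt a) * (\<bar>q b\<bar> * wt b))"
      by (simp add: ab abs_mult mult_ac)
  qed
  finally show ?thesis .
qed

lemma conv_summable:
  assumes "(\<lambda>a. \<bar>p a\<bar> * wt a) summable_on UNIV" "(\<lambda>a. \<bar>q a\<bar> * wt a) summable_on UNIV"
  shows "(\<lambda>c. \<bar>\<Sum>(a, b)\<in>splits c. p a * q b\<bar> * wt c) summable_on UNIV"
  by (rule summable_le[OF sum_splits_infsum(1)[OF summable_on_product_real(1)[OF assms]]])
    (auto intro: conv_weighted_le)

lemma splits_comm_bij: "bij_betw prod.swap (splits c) (splits c)"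
  by (rule bij_betwI[where g = prod.swap]) (auto simp: splits_def add.commute)

text \<open>Both sides run over the ordered triples with sum \<open>c\<close>, bracketed in the two
  possible ways.\<close>

lemma sum_splits_assoc:
  fixes f :: "idx \<Rightarrow> idx \<Rightarrow> idx \<Rightarrow> real"
  shows "(\<Sum>(d, e)\<in>splits c. \<Sum>(a, b)\<in>splits d. f a b e) = (\<Sum>(a, d)\<in>splits c. \<Sum>(b, e)\<in>splits d. f a b e)"
proof -
  have "(\<Sum>(d, e)\<in>splits c. \<Sum>(a, b)\<in>splits d. f a b e) = 
      (\<Sum>x\<in>splits c. \<Sum>y\<in>splits (fst x). f (fst y) (snd y) (snd x))"
    by (simp add: case_prod_unfold)
  also have "\<dots> = (\<Sum>z\<in>Sigma (splits c) (\<lambda>x. splits (fst x)). f (fst (snd z)) (snd (snd z)) (snd (fst z)))"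
    by (subst sum.Sigma) (auto simp: case_prod_unfold)
  also have "\<dots> = (\<Sum>z\<in>Sigma (splits c) (\<lambda>x. splits (snd x)). f (fst (fst z)) (fst (snd z)) (snd (snd z)))"
    by (rule sum.reindex_bij_witness
        [where i = "\<lambda>((a, d), (b, e)). ((a + b, e), (a, b))"
          and j = "\<lambda>((d, e), (a, b)). ((a, b + e), (b, e))"])
      (auto simp: splits_def add.assoc)
  also have "\<dots> = (\<Sum>x\<in>splits c. \<Sum>y\<in>splits (snd x). f (fst x) (fst y) (snd y))"
    by (subst sum.Sigma) (auto simp: case_prod_unfold)
  finally show ?thesis by (simp add: case_prod_unfold)
qed

lemma sum_splits_one: 
  fixes q :: "idx \<Rightarrow> real"
  shows "(\<Sum>(a, b)\<in>splits c. (if a = 0 then 1 else 0) * q b) = q c"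
proof -
  have "(\<Sum>(a, b)\<in>splits c. (if a = 0 then 1 else 0) * q b) = (\<Sum>(a, b)\<in>{(0 :: idx, c)}. (if a = 0 then 1 else 0) * q b)"
    by (rule sum.mono_neutral_right, simp)
      (auto simp: splits_def zero_prod_def split: if_splits)
  then show ?thesis by simp
qed

lemma conv_assoc:
  fixes p q r :: "idx \<Rightarrow> real"
  shows "(\<Sum>(d, e)\<in>splits c. (\<Sum>(a, b)\<in>splits d. p a * q b) * r e) =
    (\<Sum>(a, d)\<in>splits c. p a * (\<Sum>(b, e)\<in>splits d. q b * r e))"
proof -
  have "(\<Sum>(d, e)\<in>splits c. (\<Sum>(a, b)\<in>splits d. p a * q b) * r e) =
      (\<Sum>(d, e)\<in>splits c. \<Sum>(a, b)\<in>splits d. p a * q b * r e)"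
    by (intro sum.cong refl) (auto simp: sum_distrib_right intro!: sum.cong)
  also have "\<dots> = (\<Sum>(a, d)\<in>splits c. \<Sum>(b, e)\<in>splits d. p a * q b * r e)"
    by (rule sum_splits_assoc)
  also have "\<dots> = (\<Sum>(a, d)\<in>splits c. p a * (\<Sum>(b, e)\<in>splits d. q b * r e))"
    by (intro sum.cong refl) (auto simp: sum_distrib_left mult.assoc intro!: sum.cong)
  finally show ?thesis .
qed

lemma conv_commute:
  fixes p q :: "idx \<Rightarrow> real"
  shows "(\<Sum>(a, b)\<in>splits c. p a * q b) = (\<Sum>(a, b)\<in>splits c. q a * p b)"
  by (subst sum.reindex_bij_betw[OF splits_comm_bij, symmetric])
    (simp add: case_prod_unfold mult.commute)

instantiation wps :: "{real_normed_algebra_1, comm_ring_1}"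
begin

lift_definition one_wps :: wps is "\<lambda>a. if a = 0 then 1 else 0"
  by (rule summable_on_cong_neutral[THEN iffD1, of _ "{0}" _ "\<lambda>_. 1"]) auto

lift_definition times_wps :: "wps \<Rightarrow> wps \<Rightarrow> wps" is "\<lambda>p q c. \<Sum>(a, b)\<in>splits c. p a * q b"
  by (rule conv_summable)

instance
proof
  fix p q r :: wps and s :: real
  show "p * q * r = p * (q * r)"
    by transfer (rule ext, rule conv_assoc)
  show pq: "p * q = q * p" for p q :: wps
    by transfer (rule ext, rule conv_commute)
  show "1 * p = p"
    by transfer (simp only: sum_splits_one)
  then show "p * 1 = p" by (simp add: pq)
  show "(p + q) * r = p * r + q * r"
    by transfer (simp add: fun_eq_iff sum.distrib case_prod_unfold distrib_right)
  then show "r * (p + q) = r * p + r * q" by (simp add: pq)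
  show "(0::wps) \<noteq> 1" by transfer (metis zero_neq_one)
  show "s *\<^sub>R p * q = s *\<^sub>R (p * q)"
    by transfer (simp add: fun_eq_iff sum_distrib_left case_prod_unfold mult_ac)
  then show "p * s *\<^sub>R q = s *\<^sub>R (p * q)"
    by transfer (simp add: fun_eq_iff sum_distrib_left case_prod_unfold mult_ac)
  have "norm (p * q) \<le> infsum (\<lambda>c. \<Sum>x\<in>splits c. case x of (a, b) \<Rightarrow>
      (\<bar>coeff p a\<bar> * wt a) * (\<bar>coeff q b\<bar> * wt b)) UNIV"
    unfolding norm_wps_def
    by (intro infsum_mono summable_coeff sum_splits_infsum summable_on_product_real)
      (simp add: times_wps.rep_eq conv_weighted_le)
  also have "\<dots> = norm p * norm q"
    unfolding norm_wps_def
    by (simp add: sum_splits_infsum summable_on_product_real summable_coeff)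
  finally show "norm (p * q) \<le> norm p * norm q" .
  have "norm (1::wps) = infsum (\<lambda>a. \<bar>coeff 1 a\<bar> * wt a) {0}"
    unfolding norm_wps_def
    by (rule infsum_cong_neutral) (auto simp: one_wps.rep_eq)
  then show "norm (1::wps) = 1" by (simp add: one_wps.rep_eq)
qed

end

lemma coeff_wt_le_norm: "\<bar>coeff p a\<bar> * wt a \<le> norm p"
  using finite_sum_le_infsum[OF summable_coeff[of p], of "{a}"] by (simp add: norm_wps_def)

lemma norm_wps_le:
  assumes "\<And>F. finite F \<Longrightarrow> (\<Sum>a\<in>F. \<bar>coeff p a\<bar> * wt a) \<le> B"
  shows "norm p \<le> B"
  unfolding norm_wps_def by (rule infsum_le_finite_sums[OF summable_coeff]) (use assms in auto)

instance wps :: banach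
proof
  fix X :: "nat \<Rightarrow> wps"
  assume X: "Cauchy X"
  have "Cauchy (\<lambda>n. coeff (X n) a)" for a
  proof (rule metric_CauchyI)
    fix e :: real assume "e > 0"
    then have "e * wt a > 0" using wt_pos by simp
    from metric_CauchyD[OF X this] obtain M where
      M: "\<And>m n. m \<ge> M \<Longrightarrow> n \<ge> M \<Longrightarrow> norm (X m - X n) < e * wt a" by (auto simp: dist_norm)
    have "dist (coeff (X m) a) (coeff (X n) a) < e" if "m \<ge> M" "n \<ge> M" for m n
    proof -
      have "\<bar>coeff (X m - X n) a\<bar> * wt a < e * wt a"
        using coeff_wt_le_norm M[OF that] by (rule le_less_trans)
      then show ?thesis using wt_pos[of a] by (simp add: minus_wps.rep_eq dist_real_def)
    qed
    then show "\<exists>M. \<forall>m\<ge>M. \<forall>n\<ge>M. dist (coeff (X m) a) (coeff (X n) a) < e" by blast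
  qed
  then have "\<exists>l. (\<lambda>n. coeff (X n) a) \<longlonglongrightarrow> l" for a
    by (simp add: Cauchy_convergent_iff convergent_def)
  then obtain l where l: "\<And>a. (\<lambda>n. coeff (X n) a) \<longlonglongrightarrow> l a" by metis
  \<comment> \<open>The Cauchy estimate passes to the coefficientwise limit over a finite
    \<open>F\<close>, where limit and sum commute; a bound uniform in \<open>F\<close> then bounds
    the norm.\<close>
  have fin: "\<exists>M. \<forall>n\<ge>M. \<forall>F. finite F \<longrightarrow> (\<Sum>a\<in>F. \<bar>l a - coeff (X n) a\<bar> * wt a) \<le> e" if "e > 0" for e
  proof -
    from metric_CauchyD[OF X that] obtain M where
      M: "\<And>m n. m \<ge> M \<Longrightarrow> n \<ge> M \<Longrightarrow> norm (X m - X n) < e" by (auto simp: dist_norm)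
    have "(\<Sum>a\<in>F. \<bar>l a - coeff (X n) a\<bar> * wt a) \<le> e" if n: "n \<ge> M" and F: "finite F" for n F
    proof (rule LIMSEQ_le_const2)
      show "(\<lambda>m. \<Sum>a\<in>F. \<bar>coeff (X m) a - coeff (X n) a\<bar> * wt a) \<longlonglongrightarrow> (\<Sum>a\<in>F. \<bar>l a - coeff (X n) a\<bar> * wt a)"
        by (intro tendsto_intros l)
      have "(\<Sum>a\<in>F. \<bar>coeff (X m) a - coeff (X n) a\<bar> * wt a) \<le> e" if "m \<ge> M" for m
        using finite_sum_le_infsum[OF summable_coeff[of "X m - X n"], of F] M[OF that n] F
        by (simp add: norm_wps_def minus_wps.rep_eq)
      then show "\<exists>N. \<forall>m\<ge>N. (\<Sum>a\<in>F. \<bar>coeff (X m) a - coeff (X n) a\<bar> * wt a) \<le> e" by blast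
    qed
    then show ?thesis by blast
  qed
  from fin[of 1] obtain M where M: "\<And>F. finite F \<Longrightarrow> (\<Sum>a\<in>F. \<bar>l a - coeff (X M) a\<bar> * wt a) \<le> 1" by auto
  have "(\<lambda>a. \<bar>l a - coeff (X M) a\<bar> * wt a) summable_on UNIV"
    by (rule nonneg_bdd_above_summable_on) (auto intro!: bdd_aboveI2[where M = 1] M)
  then have "(\<lambda>a. \<bar>l a - coeff (X M) a\<bar> * wt a + \<bar>coeff (X M) a\<bar> * wt a) summable_on UNIV"
    by (intro summable_on_add summable_coeff)
  then have "(\<lambda>a. \<bar>l a\<bar> * wt a) summable_on UNIV"
    by (rule summable_le) (auto simp: mult_right_mono simp flip: distrib_right)
  then obtain L where L: "coeff L = l" using wps_of_inverse by blast
  have "X \<longlonglongrightarrow> L"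
  proof (rule metric_LIMSEQ_I)
    fix e :: real assume "e > 0"
    with fin[of "e / 2"] obtain N where N: "\<And>n F. n \<ge> N \<Longrightarrow> finite F \<Longrightarrow> 
        (\<Sum>a\<in>F. \<bar>l a - coeff (X n) a\<bar> * wt a) \<le> e / 2" by auto
    have "dist (X n) L < e" if "n \<ge> N" for n
    proof -
      have "norm (L - X n) \<le> e / 2"
        by (rule norm_wps_le) (use N[OF that] in \<open>simp add: minus_wps.rep_eq L\<close>)
      then show ?thesis using \<open>e > 0\<close> by (simp add: dist_norm norm_minus_commute)
    qed
    then show "\<exists>N. \<forall>n\<ge>N. dist (X n) L < e" by blast
  qed
  then show "convergent X" by (rule convergentI)
qed

section \<open>Evaluation and differentiation of power series\<close>

definition deg :: "idx \<Rightarrow> nat" where "deg = (\<lambda>(i, j, k). i + j + k)"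

definition mon :: "idx \<Rightarrow> real ^ 3 \<Rightarrow> real" where
  "mon = (\<lambda>(i, j, k) x. x $ 1 ^ i * x $ 2 ^ j * x $ 3 ^ k)"

definition dmon :: "3 \<Rightarrow> idx \<Rightarrow> real ^ 3 \<Rightarrow> real" where
  "dmon l = (\<lambda>(i, j, k) x.
     if l = 1 then real i * x $ 1 ^ (i - 1) * x $ 2 ^ j * x $ 3 ^ k
     else if l = 2 then x $ 1 ^ i * (real j * x $ 2 ^ (j - 1)) * x $ 3 ^ k
     else x $ 1 ^ i * x $ 2 ^ j * (real k * x $ 3 ^ (k - 1)))"

definition unit_idx :: "3 \<Rightarrow> idx" where
  "unit_idx l = (if l = 1 then (1, 0, 0) else if l = 2 then (0, 1, 0) else (0, 0, 1))"

definition dcoeff :: "3 \<Rightarrow> (idx \<Rightarrow> real) \<Rightarrow> idx \<Rightarrow> real" where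
  "dcoeff l c = (\<lambda>(i, j, k).
     (if l = 1 then real (i + 1) else if l = 2 then real (j + 1) else real (k + 1)) *
     c ((i, j, k) + unit_idx l))"

definition psum :: "(idx \<Rightarrow> real) \<Rightarrow> real ^ 3 \<Rightarrow> real" where
  "psum c x = infsum (\<lambda>a. c a * mon a x) UNIV"

text \<open>The number 8 is the growth rate that the weights allow, see \<open>wt_ge\<close>. Asking
  for every \<open>r > 8\<close> instead of 8 itself makes the class stable under differentiation,
  which costs a factor linear in the degree.\<close>

definition tempered :: "(idx \<Rightarrow> real) \<Rightarrow> bool" where
  "tempered c \<longleftrightarrow> (\<forall>r>8. \<exists>C. \<forall>a. \<bar>c a\<bar> \<le> C * r ^ deg a)"

text \<open>The coefficients are at most a constant times \<open>9 ^ deg a\<close>, so at radius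
  1/16 the series is dominated by powers of 9/16.\<close>

abbreviation dom0 :: "(real ^ 3) set" where "dom0 \<equiv> ball 0 (1 / 16)"

lemma mon_add: "mon (a + b) x = mon a x * mon b x"
  by (cases a; cases b) (simp add: mon_def power_add mult_ac)

lemma deg_add [simp]: "deg (a + b) = deg a + deg b"
  by (cases a; cases b) (simp add: deg_def)

lemma deg_unit [simp]: "deg (unit_idx l) = 1"
  by (simp add: deg_def unit_idx_def)

lemma abs_pow_component_le: "\<bar>x $ l ^ i\<bar> \<le> norm (x :: real ^ 3) ^ i"
  by (simp add: power_abs power_mono component_le_norm_cart)

lemma abs_mon_le: "\<bar>mon a x\<bar> \<le> norm x ^ deg a"
proof -
  obtain i j k where a: "a = (i, j, k)" by (cases a)
  have "\<bar>mon a x\<bar> = \<bar>x $ 1 ^ i\<bar> * \<bar>x $ 2 ^ j\<bar> * \<bar>x $ 3 ^ k\<bar>" by (simp add: a mon_def abs_mult)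
  also have "\<dots> \<le> norm x ^ i * norm x ^ j * norm x ^ k"
    by (intro mult_mono abs_pow_component_le) auto
  finally show ?thesis by (simp add: a deg_def power_add)
qed

lemma dmon_unit:
  "dmon l (a + unit_idx l) x = (case a of (i, j, k) \<Rightarrow>
     (if l = 1 then real (i + 1) else if l = 2 then real (j + 1) else real (k + 1))) * mon a x"
  by (cases a) (auto simp: dmon_def mon_def unit_idx_def)

lemma dmon_zero:
  assumes "a \<notin> range (\<lambda>a. a + unit_idx l)"
  shows "dmon l a x = 0"
proof (rule ccontr)
  assume nz: "dmon l a x \<noteq> 0"
  obtain i j k where a: "a = (i, j, k)" by (cases a)
  have "a = (a - unit_idx l) + unit_idx l"
    using nz by (auto simp: a dmon_def unit_idx_def split: if_splits)
  then show False using assms by blast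
qed

lemma abs_dmon_le: "\<bar>dmon l a x\<bar> \<le> real (deg a) * norm x ^ (deg a - 1)"
proof (cases "a \<in> range (\<lambda>a. a + unit_idx l)")
  case True
  then obtain b where b: "a = b + unit_idx l" by blast
  have "\<bar>dmon l a x\<bar> = \<bar>case b of (i, j, k) \<Rightarrow>
     (if l = 1 then real (i + 1) else if l = 2 then real (j + 1) else real (k + 1))\<bar> * \<bar>mon b x\<bar>"
    unfolding b dmon_unit by (rule abs_mult)
  also have "\<dots> \<le> real (deg b + 1) * norm x ^ deg b"
    by (intro mult_mono abs_mon_le) (auto simp: deg_def split: prod.split)
  finally show ?thesis by (simp add: b)
qed (simp add: dmon_zero)

lemma has_derivative_mon:
  "(mon a has_derivative (\<lambda>h. \<Sum>l\<in>UNIV. h $ l * dmon l a x)) (at x within S)"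
proof -
  obtain i j k where a: "a = (i, j, k)" by (cases a)
  have c: "((\<lambda>x. x $ l) has_derivative (\<lambda>h. h $ l)) (at x within S)" for l :: 3
    by (rule bounded_linear.has_derivative[OF bounded_linear_vec_nth has_derivative_ident])
  have "((\<lambda>x. x $ 1 ^ i * x $ 2 ^ j * x $ 3 ^ k) has_derivative
     (\<lambda>h. x $ 1 ^ i * x $ 2 ^ j * (real k * h $ 3 * x $ 3 ^ (k - 1)) +
       (x $ 1 ^ i * (real j * h $ 2 * x $ 2 ^ (j - 1)) + real i * h $ 1 * x $ 1 ^ (i - 1) * x $ 2 ^ j)
         * x $ 3 ^ k)) (at x within S)"
    by (intro has_derivative_mult has_derivative_power c)
  then show ?thesis
    by (simp add: a mon_def[abs_def] dmon_def sum_3 algebra_simps)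
qed

lemma summable_geometric_deg:
  assumes "0 \<le> q" "q < (1::real)"
  shows "(\<lambda>a. q ^ deg a) summable_on UNIV"
proof -
  have g: "(\<lambda>i::nat. q ^ i) summable_on UNIV"
    using assms by (subst summable_on_UNIV_nonneg_real_iff) auto
  show ?thesis
    using summable_on_product_real(1)[OF g summable_on_product_real(1)[OF g g]]
    by (simp add: deg_def power_add case_prod_unfold mult.assoc)
qed

lemma bounded_linear_times_geometric:
  assumes "0 \<le> q" "q < (1::real)"
  shows "\<exists>B>0. \<forall>n. real (n + 1) * q ^ n \<le> B"
proof -
  have "(\<lambda>n. real n * q ^ n + q ^ n) \<longlonglongrightarrow> 0 + 0"
    using assms by (intro tendsto_add powser_times_n_limit_0 LIMSEQ_power_zero) auto
  then have "Bseq (\<lambda>n. real n * q ^ n + q ^ n)" by (rule convergent_imp_Bseq[OF convergentI])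
  then obtain B where "B > 0" "\<And>n. \<bar>real n * q ^ n + q ^ n\<bar> \<le> B" by (auto simp: Bseq_def)
  then have "real (n + 1) * q ^ n \<le> B" for n
    using abs_le_D1 by (fastforce simp: algebra_simps)
  with \<open>B > 0\<close> show ?thesis by blast
qed

lemma temperedE:
  assumes "tempered c" "r > 8"
  obtains C where "C > 0" "\<And>a. \<bar>c a\<bar> \<le> C * r ^ deg a"
proof -
  from assms obtain C where C: "\<And>a. \<bar>c a\<bar> \<le> C * r ^ deg a" unfolding tempered_def by blast
  have "\<bar>c a\<bar> \<le> (\<bar>C\<bar> + 1) * r ^ deg a" for a
    by (rule order_trans[OF C[of a]]) (use assms(2) in \<open>auto intro!: mult_right_mono\<close>)
  then show ?thesis using that[of "\<bar>C\<bar> + 1"] by auto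
qed

lemma tempered_dcoeff:
  assumes "tempered c"
  shows "tempered (dcoeff l c)"
  unfolding tempered_def
proof (intro allI impI)
  fix r :: real assume r: "r > 8"
  \<comment> \<open>A rate strictly between 8 and \<open>r\<close>: the factor
    \<open>deg a + 1\<close> from differentiation is absorbed by
    \<open>(s / r) ^ deg a\<close>.\<close>
  define s where "s = (r + 8) / 2"
  have s: "s > 8" "s < r" "s > 0" using r by (auto simp: s_def)
  obtain C where C: "C > 0" "\<And>a. \<bar>c a\<bar> \<le> C * s ^ deg a" using temperedE[OF assms s(1)] by blast
  obtain B where B: "B > 0" "\<And>n. real (n + 1) * (s / r) ^ n \<le> B"
    using bounded_linear_times_geometric[of "s / r"] s r by auto
  have "\<bar>dcoeff l c a\<bar> \<le> C * s * B * r ^ deg a" for a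
  proof -
    have "\<bar>dcoeff l c a\<bar> = \<bar>case a of (i, j, k) \<Rightarrow>
        if l = 1 then real (i + 1) else if l = 2 then real (j + 1) else real (k + 1)\<bar> * \<bar>c (a + unit_idx l)\<bar>"
      by (cases a) (simp add: dcoeff_def abs_mult)
    also have "\<dots> \<le> real (deg a + 1) * (C * s ^ (deg a + 1))"
    proof (rule mult_mono)
      show "\<bar>c (a + unit_idx l)\<bar> \<le> C * s ^ (deg a + 1)" using C(2)[of "a + unit_idx l"] by simp
    qed (auto simp: deg_def split: prod.split)
    also have "\<dots> = C * s * (real (deg a + 1) * (s / r) ^ deg a) * r ^ deg a"
      using s r by (simp add: field_simps)
    also have "\<dots> \<le> C * s * B * r ^ deg a"
      using C s r B by (intro mult_right_mono mult_left_mono) auto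
    finally show ?thesis .
  qed
  then show "\<exists>C. \<forall>a. \<bar>dcoeff l c a\<bar> \<le> C * r ^ deg a" by blast
qed

lemma tempered_bound:
  assumes "tempered c"
  obtains C where "C > 0" "\<And>a. \<bar>c a\<bar> \<le> C * 9 ^ deg a"
  using temperedE[OF assms, of 9] by auto

lemma psum_summable:
  assumes "tempered c" "x \<in> dom0"
  shows "(\<lambda>a. c a * mon a x) summable_on UNIV"
proof -
  obtain C where C: "C > 0" "\<And>a. \<bar>c a\<bar> \<le> C * 9 ^ deg a" using tempered_bound[OF assms(1)] by blast
  have "(\<lambda>a. norm (c a * mon a x)) summable_on UNIV"
  proof (rule summable_le[OF summable_on_cmult_right[OF summable_geometric_deg[of "9/16"]]])
    fix a
    have "norm (c a * mon a x) = \<bar>c a\<bar> * \<bar>mon a x\<bar>" by (simp add: abs_mult)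
    also have "\<dots> \<le> (C * 9 ^ deg a) * (1/16) ^ deg a"
      using C assms(2) by (intro mult_mono order_trans[OF abs_mon_le] power_mono) auto
    also have "\<dots> = C * (9/16) ^ deg a" by (simp add: power_divide)
    finally show "norm (c a * mon a x) \<le> C * (9/16) ^ deg a" .
  qed auto
  then show ?thesis by (rule Infinite_Sum.abs_summable_summable)
qed

text \<open>Termwise differentiation is carried out for sequences; this enumeration of the exponents
  links it to the unordered sums in \<open>psum\<close>.\<close>

definition nat_idx :: "nat \<Rightarrow> idx" where
  "nat_idx n = map_prod id prod_decode (prod_decode n)"

lemma bij_nat_idx: "bij nat_idx"
proof -
  have "bij (map_prod (id :: nat \<Rightarrow> nat) prod_decode)"
    using bij_prod_decode by (simp add: bij_def map_prod_surj prod.inj_map)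
  then have "bij (map_prod id prod_decode \<circ> prod_decode)"
    using bij_prod_decode bij_comp by blast
  then show ?thesis by (simp add: nat_idx_def[abs_def] comp_def)
qed

text \<open>Monomials free of the variable \<open>l\<close> have derivative zero, so the shift by
  \<open>unit_idx l\<close> turns the series of termwise derivatives into a power series
  again.\<close>

lemma dmon_sums:
  assumes "tempered c" "x \<in> dom0"
  shows "(\<lambda>n. c (nat_idx n) * dmon l (nat_idx n) x) sums psum (dcoeff l c) x"
proof -
  have "((\<lambda>a. dcoeff l c a * mon a x) has_sum psum (dcoeff l c) x) UNIV"
    unfolding psum_def by (intro has_sum_infsum psum_summable tempered_dcoeff assms)
  also have "(\<lambda>a. dcoeff l c a * mon a x) = (\<lambda>a. c a * dmon l a x) \<circ> (\<lambda>a. a + unit_idx l)"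
    by (auto simp: fun_eq_iff dmon_unit dcoeff_def)
  finally have "((\<lambda>a. c a * dmon l a x) has_sum psum (dcoeff l c) x) (range (\<lambda>a. a + unit_idx l))"
    by (subst has_sum_reindex) (auto simp: comp_def inj_on_def)
  then have "((\<lambda>a. c a * dmon l a x) has_sum psum (dcoeff l c) x) UNIV"
    by (rule has_sum_cong_neutral[THEN iffD1, rotated -1]) (auto simp: dmon_zero)
  then have "((\<lambda>n. c (nat_idx n) * dmon l (nat_idx n) x) has_sum psum (dcoeff l c) x) UNIV"
    using has_sum_reindex_bij_betw[OF bij_nat_idx, of "\<lambda>a. c a * dmon l a x"] by simp
  then show ?thesis by (rule has_sum_imp_sums)
qed

lemma psum_sums:
  assumes "tempered c" "x \<in> dom0"
  shows "(\<lambda>n. c (nat_idx n) * mon (nat_idx n) x) sums psum c x"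
proof -
  have "((\<lambda>a. c a * mon a x) has_sum psum c x) UNIV"
    unfolding psum_def by (intro has_sum_infsum psum_summable assms)
  then have "((\<lambda>n. c (nat_idx n) * mon (nat_idx n) x) has_sum psum c x) UNIV"
    using has_sum_reindex_bij_betw[OF bij_nat_idx, of "\<lambda>a. c a * mon a x"] by simp
  then show ?thesis by (rule has_sum_imp_sums)
qed

lemma dmon_uniform_limit:
  assumes "tempered c"
  shows "uniform_limit dom0 (\<lambda>N x. \<Sum>n<N. c (nat_idx n) * dmon l (nat_idx n) x)
    (\<lambda>x. psum (dcoeff l c) x) sequentially"
proof -
  obtain C where C: "C > 0" "\<And>a. \<bar>c a\<bar> \<le> C * 9 ^ deg a" using tempered_bound[OF assms(1)] by blast
  obtain B where B: "B > 0" "\<And>n. real (n + 1) * (9/10) ^ n \<le> B"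
    using bounded_linear_times_geometric[of "9/10"] by auto
  \<comment> \<open>Since 9/16 = (9/10)(5/8), the first factor absorbs \<open>deg a\<close> and the
    second remains summable. The 16 makes up for the exponent \<open>deg a - 1\<close> of a
    differentiated monomial.\<close>
  define M where "M a = 16 * C * B * (5/8) ^ deg a" for a
  have le: "norm (c a * dmon l a x) \<le> M a" if "x \<in> dom0" for a x
  proof -
    have "norm (c a * dmon l a x) = \<bar>c a\<bar> * \<bar>dmon l a x\<bar>" by (simp add: abs_mult)
    also have "\<dots> \<le> (C * 9 ^ deg a) * (real (deg a) * (1/16) ^ (deg a - 1))"
      using C that
      by (intro mult_mono order_trans[OF abs_dmon_le] mult_left_mono power_mono) auto
    also have "\<dots> = 16 * C * (real (deg a) * (9/10) ^ deg a) * (5/8) ^ deg a"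
    proof (cases "deg a")
      case (Suc n)
      have "(9/10) ^ Suc n * (5/8) ^ Suc n = (9/16 :: real) ^ Suc n"
        by (simp only: power_mult_distrib[symmetric]) simp
      moreover have "9 ^ Suc n * (1/16) ^ n = 16 * (9/16 :: real) ^ Suc n"
        by (simp add: power_divide)
      ultimately have "9 ^ Suc n * (1/16) ^ n = 16 * ((9/10) ^ Suc n * (5/8) ^ Suc n :: real)" by simp
      then have "C * real (Suc n) * (9 ^ Suc n * (1/16) ^ n) =
          C * real (Suc n) * (16 * ((9/10) ^ Suc n * (5/8) ^ Suc n))" by (simp only:)
      then show ?thesis unfolding Suc diff_Suc_1 by (simp only: mult_ac)
    qed simp
    also have "\<dots> \<le> M a"
      unfolding M_def using C B(2)[of "deg a"]
      by (intro mult_right_mono mult_left_mono) (auto intro: order_trans[rotated] simp: algebra_simps)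
    finally show ?thesis .
  qed
  have "M summable_on UNIV"
    unfolding M_def by (intro summable_on_cmult_right summable_geometric_deg) auto
  then have "(\<lambda>n. M (nat_idx n)) summable_on UNIV"
    using summable_on_reindex_bij_betw[OF bij_nat_idx, of M] by simp
  then have "summable (\<lambda>n. M (nat_idx n))"
    by (subst (asm) summable_on_UNIV_nonneg_real_iff) (use C B in \<open>auto simp: M_def\<close>)
  then have "uniform_limit dom0 (\<lambda>N x. \<Sum>n<N. c (nat_idx n) * dmon l (nat_idx n) x)
      (\<lambda>x. \<Sum>n. c (nat_idx n) * dmon l (nat_idx n) x) sequentially"
    by (rule Weierstrass_m_test[rotated]) (use le in auto)
  then show ?thesis
    by (rule uniform_limit_cong'[THEN iffD1, rotated -1]) (use sums_unique[OF dmon_sums[OF assms]] in auto)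
qed

lemma GDERIV_psum:
  assumes c: "tempered c" and x: "x \<in> dom0"
  shows "GDERIV (psum c) x :> (\<chi> l. psum (dcoeff l c) x)"
proof -
  define g' where "g' x h = (\<Sum>l\<in>UNIV. h $ l * psum (dcoeff l c) x)" for x h :: "real ^ 3"
  have "\<exists>g. \<forall>x\<in>dom0. (\<lambda>n. c (nat_idx n) * mon (nat_idx n) x) sums g x \<and>
      (g has_derivative g' x) (at x within dom0)"
  proof (rule has_derivative_series)
    show "((\<lambda>x. c (nat_idx n) * mon (nat_idx n) x) has_derivative
        (\<lambda>h. c (nat_idx n) * (\<Sum>l\<in>UNIV. h $ l * dmon l (nat_idx n) x))) (at x within dom0)" for n x
      by (intro has_derivative_mult_right has_derivative_mon)
    show "\<forall>\<^sub>F N in sequentially. \<forall>x\<in>dom0. \<forall>h.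
       norm ((\<Sum>n<N. c (nat_idx n) * (\<Sum>l\<in>UNIV. h $ l * dmon l (nat_idx n) x)) - g' x h) \<le> e * norm h"
      if "e > 0" for e
    proof -
      have "\<forall>\<^sub>F N in sequentially. \<forall>x\<in>dom0.
          dist (\<Sum>n<N. c (nat_idx n) * dmon l (nat_idx n) x) (psum (dcoeff l c) x) < e / 3" for l
        using uniform_limitD[OF dmon_uniform_limit[OF c, of l], of "e / 3"] that by simp
      then have "\<forall>\<^sub>F N in sequentially. \<forall>l\<in>UNIV. \<forall>x\<in>dom0.
          dist (\<Sum>n<N. c (nat_idx n) * dmon l (nat_idx n) x) (psum (dcoeff l c) x) < e / 3"
        by (intro eventually_ball_finite) auto
      then show ?thesis
      proof eventually_elim
        case (elim N)
        show ?case
        proof (intro ballI allI)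
          fix x h :: "real ^ 3" assume x: "x \<in> dom0"
          have "(\<Sum>n<N. c (nat_idx n) * (\<Sum>l\<in>UNIV. h $ l * dmon l (nat_idx n) x)) - g' x h
             = (\<Sum>l\<in>UNIV. h $ l * ((\<Sum>n<N. c (nat_idx n) * dmon l (nat_idx n) x) - psum (dcoeff l c) x))"
            by (simp add: g'_def sum_3 sum_distrib_left sum.distrib algebra_simps)
          also have "norm \<dots> \<le> (\<Sum>l\<in>(UNIV :: 3 set). norm h * (e / 3))"
          proof (intro sum_norm_le)
            fix l :: 3
            show "norm (h $ l * ((\<Sum>n<N. c (nat_idx n) * dmon l (nat_idx n) x) - psum (dcoeff l c) x))
                \<le> norm h * (e / 3)"
              unfolding norm_mult
              using elim x component_le_norm_cart[of h l]
              by (intro mult_mono) (auto simp: dist_real_def intro: less_imp_le)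
          qed
          finally show "norm ((\<Sum>n<N. c (nat_idx n) * (\<Sum>l\<in>UNIV. h $ l * dmon l (nat_idx n) x)) - g' x h) \<le> e * norm h"
            by (simp add: mult.commute)
        qed
      qed
    qed
    show "(\<lambda>n. c (nat_idx n) * mon (nat_idx n) x) sums psum c x" by (rule psum_sums[OF c x])
  qed (use x in auto)
  then obtain g where g: "\<And>x. x \<in> dom0 \<Longrightarrow> (\<lambda>n. c (nat_idx n) * mon (nat_idx n) x) sums g x"
    "\<And>x. x \<in> dom0 \<Longrightarrow> (g has_derivative g' x) (at x within dom0)" by blast
  have "g y = psum c y" if "y \<in> dom0" for y
    using sums_unique2[OF g(1)[OF that] psum_sums[OF c that]] .
  then have "(psum c has_derivative g' x) (at x)"
    using g(2)[OF x] x at_within_open[OF x open_ball] has_derivative_cong_open[OF open_ball x, of g "psum c"] by simp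
  moreover have "g' x = (\<lambda>h. h \<bullet> (\<chi> l. psum (dcoeff l c) x))"
    by (simp add: g'_def inner_vec_def fun_eq_iff)
  ultimately show ?thesis by (simp add: gderiv_def)
qed

lemma C_infinity_on_psum:
  assumes "tempered c"
  shows "C_infinity_on dom0 (psum c)"
  unfolding C_infinity_on_def
proof
  show "Ck_on k dom0 (psum c)" for k
    using assms
  proof (induction k arbitrary: c)
    case 0
    then show ?case
      by (auto intro!: continuous_at_imp_continuous_on dest!: GDERIV_psum simp: gderiv_def has_derivative_continuous)
  next
    case (Suc k)
    show ?case
      by (rule Ck_on_SucI[OF open_ball GDERIV_psum[OF Suc.prems]]) (simp_all add: Suc tempered_dcoeff)
  qed
qed

text \<open>All surviving monomials have degree at least \<open>d\<close>, so
  \<open>norm x ^ d\<close> splits off and the rest is compared with a geometric series of ratio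
  9/16, at the price of a factor \<open>16 ^ d\<close>.\<close>

lemma psum_order_bound:
  assumes "tempered c" "\<And>a. deg a < d \<Longrightarrow> c a = 0"
  shows "\<exists>K>0. \<forall>x\<in>dom0. \<bar>psum c x\<bar> \<le> K * norm x ^ d"
proof -
  obtain C where C: "C > 0" "\<And>a. \<bar>c a\<bar> \<le> C * 9 ^ deg a" using tempered_bound[OF assms(1)] by blast
  define S where "S = infsum (\<lambda>a. (9/16::real) ^ deg a) UNIV"
  have sum: "(\<lambda>a. (9/16::real) ^ deg a) summable_on UNIV" by (rule summable_geometric_deg) auto
  have S0: "S \<ge> 0" unfolding S_def by (rule infsum_nonneg) simp
  have "\<bar>psum c x\<bar> \<le> (C * 16 ^ d * (S + 1)) * norm x ^ d" if x: "x \<in> dom0" for x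
  proof -
    have "\<bar>c a * mon a x\<bar> \<le> (norm x ^ d * C * 16 ^ d) * (9/16) ^ deg a" for a
    proof (cases "deg a < d")
      case True
      then show ?thesis using assms(2) C by simp
    next
      case False
      have "\<bar>c a * mon a x\<bar> = \<bar>c a\<bar> * \<bar>mon a x\<bar>" by (rule abs_mult)
      also have "\<dots> \<le> (C * 9 ^ deg a) * (norm x ^ d * (1/16) ^ (deg a - d))"
      proof (intro mult_mono C)
        have "\<bar>mon a x\<bar> \<le> norm x ^ (d + (deg a - d))" using abs_mon_le[of a x] False by simp
        also have "\<dots> \<le> norm x ^ d * (1/16) ^ (deg a - d)"
          unfolding power_add using x by (intro mult_left_mono power_mono) auto
        finally show "\<bar>mon a x\<bar> \<le> norm x ^ d * (1/16) ^ (deg a - d)" .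
      qed (use C in auto)
      also have "\<dots> = (norm x ^ d * C * 16 ^ d) * (9/16) ^ deg a"
        using False by (simp add: power_divide power_diff field_simps)
      finally show ?thesis .
    qed
    then have "norm (psum c x) \<le> (norm x ^ d * C * 16 ^ d) * S"
      unfolding psum_def S_def
      by (intro norm_infsum_le[OF has_sum_infsum[OF psum_summable[OF assms(1) x]]
            has_sum_cmult_right[OF has_sum_infsum[OF sum]]]) auto
    also have "\<dots> \<le> (norm x ^ d * C * 16 ^ d) * (S + 1)"
      using C by (intro mult_left_mono) auto
    finally show ?thesis by (simp add: mult_ac)
  qed
  moreover have "C * 16 ^ d * (S + 1) > 0" using C S0 by simp
  ultimately show ?thesis by blast
qed

text \<open>The two binomial coefficients in \<open>wt_binomial\<close> and the factor
  \<open>2 ^ k\<close> are each at most \<open>2 ^ deg a\<close>, whence 8 = 2 * 2 * 2.\<close>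

lemma wt_ge: "1 \<le> wt a * 8 ^ deg a"
proof -
  obtain i j k where a: "a = (i, j, k)" by (cases a)
  let ?n = "i + j + k"
  have bin: "real (n choose l) \<le> 2 ^ n" for n l
    using of_nat_mono[OF binomial_le_pow2[of n l], where ?'a = real] by simp
  have "real (?n choose k) * real ((i + j) choose i) * 2 ^ k \<le> 2 ^ ?n * 2 ^ (i + j) * 2 ^ k"
    by (intro mult_mono bin) auto
  also have "\<dots> \<le> 2 ^ ?n * 2 ^ ?n * 2 ^ ?n"
    by (intro mult_mono power_increasing) auto
  also have "\<dots> = (2 * 2 * 2 :: real) ^ ?n" by (simp only: power_mult_distrib)
  finally have "real (?n choose k) * real ((i + j) choose i) * 2 ^ k \<le> 8 ^ deg a"
    by (simp add: a deg_def)
  moreover have "real (?n choose k) * real ((i + j) choose i) * 2 ^ k > 0"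
    by (simp add: zero_less_binomial)
  ultimately show ?thesis unfolding a wt_binomial by (simp add: divide_le_eq_1)
qed

lemma tempered_coeff: "tempered (coeff p)"
  unfolding tempered_def
proof (intro allI impI exI)
  fix r :: real and a assume r: "r > 8"
  have "\<bar>coeff p a\<bar> * 1 \<le> \<bar>coeff p a\<bar> * (wt a * 8 ^ deg a)" by (intro mult_left_mono wt_ge) simp
  also have "\<dots> \<le> norm p * 8 ^ deg a"
    using coeff_wt_le_norm[of p a] by (simp add: mult.assoc[symmetric])
  also have "\<dots> \<le> norm p * r ^ deg a" using r by (intro mult_left_mono power_mono) auto
  finally show "\<bar>coeff p a\<bar> \<le> norm p * r ^ deg a" by simp
qed

section \<open>Evaluation as a ring homomorphism\<close>

definition ev :: "wps \<Rightarrow> real ^ 3 \<Rightarrow> real" where "ev p = psum (coeff p)"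

lemma C_infinity_on_ev: "C_infinity_on dom0 (ev p)"
  unfolding ev_def by (rule C_infinity_on_psum[OF tempered_coeff])

lemma ev_add: "x \<in> dom0 \<Longrightarrow> ev (p + q) x = ev p x + ev q x"
  unfolding ev_def psum_def
  by (simp add: plus_wps.rep_eq distrib_right infsum_add psum_summable tempered_coeff)

lemma ev_scaleR: "ev (r *\<^sub>R p) x = r * ev p x"
  unfolding ev_def psum_def
  by (simp add: scaleR_wps.rep_eq mult.assoc infsum_cmult_right')

lemma ev_uminus: "ev (- p) x = - ev p x"
  using ev_scaleR[of "-1" p x] by simp

lemma ev_diff: "x \<in> dom0 \<Longrightarrow> ev (p - q) x = ev p x - ev q x"
  using ev_add[of x p "- q"] by (simp add: ev_uminus)

lemma ev_mult:
  assumes x: "x \<in> dom0"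
  shows "ev (p * q) x = ev p x * ev q x"
proof -
  let ?P = "\<lambda>a. coeff p a * mon a x" and ?Q = "\<lambda>a. coeff q a * mon a x"
  have s: "?P summable_on UNIV" "?Q summable_on UNIV"
    by (intro psum_summable tempered_coeff x)+
  have "coeff (p * q) c * mon c x = (\<Sum>y\<in>splits c. case y of (a, b) \<Rightarrow> ?P a * ?Q b)" for c
    unfolding times_wps.rep_eq sum_distrib_right
    by (intro sum.cong refl) (auto simp: splits_def mon_add mult_ac simp del: add_Pair)
  then have "ev (p * q) x = infsum (\<lambda>c. \<Sum>y\<in>splits c. case y of (a, b) \<Rightarrow> ?P a * ?Q b) UNIV"
    by (simp add: ev_def psum_def)
  also have "\<dots> = infsum ?P UNIV * infsum ?Q UNIV"
    using sum_splits_infsum(2)[OF summable_on_product_real(1)[OF s]] summable_on_product_real(2)[OF s]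
    by simp
  finally show ?thesis by (simp add: ev_def psum_def)
qed

lemma psum_single: "psum (\<lambda>a. if a = b then r else 0) x = r * mon b x"
proof -
  have "psum (\<lambda>a. if a = b then r else 0) x = infsum (\<lambda>a. (if a = b then r else 0) * mon a x) {b}"
    unfolding psum_def by (rule infsum_cong_neutral) auto
  then show ?thesis by simp
qed

lemma ev_one: "ev 1 x = 1"
  unfolding ev_def one_wps.rep_eq psum_single by (simp add: mon_def zero_prod_def)

lemma ev_zero: "ev 0 x = 0"
  using ev_scaleR[of 0 1 x] by simp

lemma ev_power: "x \<in> dom0 \<Longrightarrow> ev (p ^ n) x = ev p x ^ n"
  by (induction n) (auto simp: ev_one ev_mult)

lift_definition var :: "3 \<Rightarrow> wps" is "\<lambda>l a. if a = unit_idx l then 1 else 0"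
  by (rule summable_on_cong_neutral[THEN iffD1, of _ "{unit_idx l}" _ "\<lambda>_. wt (unit_idx l)" for l]) auto

lemma ev_var: "ev (var l) x = x $ l"
  using exhaust_3[of l]
  unfolding ev_def var.rep_eq psum_single by (auto simp: mon_def unit_idx_def)

section \<open>Order of vanishing at the origin\<close>

definition order_ge :: "nat \<Rightarrow> wps \<Rightarrow> bool" where
  "order_ge d p \<longleftrightarrow> (\<forall>a. deg a < d \<longrightarrow> coeff p a = 0)"

lemma order_geD: "order_ge d p \<Longrightarrow> deg a < d \<Longrightarrow> coeff p a = 0"
  unfolding order_ge_def by blast

lemma order_ge_0 [simp]: "order_ge 0 p"
  by (simp add: order_ge_def)

lemma order_ge_zero [simp]: "order_ge d 0"
  by (simp add: order_ge_def zero_wps.rep_eq)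

lemma order_ge_mono: "order_ge d p \<Longrightarrow> e \<le> d \<Longrightarrow> order_ge e p"
  by (simp add: order_ge_def)

lemma order_ge_add: "order_ge d p \<Longrightarrow> order_ge d q \<Longrightarrow> order_ge d (p + q)"
  by (simp add: order_ge_def plus_wps.rep_eq)

lemma order_ge_diff: "order_ge d p \<Longrightarrow> order_ge d q \<Longrightarrow> order_ge d (p - q)"
  by (simp add: order_ge_def minus_wps.rep_eq)

lemma order_ge_uminus: "order_ge d p \<Longrightarrow> order_ge d (- p)"
  by (simp add: order_ge_def uminus_wps.rep_eq)

lemma order_ge_scaleR: "order_ge d p \<Longrightarrow> order_ge d (r *\<^sub>R p)"
  by (simp add: order_ge_def scaleR_wps.rep_eq)

lemma order_ge_mult:
  assumes "order_ge d p" "order_ge e q"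
  shows "order_ge (d + e) (p * q)"
  unfolding order_ge_def times_wps.rep_eq
proof (intro allI impI sum.neutral ballI)
  fix c x assume c: "deg c < d + e" and x: "x \<in> splits c"
  obtain a b where ab: "x = (a, b)" by (cases x)
  then have "deg a + deg b < d + e" using c x by (auto simp: splits_def simp del: add_Pair)
  then have "deg a < d \<or> deg b < e" by linarith
  then show "(case x of (a, b) \<Rightarrow> coeff p a * coeff q b) = 0"
    using order_geD[OF assms(1), of a] order_geD[OF assms(2), of b]
    by (auto simp only: ab prod.case mult_zero_left mult_zero_right)
qed

lemma order_ge_power: "order_ge d p \<Longrightarrow> order_ge (n * d) (p ^ n)"
  by (induction n) (auto intro: order_ge_mult)

lemma order_ge_var: "order_ge 1 (var l)"
  by (auto simp: order_ge_def var.rep_eq)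

text \<open>Coefficients depend continuously on the series in norm. Closedness makes the set on
  which the contraction acts complete.\<close>

lemma closed_order_ge: "closed {p. order_ge d p}"
  unfolding closed_sequential_limits
proof (intro allI impI, elim conjE)
  fix X :: "nat \<Rightarrow> wps" and L
  assume X: "\<forall>n. X n \<in> {p. order_ge d p}" "X \<longlonglongrightarrow> L"
  have "coeff L a = 0" if "deg a < d" for a
  proof -
    have "\<bar>coeff L a\<bar> * wt a \<le> norm (L - X n)" for n
      using coeff_wt_le_norm[of "L - X n" a] order_geD[OF _ that, of "X n"] X(1)
      by (simp add: minus_wps.rep_eq)
    moreover have "(\<lambda>n. norm (L - X n)) \<longlonglongrightarrow> norm (L - L)" by (intro tendsto_intros X)
    ultimately have "\<bar>coeff L a\<bar> * wt a \<le> 0" by (intro LIMSEQ_le_const) auto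
    then show ?thesis using wt_pos[of a] by (simp add: mult_le_0_iff)
  qed
  then show "L \<in> {p. order_ge d p}" by (simp add: order_ge_def)
qed

lemma ev_order_bound:
  "order_ge d p \<Longrightarrow> \<exists>K>0. \<forall>x\<in>dom0. \<bar>ev p x\<bar> \<le> K * norm x ^ d"
  unfolding ev_def by (rule psum_order_bound[OF tempered_coeff]) (rule order_geD)

text \<open>Common estimate for operators that move the coefficient at \<open>\<sigma> a\<close> to
  \<open>a\<close> with a factor \<open>\<kappa> a\<close>. As \<open>\<sigma>\<close> is injective,
  no coefficient is counted twice, so bounding each factor by half the ratio of the weights bounds
  the operator norm by 1/2.\<close>

lemma weighted_shift:
  assumes c: "(\<lambda>a. \<bar>c a\<bar> * wt a) summable_on UNIV" and inj: "inj_on \<sigma> P"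
    and \<kappa>: "\<And>a. a \<in> P \<Longrightarrow> \<bar>\<kappa> a\<bar> * wt a \<le> wt (\<sigma> a) / 2"
  shows "(\<lambda>a. \<bar>if a \<in> P then \<kappa> a * c (\<sigma> a) else 0\<bar> * wt a) summable_on UNIV" (is ?A)
    and "infsum (\<lambda>a. \<bar>if a \<in> P then \<kappa> a * c (\<sigma> a) else 0\<bar> * wt a) UNIV
      \<le> infsum (\<lambda>a. \<bar>c a\<bar> * wt a) UNIV / 2" (is ?B)
proof -
  let ?g = "\<lambda>b. \<bar>c b\<bar> * wt b / 2"
  have c2: "?g summable_on UNIV"
    using summable_on_cmult_right[OF c, of "1/2"] by simp
  then have "?g summable_on (\<sigma> ` P)" by (rule summable_on_subset) simp
  then have s: "(?g \<circ> \<sigma>) summable_on P" by (subst (asm) summable_on_reindex[OF inj])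
  have le: "\<bar>if a \<in> P then \<kappa> a * c (\<sigma> a) else 0\<bar> * wt a \<le> (if a \<in> P then (?g \<circ> \<sigma>) a else 0)" for a
    using mult_left_mono[OF \<kappa>, of a "\<bar>c (\<sigma> a)\<bar>"] by (auto simp: abs_mult mult_ac)
  have s2: "(\<lambda>a. if a \<in> P then (?g \<circ> \<sigma>) a else 0) summable_on UNIV"
    by (rule summable_on_cong_neutral[THEN iffD1, OF _ _ _ s]) auto
  show A: ?A
    by (rule summable_le[OF s2 _ le]) simp
  have "infsum (\<lambda>a. \<bar>if a \<in> P then \<kappa> a * c (\<sigma> a) else 0\<bar> * wt a) UNIV
      \<le> infsum (\<lambda>a. if a \<in> P then (?g \<circ> \<sigma>) a else 0) UNIV"
    by (rule infsum_mono[OF A s2 le])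
  also have "\<dots> = infsum (?g \<circ> \<sigma>) P" by (rule infsum_cong_neutral) auto
  also have "\<dots> = infsum ?g (\<sigma> ` P)" by (rule infsum_reindex[OF inj, symmetric])
  also have "\<dots> \<le> infsum ?g UNIV"
    by (rule infsum_mono_neutral[OF _ c2]) (use \<open>?g summable_on (\<sigma> ` P)\<close> in auto)
  also have "\<dots> = infsum (\<lambda>a. \<bar>c a\<bar> * wt a) UNIV / 2"
    using infsum_cmult_left'[of "\<lambda>a. \<bar>c a\<bar> * wt a" "1/2" UNIV] by simp
  finally show ?B .
qed

text \<open>\<open>zint\<close> integrates in the third variable, \<open>zint_d1\<close> and \<open>zint_d2\<close> in addition differentiate in
  the first or second one. The weights \<open>wt\<close> are chosen such that all three are bounded.\<close>

abbreviation zpos :: "idx set" where "zpos \<equiv> {a. snd (snd a) > 0}"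

text \<open>With one derivative included, source and target index have the same total degree and the
  weights match exactly. Pure integration raises the degree by one, which leaves an additional
  factor \<open>1 / (i + j + k)\<close>, at most 1.\<close>

lemma wt_zint:
  assumes "k > 0"
  shows "1 / real k * wt (i, j, k) \<le> wt (i, j, k - 1) / 2"
    and "real (i + 1) / real k * wt (i, j, k) = wt (i + 1, j, k - 1) / 2"
    and "real (j + 1) / real k * wt (i, j, k) = wt (i, j + 1, k - 1) / 2"
proof -
  obtain l where k: "k = Suc l" using assms by (cases k) auto
  have "1 / real k * wt (i, j, k) = fact i * fact j * fact l / (real (i + j + k) * fact (i + j + l) * 2 ^ k)"
    using assms fact_Suc[of l, where ?'a = real] fact_Suc[of "i + j + l", where ?'a = real]
    unfolding wt_def by (simp add: k del: fact_Suc)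
  also have "\<dots> \<le> fact i * fact j * fact l / (1 * fact (i + j + l) * 2 ^ k)"
    by (intro divide_left_mono mult_right_mono mult_pos_pos) (auto simp: k)
  also have "\<dots> = wt (i, j, k - 1) / 2" by (simp add: k wt_def)
  finally show "1 / real k * wt (i, j, k) \<le> wt (i, j, k - 1) / 2" .
  let ?A = "fact i * fact j * fact l :: real" and ?F = "fact (i + j + k) :: real"
  have fk: "fact k = real k * fact l" by (simp add: k)
  have w: "wt (i, j, k) = real k * (?A / (?F * 2 ^ k))"
    unfolding wt_def by (simp add: fk)
  have p: "(2::real) ^ k = 2 * 2 ^ (k - 1)" by (simp add: k)
  have idx: "i + 1 + j + (k - 1) = i + j + k" "i + (j + 1) + (k - 1) = i + j + k" by (simp_all add: k)
  have 1: "wt (i + 1, j, k - 1) / 2 = real (i + 1) * (?A / (?F * 2 ^ k))"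
    unfolding wt_def prod.case idx p by (simp add: k del: fact_Suc, simp add: algebra_simps)
  have 2: "wt (i, j + 1, k - 1) / 2 = real (j + 1) * (?A / (?F * 2 ^ k))"
    unfolding wt_def prod.case idx p by (simp add: k del: fact_Suc, simp add: algebra_simps)
  show "real (i + 1) / real k * wt (i, j, k) = wt (i + 1, j, k - 1) / 2"
    "real (j + 1) / real k * wt (i, j, k) = wt (i, j + 1, k - 1) / 2"
    unfolding 1 2 w using assms by simp_all
qed

lemma zpos_shift_bounds:
  "a \<in> zpos \<Longrightarrow> \<bar>case a of (i, j, k) \<Rightarrow> 1 / real k\<bar> * wt a \<le> wt (case a of (i, j, k) \<Rightarrow> (i, j, k - 1)) / 2"
  "a \<in> zpos \<Longrightarrow> \<bar>case a of (i, j, k) \<Rightarrow> real (i + 1) / real k\<bar> * wt a \<le> wt (case a of (i, j, k) \<Rightarrow> (i + 1, j, k - 1)) / 2"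
  "a \<in> zpos \<Longrightarrow> \<bar>case a of (i, j, k) \<Rightarrow> real (j + 1) / real k\<bar> * wt a \<le> wt (case a of (i, j, k) \<Rightarrow> (i, j + 1, k - 1)) / 2"
  using wt_zint by (cases a, simp)+

lemma zpos_inj:
  "inj_on (\<lambda>a. case a of (i, j, k) \<Rightarrow> (i, j, k - 1)) zpos"
  "inj_on (\<lambda>a. case a of (i, j, k) \<Rightarrow> (i + 1, j, k - 1)) zpos"
  "inj_on (\<lambda>a. case a of (i, j, k) \<Rightarrow> (i, j + 1, k - 1)) zpos"
  by (auto simp: inj_on_def)

lift_definition zint :: "wps \<Rightarrow> wps" is
  "\<lambda>c a. if a \<in> zpos then (case a of (i, j, k) \<Rightarrow> 1 / real k) * c (case a of (i, j, k) \<Rightarrow> (i, j, k - 1)) else 0"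
  by (rule weighted_shift(1)[OF _ zpos_inj(1) zpos_shift_bounds(1)])

lift_definition zint_d1 :: "wps \<Rightarrow> wps" is
  "\<lambda>c a. if a \<in> zpos then (case a of (i, j, k) \<Rightarrow> real (i + 1) / real k) * c (case a of (i, j, k) \<Rightarrow> (i + 1, j, k - 1)) else 0"
  by (rule weighted_shift(1)[OF _ zpos_inj(2) zpos_shift_bounds(2)])

lift_definition zint_d2 :: "wps \<Rightarrow> wps" is
  "\<lambda>c a. if a \<in> zpos then (case a of (i, j, k) \<Rightarrow> real (j + 1) / real k) * c (case a of (i, j, k) \<Rightarrow> (i, j + 1, k - 1)) else 0"
  by (rule weighted_shift(1)[OF _ zpos_inj(3) zpos_shift_bounds(3)])

lemma norm_zint_d1: "norm (zint_d1 p) \<le> norm p / 2"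
  unfolding norm_wps_def zint_d1.rep_eq
  by (rule weighted_shift(2)[OF summable_coeff zpos_inj(2) zpos_shift_bounds(2)])

lemma norm_zint_d2: "norm (zint_d2 p) \<le> norm p / 2"
  unfolding norm_wps_def zint_d2.rep_eq
  by (rule weighted_shift(2)[OF summable_coeff zpos_inj(3) zpos_shift_bounds(3)])

lemma coeff_zint:
  "coeff (zint p) (i, j, k) = (if k > 0 then coeff p (i, j, k - 1) / real k else 0)"
  "coeff (zint_d1 p) (i, j, k) = (if k > 0 then real (i + 1) * coeff p (i + 1, j, k - 1) / real k else 0)"
  "coeff (zint_d2 p) (i, j, k) = (if k > 0 then real (j + 1) * coeff p (i, j + 1, k - 1) / real k else 0)"
  by (simp_all add: zint.rep_eq zint_d1.rep_eq zint_d2.rep_eq)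

lemma wps_eqI3: "(\<And>i j k. coeff p (i, j, k) = coeff q (i, j, k)) \<Longrightarrow> p = q"
  by (rule wps_eqI) (metis prod_cases3)

lemma zint_diff:
  "zint (p - q) = zint p - zint q" "zint_d1 (p - q) = zint_d1 p - zint_d1 q"
  "zint_d2 (p - q) = zint_d2 p - zint_d2 q"
  by (rule wps_eqI3, simp add: coeff_zint minus_wps.rep_eq right_diff_distrib diff_divide_distrib)+

lemma zint_zero [simp]: "zint 0 = 0" "zint_d1 0 = 0" "zint_d2 0 = 0"
  by (rule wps_eqI3, simp add: coeff_zint zero_wps.rep_eq)+

text \<open>Symmetry of mixed derivatives, in the form required for iterated integrals such as
  \<open>zint (zint \<omega>)\<close>.\<close>

lemma zint_d_zint: "zint_d1 (zint p) = zint (zint_d1 p)" "zint_d2 (zint p) = zint (zint_d2 p)"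
    "zint_d2 (zint_d1 p) = zint_d1 (zint_d2 p)"
  by (rule wps_eqI3, simp add: coeff_zint)+

lemma dcoeff_zint:
  "dcoeff 1 (coeff (zint p)) = coeff (zint_d1 p)" "dcoeff 2 (coeff (zint p)) = coeff (zint_d2 p)"
  "dcoeff 3 (coeff (zint p)) = coeff p"
  by (rule ext, simp add: dcoeff_def unit_idx_def coeff_zint split: prod.split)+

lemma GDERIV_ev_zint:
  assumes "x \<in> dom0"
  shows "GDERIV (ev (zint p)) x :> vector [ev (zint_d1 p) x, ev (zint_d2 p) x, ev p x]"
proof -
  have "(\<chi> l. psum (dcoeff l (coeff (zint p))) x) = vector [ev (zint_d1 p) x, ev (zint_d2 p) x, ev p x]"
    by (simp add: vec_eq_iff forall_3 dcoeff_zint ev_def)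
  then show ?thesis
    using GDERIV_psum[OF tempered_coeff assms, of "zint p"] unfolding ev_def by simp
qed

lemma order_ge_zint:
  assumes "order_ge d p"
  shows "order_ge (Suc d) (zint p)" "order_ge d (zint_d1 p)" "order_ge d (zint_d2 p)"
  unfolding order_ge_def
  by (auto simp: split_paired_all coeff_zint deg_def intro!: order_geD[OF assms])

section \<open>The equation near a degenerate point\<close>

text \<open>Real and imaginary part of \<open>(p + i q)^n\<close> over an arbitrary commutative
  ring, so that one expression serves real arguments and power series alike.\<close>

fun repow impow :: "nat \<Rightarrow> 'a::comm_ring_1 \<Rightarrow> 'a \<Rightarrow> 'a" where
  "repow 0 p q = 1"
| "repow (Suc n) p q = p * repow n p q - q * impow n p q"
| "impow 0 p q = 0"
| "impow (Suc n) p q = p * impow n p q + q * repow n p q"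

lemma repow_impow_norm: "repow n p q ^ 2 + impow n p q ^ 2 = (p\<^sup>2 + q\<^sup>2) ^ n"
proof (induction n)
  case (Suc n)
  have "repow (Suc n) p q ^ 2 + impow (Suc n) p q ^ 2 = (p\<^sup>2 + q\<^sup>2) * (repow n p q ^ 2 + impow n p q ^ 2)"
    by (simp add: power2_eq_square algebra_simps)
  then show ?case by (simp only: Suc power_Suc)
qed simp

lemma ev_repow:
  assumes "x \<in> dom0"
  shows "ev (repow n p q) x = repow n (ev p x) (ev q x)" and "ev (impow n p q) x = impow n (ev p x) (ev q x)"
  using assms by (induction n) (auto simp: ev_one ev_zero ev_mult ev_diff ev_add)

lemma order_ge_repow:
  assumes "order_ge 1 p" "order_ge 1 q"
  shows "order_ge n (repow n p q)" "order_ge n (impow n p q)"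
proof (induction n)
  case (Suc n)
  { case 1
    show ?case using order_ge_mult[OF assms(1) Suc(1)] order_ge_mult[OF assms(2) Suc(2)]
      by (auto intro: order_ge_diff) }
  { case 2
    show ?case using order_ge_mult[OF assms(1) Suc(2)] order_ge_mult[OF assms(2) Suc(1)]
      by (auto intro: order_ge_add) }
qed auto

lemma abs_repow_le: "\<bar>repow n p q\<bar> \<le> (\<bar>p\<bar> + \<bar>q\<bar>) ^ n \<and> \<bar>impow n p q\<bar> \<le> (\<bar>p\<bar> + \<bar>q\<bar>) ^ n" for p q :: real
proof (induction n)
  case (Suc n)
  have *: "\<bar>p\<bar> * \<bar>u\<bar> + \<bar>q\<bar> * \<bar>v\<bar> \<le> (\<bar>p\<bar> + \<bar>q\<bar>) ^ Suc n"
    if "\<bar>u\<bar> \<le> (\<bar>p\<bar> + \<bar>q\<bar>) ^ n" "\<bar>v\<bar> \<le> (\<bar>p\<bar> + \<bar>q\<bar>) ^ n" for u v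
    using mult_left_mono[OF that(1), of "\<bar>p\<bar>"] mult_left_mono[OF that(2), of "\<bar>q\<bar>"]
    by (simp add: algebra_simps)
  have "\<bar>repow (Suc n) p q\<bar> \<le> \<bar>p\<bar> * \<bar>repow n p q\<bar> + \<bar>q\<bar> * \<bar>impow n p q\<bar>"
    using abs_triangle_ineq4[of "p * repow n p q" "q * impow n p q"] by (simp add: abs_mult)
  moreover have "\<bar>impow (Suc n) p q\<bar> \<le> \<bar>p\<bar> * \<bar>impow n p q\<bar> + \<bar>q\<bar> * \<bar>repow n p q\<bar>"
    using abs_triangle_ineq[of "p * impow n p q" "q * repow n p q"] by (simp add: abs_mult)
  ultimately show ?case using *[of "repow n p q" "impow n p q"] *[of "impow n p q" "repow n p q"] Suc by linarith
qed simp

lemma repow_homogeneous: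
  "repow n (t * p) (t * q) = t ^ n * repow n p q" "impow n (t * p) (t * q) = t ^ n * impow n p q"
  by (induction n) (auto simp: algebra_simps)

lemma continuous_repow:
  "continuous_on UNIV (\<lambda>u::real. repow n 1 u)" "continuous_on UNIV (\<lambda>u::real. impow n 1 u)"
  by (induction n) (auto intro!: continuous_intros)

lemma repow_one_zero: "repow n p 0 = p ^ n" "impow n p 0 = 0"
  by (induction n) auto

text \<open>By homogeneity only \<open>q / z\<close> matters. In a cone around the z-axis the real
  part is, by continuity, at least half of its value on the axis; outside this cone \<open>z\<close>
  is controlled by \<open>q\<close> and everything is absorbed by the term with
  \<open>C\<close>.\<close>

lemma repow_even_lower:
  "\<exists>C>0. \<forall>z q::real. repow (2 * j) z q \<ge> z ^ (2 * j) / 2 - C * q ^ (2 * j)"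
proof -
  have "isCont (\<lambda>u::real. repow (2 * j) 1 u) 0"
    using continuous_repow(1) by (simp add: continuous_on_eq_continuous_at)
  then obtain t where t: "t > 0" "\<And>u::real. \<bar>u\<bar> < t \<Longrightarrow> \<bar>repow (2 * j) 1 u - 1\<bar> < 1 / 2"
    unfolding continuous_at_eps_delta
    by (elim allE[where x = "1/2"]) (auto simp: dist_real_def repow_one_zero)
  \<comment> \<open>Outside the cone the first summand accounts for
    \<open>- repow (2 * j) z q\<close>, the second for \<open>z ^ (2 * j)\<close>.\<close>
  define C where "C = (1 / t + 1) ^ (2 * j) + (1 / t) ^ (2 * j)"
  have C: "C > 0" using t unfolding C_def by (intro add_pos_pos zero_less_power) auto
  have "repow (2 * j) z q \<ge> z ^ (2 * j) / 2 - C * q ^ (2 * j)" for z q :: real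
  proof (cases "\<bar>q\<bar> < t * \<bar>z\<bar>")
    case True
    then have z: "z \<noteq> 0" by auto
    have "\<bar>q / z\<bar> < t" using True z by (simp add: field_simps)
    then have "repow (2 * j) 1 (q / z) \<ge> 1 / 2" using t(2)[of "q / z"] by linarith
    then have "z ^ (2 * j) * repow (2 * j) 1 (q / z) \<ge> z ^ (2 * j) * (1 / 2)"
      by (intro mult_left_mono) (auto simp: power_mult)
    then have "repow (2 * j) z q \<ge> z ^ (2 * j) / 2"
      using repow_homogeneous(1)[of "2 * j" z 1 "q / z"] z by simp
    moreover have "C * q ^ (2 * j) \<ge> 0" using C by (simp add: power_mult)
    ultimately show ?thesis by linarith
  next
    case False
    then have z: "\<bar>z\<bar> \<le> (1 / t) * \<bar>q\<bar>" using t by (simp add: field_simps)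
    have "- repow (2 * j) z q \<le> (\<bar>z\<bar> + \<bar>q\<bar>) ^ (2 * j)" using abs_repow_le[of "2 * j" z q] by linarith
    also have "\<dots> \<le> ((1 / t + 1) * \<bar>q\<bar>) ^ (2 * j)"
      using z by (intro power_mono) (auto simp: algebra_simps)
    also have "\<dots> = (1 / t + 1) ^ (2 * j) * q ^ (2 * j)"
      by (simp add: power_mult_distrib power_even_abs)
    finally have 1: "- repow (2 * j) z q \<le> (1 / t + 1) ^ (2 * j) * q ^ (2 * j)" .
    have "\<bar>z\<bar> ^ (2 * j) \<le> ((1 / t) * \<bar>q\<bar>) ^ (2 * j)" using z by (intro power_mono) auto
    then have "z ^ (2 * j) \<le> (1 / t) ^ (2 * j) * q ^ (2 * j)"
      by (simp add: power_mult_distrib power_divide power_even_abs)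
    moreover have "z ^ (2 * j) \<ge> 0" by (simp add: power_mult)
    ultimately show ?thesis using 1 by (simp add: C_def algebra_simps)
  qed
  with C show ?thesis by blast
qed

definition has_grad :: "(real ^ 3 \<Rightarrow> real) \<Rightarrow> real \<Rightarrow> real \<Rightarrow> real \<Rightarrow> real ^ 3 \<Rightarrow> bool" where
  "has_grad f a b c x \<longleftrightarrow> GDERIV f x :> vector [a, b, c]"

lemma has_grad_eqI: "has_grad f a b c x \<Longrightarrow> a = a' \<Longrightarrow> b = b' \<Longrightarrow> c = c' \<Longrightarrow> has_grad f a' b' c' x"
  by simp

lemma has_grad_const: "has_grad (\<lambda>x. r) 0 0 0 x"
  using GDERIV_const[of r x] by (simp add: has_grad_def vec_eq_iff forall_3 GDERIV_subst)

lemma has_grad_component: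
  "has_grad (\<lambda>x. x $ 1) 1 0 0 x" "has_grad (\<lambda>x. x $ 2) 0 1 0 x" "has_grad (\<lambda>x. x $ 3) 0 0 1 x"
  unfolding has_grad_def
  by (rule GDERIV_subst[OF GDERIV_component], simp add: vec_eq_iff forall_3 axis_def)+

lemma has_grad_add:
  "has_grad f a b c x \<Longrightarrow> has_grad g a' b' c' x \<Longrightarrow> has_grad (\<lambda>x. f x + g x) (a + a') (b + b') (c + c') x"
  unfolding has_grad_def by (drule (1) GDERIV_add, erule GDERIV_subst) (simp add: vec_eq_iff forall_3)

lemma has_grad_diff:
  "has_grad f a b c x \<Longrightarrow> has_grad g a' b' c' x \<Longrightarrow> has_grad (\<lambda>x. f x - g x) (a - a') (b - b') (c - c') x"
  unfolding has_grad_def by (drule (1) GDERIV_diff, erule GDERIV_subst) (simp add: vec_eq_iff forall_3)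

lemma has_grad_mult:
  "has_grad f a b c x \<Longrightarrow> has_grad g a' b' c' x \<Longrightarrow>
    has_grad (\<lambda>x. f x * g x) (f x * a' + g x * a) (f x * b' + g x * b) (f x * c' + g x * c) x"
  unfolding has_grad_def by (drule (1) GDERIV_mult, erule GDERIV_subst) (simp add: vec_eq_iff forall_3)

lemma has_grad_cmult:
  "has_grad f a b c x \<Longrightarrow> has_grad (\<lambda>x. r * f x) (r * a) (r * b) (r * c) x"
  by (rule has_grad_eqI[OF has_grad_mult[OF has_grad_const]]) auto

lemma has_grad_power:
  assumes "has_grad f a b c x"
  shows "has_grad (\<lambda>x. f x ^ n) (real n * f x ^ (n - 1) * a) (real n * f x ^ (n - 1) * b) (real n * f x ^ (n - 1) * c) x"
proof (induction n)
  case 0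
  then show ?case using has_grad_const[of 1 x] by simp
next
  case (Suc n)
  show ?case unfolding power_Suc
    by (rule has_grad_eqI[OF has_grad_mult[OF assms Suc]]) (cases n; simp add: algebra_simps)+
qed

text \<open>The complex rule \<open>d (f + i g)^n = n (f + i g)^(n-1) d (f + i g)\<close>, split
  into real and imaginary part. For \<open>n = 0\<close> the truncated exponent is multiplied by
  \<open>real n = 0\<close>.\<close>

lemma has_grad_repow:
  assumes "has_grad f a b c x" "has_grad g a' b' c' x"
  defines "R n \<equiv> repow n (f x) (g x)" and "I n \<equiv> impow n (f x) (g x)"
  shows "has_grad (\<lambda>x. repow n (f x) (g x)) (real n * (R (n - 1) * a - I (n - 1) * a'))
      (real n * (R (n - 1) * b - I (n - 1) * b')) (real n * (R (n - 1) * c - I (n - 1) * c')) x"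
    and "has_grad (\<lambda>x. impow n (f x) (g x)) (real n * (R (n - 1) * a' + I (n - 1) * a))
      (real n * (R (n - 1) * b' + I (n - 1) * b)) (real n * (R (n - 1) * c' + I (n - 1) * c)) x"
proof (induction n)
  case 0
  { case 1 show ?case using has_grad_const[of 1 x] by simp }
  { case 2 show ?case using has_grad_const[of 0 x] by simp }
next
  case (Suc n)
  { case 1
    show ?case unfolding repow.simps
      by (rule has_grad_eqI[OF has_grad_diff[OF has_grad_mult[OF assms(1) Suc(1)] has_grad_mult[OF assms(2) Suc(2)]]])
        (cases n; simp add: R_def I_def algebra_simps)+ }
  { case 2
    show ?case unfolding impow.simps
      by (rule has_grad_eqI[OF has_grad_add[OF has_grad_mult[OF assms(1) Suc(2)] has_grad_mult[OF assms(2) Suc(1)]]])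
        (cases n; simp add: R_def I_def algebra_simps)+ }
qed

text \<open>The approximate solution
  \<open>e z Re (x + iy)\<^sup>m + A z\<^sup>2 (x\<^sup>2 + y\<^sup>2)\<^bsup>m-1\<^esup> + B Re (z + i\<kappa>x)\<^bsup>2m\<^esup>\<close> with \<open>m = k + 2\<close>, together with its first
  and second partial derivatives, as polymorphic expressions that can be read both in \<^typ>\<open>real\<close>
  and in \<^typ>\<open>wps\<close>.\<close>

lemma order_ge_multI: "order_ge d p \<Longrightarrow> order_ge e q \<Longrightarrow> n \<le> d + e \<Longrightarrow> order_ge n (p * q)"
  using order_ge_mult order_ge_mono by blast

definition det3s :: "'a \<Rightarrow> 'a \<Rightarrow> 'a \<Rightarrow> 'a \<Rightarrow> 'a \<Rightarrow> 'a \<Rightarrow> 'a::comm_ring_1" where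
  "det3s K11 K12 K13 K22 K23 K33 = K11 * (K22 * K33 - K23 * K23) - K12 * (K12 * K33 - K13 * K23)
    + K13 * (K12 * K23 - K13 * K22)"

text \<open>Written for \<open>v = tan \<theta> (x\<^sup>2 + y\<^sup>2) / 2 + w\<close> with \<open>c = cos \<theta>\<close> and \<open>s = sin \<theta>\<close>, the special
  Lagrangian equation of phase \<open>2\<theta>\<close> for \<open>v\<close> is \<open>w\<^bsub>zz\<^esub> = NN c s (D\<^sup>2 w)\<close>.\<close>

definition NN :: "real \<Rightarrow> real \<Rightarrow> 'a \<Rightarrow> 'a \<Rightarrow> 'a \<Rightarrow> 'a \<Rightarrow> 'a \<Rightarrow> 'a \<Rightarrow> 'a::{real_algebra_1,comm_ring_1}" where
  "NN c s K11 K12 K13 K22 K23 K33 =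
    (- (c\<^sup>2)) *\<^sub>R (K11 + K22)
    + (s * c) *\<^sub>R (K13 * K13 + K23 * K23 - K33 * (K11 + K22))
    - (2 * s * c ^ 3) *\<^sub>R (K11 * K22 - K12 * K12)
    + (c\<^sup>2 * (c\<^sup>2 - s\<^sup>2)) *\<^sub>R det3s K11 K12 K13 K22 K23 K33"

lemma ev_NN:
  assumes "x \<in> dom0"
  shows "ev (NN c s K11 K12 K13 K22 K23 K33) x =
    NN c s (ev K11 x) (ev K12 x) (ev K13 x) (ev K22 x) (ev K23 x) (ev K33 x)"
  unfolding NN_def det3s_def
  by (simp only: ev_add[OF assms] ev_diff[OF assms] ev_scaleR ev_mult[OF assms] real_scaleR_def)

lemma order_ge_det3s:
  assumes "order_ge d K11" "order_ge d K12" "order_ge d K13" "order_ge d K22" "order_ge d K23" "order_ge d K33"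
    and "n \<le> 3 * d"
  shows "order_ge n (det3s K11 K12 K13 K22 K23 K33)"
proof -
  have *: "order_ge (2 * d) (p * q)" if "order_ge d p" "order_ge d q" for p q
    using order_ge_mult[OF that] by (simp add: mult_2)
  have **: "order_ge n (p * q)" if "order_ge d p" "order_ge (2 * d) q" for p q
    using that assms(7) by (intro order_ge_multI) auto
  show ?thesis unfolding det3s_def
    by (intro order_ge_add order_ge_diff ** * assms)
qed

text \<open>To be read with \<open>L\<close> the second derivatives of
  \<open>e z Re (x + i y)^m\<close>, where \<open>L22 = - L11\<close> and \<open>L33 = 0\<close>,
  and \<open>G\<close> those of the terms of degree 2m. The linear contribution of \<open>L\<close>
  drops out of the trace. The first bracket collects everything of degree 2m - 2; all other summands
  have degree at least 3(m - 1), which is at least 2m - 1 for m at least 2.\<close>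

lemma NN_split:
  fixes L11 :: "'a::{real_algebra_1,comm_ring_1}"
  shows "NN c s (L11 + G11) (L12 + G12) (L13 + G13) (- L11 + G22) (L23 + G23) G33 - G33 =
    ((- (c\<^sup>2)) *\<^sub>R (G11 + G22) - G33 + (s * c) *\<^sub>R (L13 * L13 + L23 * L23) + (2 * s * c ^ 3) *\<^sub>R (L11 * L11 + L12 * L12))
    + (s * c) *\<^sub>R (L13 * G13 + L13 * G13 + G13 * G13 + (L23 * G23 + L23 * G23) + G23 * G23 - G33 * (G11 + G22))
    - (2 * s * c ^ 3) *\<^sub>R (L11 * G22 - L11 * G11 + G11 * G22 - (L12 * G12 + L12 * G12) - G12 * G12)
    + (c\<^sup>2 * (c\<^sup>2 - s\<^sup>2)) *\<^sub>R det3s (L11 + G11) (L12 + G12) (L13 + G13) (- L11 + G22) (L23 + G23) G33"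
proof -
  have 1: "(L11 + G11) + (- L11 + G22) = G11 + G22" by simp
  have 2: "(L13 + G13) * (L13 + G13) + (L23 + G23) * (L23 + G23) - G33 * (G11 + G22)
     = (L13 * L13 + L23 * L23) + (L13 * G13 + L13 * G13 + G13 * G13 + (L23 * G23 + L23 * G23) + G23 * G23 - G33 * (G11 + G22))"
    by (simp add: algebra_simps)
  have 3: "(L11 + G11) * (- L11 + G22) - (L12 + G12) * (L12 + G12)
     = (L11 * G22 - L11 * G11 + G11 * G22 - (L12 * G12 + L12 * G12) - G12 * G12) - (L11 * L11 + L12 * L12)"
    by (simp add: algebra_simps)
  show ?thesis
    unfolding NN_def 1 2 3 scaleR_add_right[of "s * c" "L13 * L13 + L23 * L23"]
      scaleR_diff_right[of "2 * s * c ^ 3" _ "L11 * L11 + L12 * L12"]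
    by (simp only: diff_conv_add_uminus add_ac minus_add_distrib minus_minus)
qed

text \<open>\<open>NN\<close> is a polynomial in its arguments and therefore respects congruence
  modulo the ideal of series of order at least \<open>d\<close>.\<close>

lemma NN_cong_order:
  assumes "order_ge d (K11 - L11)" "order_ge d (K12 - L12)" "order_ge d (K13 - L13)"
    "order_ge d (K22 - L22)" "order_ge d (K23 - L23)" "order_ge d (K33 - L33)"
  shows "order_ge d (NN c s K11 K12 K13 K22 K23 K33 - NN c s L11 L12 L13 L22 L23 L33)"
proof -
  have mult: "order_ge d (p * q - p' * q')" if "order_ge d (p - p')" "order_ge d (q - q')" for p q p' q'
  proof -
    have "p * q - p' * q' = p * (q - q') + (p - p') * q'" by (simp add: algebra_simps)
    then show ?thesis
      using order_ge_multI[of 0 p d "q - q'" d] order_ge_multI[of d "p - p'" 0 q' d] that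
      by (auto intro: order_ge_add)
  qed
  have add: "order_ge d ((p + q) - (p' + q'))" if "order_ge d (p - p')" "order_ge d (q - q')" for p q p' q'
    using order_ge_add[OF that] by (simp add: algebra_simps)
  have diff: "order_ge d ((p - q) - (p' - q'))" if "order_ge d (p - p')" "order_ge d (q - q')" for p q p' q'
    using order_ge_diff[OF that] by (simp add: algebra_simps)
  have scale: "order_ge d (r *\<^sub>R p - r *\<^sub>R p')" if "order_ge d (p - p')" for p p' r
    using order_ge_scaleR[OF that] by (simp add: scaleR_diff_right)
  show ?thesis unfolding NN_def det3s_def
    by (intro mult add diff scale assms)
qed

text \<open>Bounds for two values and for their difference in one predicate: with the rules below, a
  Lipschitz estimate for a polynomial expression is assembled along its syntax.\<close>

definition lip :: "real \<Rightarrow> real \<Rightarrow> 'a::real_normed_vector \<Rightarrow> 'a \<Rightarrow> bool" where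
  "lip M D x x' \<longleftrightarrow> norm x \<le> M \<and> norm x' \<le> M \<and> norm (x - x') \<le> D"

lemma lip_add:
  assumes "lip M D x x'" "lip N E y y'"
  shows "lip (M + N) (D + E) (x + y) (x' + y')"
proof -
  have eq: "(x + y) - (x' + y') = (x - x') + (y - y')" by (simp add: algebra_simps)
  show ?thesis using assms unfolding lip_def eq by (meson norm_triangle_mono)
qed

lemma lip_diff:
  assumes "lip M D x x'" "lip N E y y'"
  shows "lip (M + N) (D + E) (x - y) (x' - y')"
proof -
  have "lip N E (- y) (- y')"
    using assms(2) norm_minus_commute[of y y'] unfolding lip_def by simp
  from lip_add[OF assms(1) this] show ?thesis by simp
qed

lemma lip_scaleR:
  assumes "lip M D x x'" "\<bar>r\<bar> \<le> R"
  shows "lip (R * M) (R * D) (r *\<^sub>R x) (r *\<^sub>R x')"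
proof -
  have "norm (r *\<^sub>R v) \<le> R * L" if "norm v \<le> L" for v :: 'a and L
    unfolding norm_scaleR using assms(2) that by (intro mult_mono) auto
  then show ?thesis
    using assms(1) unfolding lip_def scaleR_diff_right[symmetric] by blast
qed

lemma lip_mult:
  fixes x :: "'a::real_normed_algebra"
  assumes "lip M D x x'" "lip N E y y'"
  shows "lip (M * N) (M * E + D * N) (x * y) (x' * y')"
proof -
  have pos: "M \<ge> 0" "D \<ge> 0" using assms(1) norm_ge_zero order_trans unfolding lip_def by blast+
  have le: "norm (u * v) \<le> a * b" if "norm u \<le> a" "norm v \<le> b" "a \<ge> 0" for u v :: 'a and a b
    using that by (intro order_trans[OF norm_mult_ineq] mult_mono) auto
  have "x * y - x' * y' = x * (y - y') + (x - x') * y'" by (simp add: algebra_simps)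
  also have "norm \<dots> \<le> M * E + D * N"
    using assms pos unfolding lip_def by (intro norm_triangle_le add_mono le) auto
  finally show ?thesis using assms pos le unfolding lip_def by auto
qed

text \<open>The linear part contributes \<open>D / 2\<close> by the trace hypothesis
  \<open>tr\<close>, the quadratic terms add \<open>16 M D\<close> and the cubic ones
  \<open>18 M^2 D\<close>. For \<open>M = 1 / 100\<close> the sum is
  \<open>0.6618 D\<close>.\<close>

lemma NN_Lipschitz:
  fixes K11 :: wps
  assumes cs: "\<bar>c\<bar> \<le> 1" "\<bar>s\<bar> \<le> 1"
    and K: "lip M D K11 L11" "lip M D K12 L12" "lip M D K13 L13" "lip M D K22 L22" "lip M D K23 L23" "lip M D K33 L33"
    and tr: "norm ((K11 + K22) - (L11 + L22)) \<le> D / 2" and M: "M = 1 / 100"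
  shows "norm (NN c s K11 K12 K13 K22 K23 K33 - NN c s L11 L12 L13 L22 L23 L33) \<le> 3 / 4 * D"
proof -
  have D: "D \<ge> 0" using K(1) norm_ge_zero order_trans unfolding lip_def by blast
  have c2: "c\<^sup>2 \<le> 1" "s\<^sup>2 \<le> 1" using cs by (auto simp: abs_square_le_1)
  have b1: "\<bar>- (c\<^sup>2)\<bar> \<le> 1" using c2 by simp
  have b2: "\<bar>s * c\<bar> \<le> 1" using cs by (simp add: abs_mult mult_le_one)
  have "\<bar>c\<bar> ^ 3 \<le> 1" using cs by (intro power_le_one) auto
  then have "\<bar>s\<bar> * \<bar>c\<bar> ^ 3 \<le> 1" using cs by (intro mult_le_one) auto
  then have b3: "\<bar>2 * s * c ^ 3\<bar> \<le> 2" by (simp add: abs_mult power_abs)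
  have "\<bar>c\<^sup>2 - s\<^sup>2\<bar> \<le> 1" using c2 zero_le_power2[of c] zero_le_power2[of s] by linarith
  then have b4: "\<bar>c\<^sup>2 * (c\<^sup>2 - s\<^sup>2)\<bar> \<le> 1" using c2 by (simp add: abs_mult mult_le_one)
  have tr': "lip (2 * M) (D / 2) (K11 + K22) (L11 + L22)"
    using tr lip_add[OF K(1) K(4)] by (simp add: lip_def)
  note A0 = lip_scaleR[OF tr' b1]
  note A1 = lip_scaleR[OF lip_diff[OF lip_add[OF lip_mult[OF K(3) K(3)] lip_mult[OF K(5) K(5)]] lip_mult[OF K(6) lip_add[OF K(1) K(4)]]] b2]
  note A2 = lip_scaleR[OF lip_diff[OF lip_mult[OF K(1) K(4)] lip_mult[OF K(2) K(2)]] b3]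
  note m1 = lip_mult[OF K(1) lip_diff[OF lip_mult[OF K(4) K(6)] lip_mult[OF K(5) K(5)]]]
  note m2 = lip_mult[OF K(2) lip_diff[OF lip_mult[OF K(2) K(6)] lip_mult[OF K(3) K(5)]]]
  note m3 = lip_mult[OF K(3) lip_diff[OF lip_mult[OF K(2) K(5)] lip_mult[OF K(3) K(4)]]]
  note A3 = lip_scaleR[OF lip_add[OF lip_diff[OF m1 m2] m3] b4]
  have "lip M' E' p q \<Longrightarrow> norm (p - q) \<le> E'" for M' E' and p q :: wps by (simp add: lip_def)
  from this[OF lip_add[OF lip_diff[OF lip_add[OF A0 A1] A2] A3]]
  show ?thesis unfolding NN_def det3s_def
  proof (rule order_trans)
    show "1 * (D / 2) + 1 * (M * D + D * M + (M * D + D * M) + (M * (D + D) + D * (M + M))) + 2 * (M * D + D * M + (M * D + D * M)) +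
      1 * (M * (M * D + D * M + (M * D + D * M)) + D * (M * M + M * M) + (M * (M * D + D * M + (M * D + D * M)) + D * (M * M + M * M)) +
        (M * (M * D + D * M + (M * D + D * M)) + D * (M * M + M * M))) \<le> 3 / 4 * D"
      using D unfolding M by simp
  qed
qed

section \<open>The approximate solution and its residual\<close>

locale approx_terms =
  fixes k :: nat and e A B \<kappa> :: real
begin

definition q0 :: "'a \<Rightarrow> 'a \<Rightarrow> 'a \<Rightarrow> 'a::{real_algebra_1,comm_ring_1}" where
  "q0 x y z = e *\<^sub>R (z * repow (k + 2) x y) + A *\<^sub>R (z\<^sup>2 * (x\<^sup>2 + y\<^sup>2) ^ (k + 1))
    + B *\<^sub>R repow (2 * k + 4) z (\<kappa> *\<^sub>R x)"

definition q1 :: "'a \<Rightarrow> 'a \<Rightarrow> 'a \<Rightarrow> 'a::{real_algebra_1,comm_ring_1}" where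
  "q1 x y z = (e * real (k + 2)) *\<^sub>R (z * repow (k + 1) x y)
    + (2 * A * real (k + 1)) *\<^sub>R (z\<^sup>2 * x * (x\<^sup>2 + y\<^sup>2) ^ k)
    - (B * real (2 * k + 4) * \<kappa>) *\<^sub>R impow (2 * k + 3) z (\<kappa> *\<^sub>R x)"

definition q2 :: "'a \<Rightarrow> 'a \<Rightarrow> 'a \<Rightarrow> 'a::{real_algebra_1,comm_ring_1}" where
  "q2 x y z = (2 * A * real (k + 1)) *\<^sub>R (z\<^sup>2 * y * (x\<^sup>2 + y\<^sup>2) ^ k)
    - (e * real (k + 2)) *\<^sub>R (z * impow (k + 1) x y)"

definition q3 :: "'a \<Rightarrow> 'a \<Rightarrow> 'a \<Rightarrow> 'a::{real_algebra_1,comm_ring_1}" where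
  "q3 x y z = e *\<^sub>R repow (k + 2) x y + (2 * A) *\<^sub>R (z * (x\<^sup>2 + y\<^sup>2) ^ (k + 1))
    + (B * real (2 * k + 4)) *\<^sub>R repow (2 * k + 3) z (\<kappa> *\<^sub>R x)"

text \<open>The parentheses separate the part that stems from \<open>e z Re (x + i y)^m\<close> from
  the terms of degree 2m - 2, in the form used by \<open>q_split\<close>. For \<open>k = 0\<close>
  the truncated exponent \<open>k - 1\<close> occurs only together with the factor
  \<open>real k = 0\<close>.\<close>

definition q11 :: "'a \<Rightarrow> 'a \<Rightarrow> 'a \<Rightarrow> 'a::{real_algebra_1,comm_ring_1}" where
  "q11 x y z = (e * real (k + 2) * real (k + 1)) *\<^sub>R (z * repow k x y)
    + ((2 * A * real (k + 1)) *\<^sub>R (z\<^sup>2 * (x\<^sup>2 + y\<^sup>2) ^ k)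
      + (4 * A * real (k + 1) * real k) *\<^sub>R (z\<^sup>2 * x\<^sup>2 * (x\<^sup>2 + y\<^sup>2) ^ (k - 1))
    - (B * real (2 * k + 4) * real (2 * k + 3) * \<kappa>\<^sup>2) *\<^sub>R repow (2 * k + 2) z (\<kappa> *\<^sub>R x))"

definition q12 :: "'a \<Rightarrow> 'a \<Rightarrow> 'a \<Rightarrow> 'a::{real_algebra_1,comm_ring_1}" where
  "q12 x y z = (- (e * real (k + 2) * real (k + 1))) *\<^sub>R (z * impow k x y)
    + (4 * A * real (k + 1) * real k) *\<^sub>R (z\<^sup>2 * x * y * (x\<^sup>2 + y\<^sup>2) ^ (k - 1))"

definition q22 :: "'a \<Rightarrow> 'a \<Rightarrow> 'a \<Rightarrow> 'a::{real_algebra_1,comm_ring_1}" where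
  "q22 x y z = (- (e * real (k + 2) * real (k + 1))) *\<^sub>R (z * repow k x y)
    + ((2 * A * real (k + 1)) *\<^sub>R (z\<^sup>2 * (x\<^sup>2 + y\<^sup>2) ^ k)
      + (4 * A * real (k + 1) * real k) *\<^sub>R (z\<^sup>2 * y\<^sup>2 * (x\<^sup>2 + y\<^sup>2) ^ (k - 1)))"

definition q13 :: "'a \<Rightarrow> 'a \<Rightarrow> 'a \<Rightarrow> 'a::{real_algebra_1,comm_ring_1}" where
  "q13 x y z = (e * real (k + 2)) *\<^sub>R repow (k + 1) x y
    + ((4 * A * real (k + 1)) *\<^sub>R (z * x * (x\<^sup>2 + y\<^sup>2) ^ k)
    - (B * real (2 * k + 4) * real (2 * k + 3) * \<kappa>) *\<^sub>R impow (2 * k + 2) z (\<kappa> *\<^sub>R x))"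

definition q23 :: "'a \<Rightarrow> 'a \<Rightarrow> 'a \<Rightarrow> 'a::{real_algebra_1,comm_ring_1}" where
  "q23 x y z = (- (e * real (k + 2))) *\<^sub>R impow (k + 1) x y
    + (4 * A * real (k + 1)) *\<^sub>R (z * y * (x\<^sup>2 + y\<^sup>2) ^ k)"

definition q33 :: "'a \<Rightarrow> 'a \<Rightarrow> 'a \<Rightarrow> 'a::{real_algebra_1,comm_ring_1}" where
  "q33 x y z = (2 * A) *\<^sub>R (x\<^sup>2 + y\<^sup>2) ^ (k + 1)
    + (B * real (2 * k + 4) * real (2 * k + 3)) *\<^sub>R repow (2 * k + 2) z (\<kappa> *\<^sub>R x)"

lemmas q_defs = q0_def q1_def q2_def q3_def q11_def q12_def q13_def q22_def q23_def q33_def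

lemma ev_q:
  assumes "x \<in> dom0"
  shows "ev (q0 X Y Z) x = q0 (ev X x) (ev Y x) (ev Z x)"
    "ev (q1 X Y Z) x = q1 (ev X x) (ev Y x) (ev Z x)"
    "ev (q2 X Y Z) x = q2 (ev X x) (ev Y x) (ev Z x)"
    "ev (q3 X Y Z) x = q3 (ev X x) (ev Y x) (ev Z x)"
    "ev (q11 X Y Z) x = q11 (ev X x) (ev Y x) (ev Z x)"
    "ev (q12 X Y Z) x = q12 (ev X x) (ev Y x) (ev Z x)"
    "ev (q13 X Y Z) x = q13 (ev X x) (ev Y x) (ev Z x)"
    "ev (q22 X Y Z) x = q22 (ev X x) (ev Y x) (ev Z x)"
    "ev (q23 X Y Z) x = q23 (ev X x) (ev Y x) (ev Z x)"
    "ev (q33 X Y Z) x = q33 (ev X x) (ev Y x) (ev Z x)"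
  unfolding q_defs
  by (simp_all only: ev_add[OF assms] ev_diff[OF assms] ev_scaleR ev_mult[OF assms]
      ev_power[OF assms] ev_repow[OF assms] real_scaleR_def)

lemma has_grad_q:
  "has_grad (\<lambda>x. q0 (x $ 1) (x $ 2) (x $ 3)) (q1 (x $ 1) (x $ 2) (x $ 3)) (q2 (x $ 1) (x $ 2) (x $ 3)) (q3 (x $ 1) (x $ 2) (x $ 3)) x"
  "has_grad (\<lambda>x. q1 (x $ 1) (x $ 2) (x $ 3)) (q11 (x $ 1) (x $ 2) (x $ 3)) (q12 (x $ 1) (x $ 2) (x $ 3)) (q13 (x $ 1) (x $ 2) (x $ 3)) x"
  "has_grad (\<lambda>x. q2 (x $ 1) (x $ 2) (x $ 3)) (q12 (x $ 1) (x $ 2) (x $ 3)) (q22 (x $ 1) (x $ 2) (x $ 3)) (q23 (x $ 1) (x $ 2) (x $ 3)) x"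
  "has_grad (\<lambda>x. q3 (x $ 1) (x $ 2) (x $ 3)) (q13 (x $ 1) (x $ 2) (x $ 3)) (q23 (x $ 1) (x $ 2) (x $ 3)) (q33 (x $ 1) (x $ 2) (x $ 3)) x"
proof -
  have n: "2 * k + 4 - 1 = 2 * k + 3" "2 * k + 3 - 1 = 2 * k + 2" "k + 2 - 1 = k + 1" "k + 1 - 1 = k"
    by simp_all
  note [simp] = n
  note I = has_grad_add has_grad_diff has_grad_cmult has_grad_mult has_grad_component has_grad_power has_grad_repow
  show "has_grad (\<lambda>x. q0 (x $ 1) (x $ 2) (x $ 3)) (q1 (x $ 1) (x $ 2) (x $ 3)) (q2 (x $ 1) (x $ 2) (x $ 3)) (q3 (x $ 1) (x $ 2) (x $ 3)) x"
    unfolding q_defs real_scaleR_def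
    apply (rule has_grad_eqI)
       apply (rule I)+
    unfolding n by (simp_all add: algebra_simps power2_eq_square del: repow.simps impow.simps power_Suc)
  show "has_grad (\<lambda>x. q1 (x $ 1) (x $ 2) (x $ 3)) (q11 (x $ 1) (x $ 2) (x $ 3)) (q12 (x $ 1) (x $ 2) (x $ 3)) (q13 (x $ 1) (x $ 2) (x $ 3)) x"
    unfolding q_defs real_scaleR_def
    apply (rule has_grad_eqI)
       apply (rule I)+
    unfolding n by (simp_all add: algebra_simps power2_eq_square del: repow.simps impow.simps power_Suc)
  show "has_grad (\<lambda>x. q2 (x $ 1) (x $ 2) (x $ 3)) (q12 (x $ 1) (x $ 2) (x $ 3)) (q22 (x $ 1) (x $ 2) (x $ 3)) (q23 (x $ 1) (x $ 2) (x $ 3)) x"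
    unfolding q_defs real_scaleR_def
    apply (rule has_grad_eqI)
       apply (rule I)+
    unfolding n by (simp_all add: algebra_simps power2_eq_square del: repow.simps impow.simps power_Suc)
  show "has_grad (\<lambda>x. q3 (x $ 1) (x $ 2) (x $ 3)) (q13 (x $ 1) (x $ 2) (x $ 3)) (q23 (x $ 1) (x $ 2) (x $ 3)) (q33 (x $ 1) (x $ 2) (x $ 3)) x"
    unfolding q_defs real_scaleR_def
    apply (rule has_grad_eqI)
       apply (rule I)+
    unfolding n by (simp_all add: algebra_simps power2_eq_square del: repow.simps impow.simps power_Suc)
qed

lemma order_ge_parts:
  assumes X: "order_ge 1 X" and Y: "order_ge 1 Y" and Z: "order_ge 1 Z"
  shows "order_ge 1 (\<kappa> *\<^sub>R X)" "order_ge 2 (Z\<^sup>2)" "order_ge (2 * n) ((X\<^sup>2 + Y\<^sup>2) ^ n)"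
    "order_ge 2 (X\<^sup>2)" "order_ge 2 (Y\<^sup>2)"
proof -
  show "order_ge 1 (\<kappa> *\<^sub>R X)" by (rule order_ge_scaleR[OF X])
  show Z2: "order_ge 2 (Z\<^sup>2)" "order_ge 2 (X\<^sup>2)" "order_ge 2 (Y\<^sup>2)"
    using order_ge_power[OF Z, of 2] order_ge_power[OF X, of 2] order_ge_power[OF Y, of 2] by simp_all
  show "order_ge (2 * n) ((X\<^sup>2 + Y\<^sup>2) ^ n)"
    using order_ge_power[OF order_ge_add[OF Z2(2,3)], of n] by (simp add: mult.commute)
qed

context
  fixes X Y Z :: wps
  assumes X: "order_ge 1 X" and Y: "order_ge 1 Y" and Z: "order_ge 1 Z"
begin

lemma order_ge_repow_mono:
  "n \<le> l \<Longrightarrow> order_ge n (repow l X Y)" "n \<le> l \<Longrightarrow> order_ge n (impow l X Y)"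
  "n \<le> l \<Longrightarrow> order_ge n (repow l Z (\<kappa> *\<^sub>R X))" "n \<le> l \<Longrightarrow> order_ge n (impow l Z (\<kappa> *\<^sub>R X))"
  "n \<le> 2 * l \<Longrightarrow> order_ge n ((X\<^sup>2 + Y\<^sup>2) ^ l)"
  using order_ge_repow[OF X Y, of l] order_ge_repow[OF Z order_ge_scaleR[OF X], of l \<kappa>]
    order_ge_parts(3)[OF X Y Z, of l] order_ge_mono by blast+

lemma order_ge_q0: "order_ge (k + 3) (q0 X Y Z)"
  unfolding q0_def
  by (intro order_ge_add order_ge_scaleR
      order_ge_multI[OF Z order_ge_repow_mono(1)[of "k + 2"]]
      order_ge_multI[OF order_ge_parts(2)[OF X Y Z] order_ge_repow_mono(5)[of "2 * k + 2"]]
      order_ge_repow_mono) auto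

lemma order_ge_q3: "order_ge (k + 2) (q3 X Y Z)"
  unfolding q3_def
  by (intro order_ge_add order_ge_scaleR
      order_ge_multI[OF Z order_ge_repow_mono(5)[of "2 * k + 2"]]
      order_ge_repow_mono) auto

text \<open>The \<open>L\<close> are the second derivatives of \<open>e z Re (x + i y)^m\<close>, of
  degree \<open>k + 1\<close>; the \<open>G\<close> are those of the terms with \<open>A\<close> and
  \<open>B\<close>, of degree \<open>2 * k + 2\<close>. The former function is harmonic in x and y
  and linear in z, so its 22-entry is \<open>- L11\<close> and its 33-entry vanishes.\<close>

definition "L11 = (e * real (k + 2) * real (k + 1)) *\<^sub>R (Z * repow k X Y)"
definition "L12 = (- (e * real (k + 2) * real (k + 1))) *\<^sub>R (Z * impow k X Y)"
definition "L13 = (e * real (k + 2)) *\<^sub>R repow (k + 1) X Y"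
definition "L23 = (- (e * real (k + 2))) *\<^sub>R impow (k + 1) X Y"
definition "G11 = (2 * A * real (k + 1)) *\<^sub>R (Z\<^sup>2 * (X\<^sup>2 + Y\<^sup>2) ^ k)
      + (4 * A * real (k + 1) * real k) *\<^sub>R (Z\<^sup>2 * X\<^sup>2 * (X\<^sup>2 + Y\<^sup>2) ^ (k - 1))
    - (B * real (2 * k + 4) * real (2 * k + 3) * \<kappa>\<^sup>2) *\<^sub>R repow (2 * k + 2) Z (\<kappa> *\<^sub>R X)"
definition "G12 = (4 * A * real (k + 1) * real k) *\<^sub>R (Z\<^sup>2 * X * Y * (X\<^sup>2 + Y\<^sup>2) ^ (k - 1))"
definition "G22 = (2 * A * real (k + 1)) *\<^sub>R (Z\<^sup>2 * (X\<^sup>2 + Y\<^sup>2) ^ k)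
      + (4 * A * real (k + 1) * real k) *\<^sub>R (Z\<^sup>2 * Y\<^sup>2 * (X\<^sup>2 + Y\<^sup>2) ^ (k - 1))"
definition "G13 = (4 * A * real (k + 1)) *\<^sub>R (Z * X * (X\<^sup>2 + Y\<^sup>2) ^ k)
    - (B * real (2 * k + 4) * real (2 * k + 3) * \<kappa>) *\<^sub>R impow (2 * k + 2) Z (\<kappa> *\<^sub>R X)"
definition "G23 = (4 * A * real (k + 1)) *\<^sub>R (Z * Y * (X\<^sup>2 + Y\<^sup>2) ^ k)"

lemmas L_defs = L11_def L12_def L13_def L23_def
lemmas G_defs = G11_def G12_def G22_def G13_def G23_def

lemma q_split:
  "q11 X Y Z = L11 + G11" "q12 X Y Z = L12 + G12" "q13 X Y Z = L13 + G13"
  "q22 X Y Z = - L11 + G22" "q23 X Y Z = L23 + G23"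
  by (simp_all add: L_defs G_defs q_defs)

lemma order_ge_L:
  "order_ge (k + 1) L11" "order_ge (k + 1) L12" "order_ge (k + 1) L13" "order_ge (k + 1) L23"
  unfolding L_defs
  by (intro order_ge_scaleR order_ge_repow_mono
      order_ge_multI[OF Z order_ge_repow_mono(1)[of k]] order_ge_multI[OF Z order_ge_repow_mono(2)[of k]]; simp)+

lemma order_ge_G:
  "order_ge (2 * k + 2) G11" "order_ge (2 * k + 2) G12" "order_ge (2 * k + 2) G13"
  "order_ge (2 * k + 2) G22" "order_ge (2 * k + 2) G23" "order_ge (2 * k + 2) (q33 X Y Z)"
proof -
  note P = order_ge_parts[OF X Y Z]
  have a: "order_ge (2 * k + 2) (p * (X\<^sup>2 + Y\<^sup>2) ^ k)" if "order_ge 2 p" for p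
    by (rule order_ge_multI[OF that P(3)]) simp
  have b: "order_ge (2 * k + 2) (p * (X\<^sup>2 + Y\<^sup>2) ^ (k - 1))" if "order_ge 4 p" for p
    by (rule order_ge_multI[OF that P(3)]) simp
  have 4: "order_ge 4 (Z\<^sup>2 * X\<^sup>2)" "order_ge 4 (Z\<^sup>2 * Y\<^sup>2)" "order_ge 4 (Z\<^sup>2 * X * Y)"
    "order_ge 2 (Z * X)" "order_ge 2 (Z * Y)"
    by (rule order_ge_multI[OF P(2) P(4)] order_ge_multI[OF P(2) P(5)]
        order_ge_multI[OF order_ge_multI[OF P(2) X order_refl] Y] order_ge_multI[OF Z X] order_ge_multI[OF Z Y]; simp)+
  show "order_ge (2 * k + 2) G11" "order_ge (2 * k + 2) G12" "order_ge (2 * k + 2) G13"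
    "order_ge (2 * k + 2) G22" "order_ge (2 * k + 2) G23" "order_ge (2 * k + 2) (q33 X Y Z)"
    unfolding G_defs q33_def
    by (intro order_ge_add order_ge_diff order_ge_scaleR a b 4 P(2) order_ge_repow_mono; simp)+
qed

lemma order_ge_q2nd:
  "order_ge (k + 1) (q11 X Y Z)" "order_ge (k + 1) (q12 X Y Z)" "order_ge (k + 1) (q13 X Y Z)"
  "order_ge (k + 1) (q22 X Y Z)" "order_ge (k + 1) (q23 X Y Z)" "order_ge (k + 1) (q33 X Y Z)"
  unfolding q_split using order_ge_G[THEN order_ge_mono, of "k + 1"] order_ge_L
  by (auto intro!: order_ge_add order_ge_diff order_ge_uminus)

text \<open>Three cancellations in degree 2m - 2. The relation for \<open>A\<close> balances the
  z-derivative \<open>2 * A\<close> of the second term against the squared horizontal gradient in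
  \<open>L13\<close> and \<open>L23\<close>, both multiples of \<open>(X^2 + Y^2)^(k+1)\<close>. The
  same \<open>A\<close> balances its horizontal Laplacian against
  \<open>L11 * L11 + L12 * L12\<close>, both multiples of \<open>Z^2 (X^2 + Y^2)^k\<close>. Finally
  \<open>\<kappa> * c = 1\<close> makes the \<open>B\<close> term a solution of the linear equation
  \<open>w_zz + c^2 (w_xx + w_yy) = 0\<close>.\<close>

lemma residual_cancel:
  assumes A: "2 * A = s * c * (e * real (k + 2))\<^sup>2" and \<kappa>: "\<kappa> * c = 1"
  shows "(- (c\<^sup>2)) *\<^sub>R (G11 + G22) - q33 X Y Z + (s * c) *\<^sub>R (L13 * L13 + L23 * L23)
    + (2 * s * c ^ 3) *\<^sub>R (L11 * L11 + L12 * L12) = 0"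
proof -
  let ?r = "X\<^sup>2 + Y\<^sup>2" and ?R = "repow (2 * k + 2) Z (\<kappa> *\<^sub>R X)"
  define N where "N = B * real (2 * k + 4) * real (2 * k + 3)"
  define T where "T = Z\<^sup>2 * ?r ^ k"
  let ?P = "Z\<^sup>2 * X\<^sup>2 * ?r ^ (k - 1) + Z\<^sup>2 * Y\<^sup>2 * ?r ^ (k - 1)"
  define a where "a = 2 * A * real (k + 1)"
  have P: "real k *\<^sub>R ?P = real k *\<^sub>R T"
  proof (cases k)
    case (Suc n)
    have "Z\<^sup>2 * X\<^sup>2 * ?r ^ n + Z\<^sup>2 * Y\<^sup>2 * ?r ^ n = Z\<^sup>2 * (?r * ?r ^ n)" by (simp add: algebra_simps)
    then show ?thesis by (simp add: Suc T_def)
  qed simp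
  have "G11 + G22 = a *\<^sub>R T + a *\<^sub>R T + (4 * A * real (k + 1) * real k) *\<^sub>R ?P - (N * \<kappa>\<^sup>2) *\<^sub>R ?R"
    unfolding G_defs N_def T_def a_def by (simp only: scaleR_add_right) simp
  also have "(4 * A * real (k + 1) * real k) *\<^sub>R ?P = (2 * a * real k) *\<^sub>R T"
  proof -
    have "(4 * A * real (k + 1) * real k) *\<^sub>R ?P = (4 * A * real (k + 1)) *\<^sub>R (real k *\<^sub>R ?P)"
      by (simp only: scaleR_scaleR)
    moreover have "4 * A * real (k + 1) * real k = 2 * a * real k" by (simp add: a_def)
    ultimately show ?thesis by (simp only: P scaleR_scaleR)
  qed
  also have "a *\<^sub>R T + a *\<^sub>R T + (2 * a * real k) *\<^sub>R T = (a + a + 2 * a * real k) *\<^sub>R T"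
    by (simp only: scaleR_add_left)
  also have "a + a + 2 * a * real k = 4 * A * (real (k + 1))\<^sup>2"
    by (simp add: a_def power2_eq_square algebra_simps)
  finally have 1: "G11 + G22 = (4 * A * (real (k + 1))\<^sup>2) *\<^sub>R T - (N * \<kappa>\<^sup>2) *\<^sub>R ?R" .
  have 2: "q33 X Y Z = (2 * A) *\<^sub>R ?r ^ (k + 1) + N *\<^sub>R ?R"
    by (simp add: q33_def N_def)
  have 3: "L13 * L13 + L23 * L23 = ((e * real (k + 2))\<^sup>2) *\<^sub>R ?r ^ (k + 1)"
    unfolding L_defs repow_impow_norm[symmetric]
    by (simp add: power2_eq_square scaleR_add_right del: repow.simps impow.simps)
  have "T = (Z * repow k X Y)\<^sup>2 + (Z * impow k X Y)\<^sup>2"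
    unfolding T_def repow_impow_norm[symmetric] by (simp add: algebra_simps power_mult_distrib)
  then have 4: "L11 * L11 + L12 * L12 = ((e * real (k + 2) * real (k + 1))\<^sup>2) *\<^sub>R T"
    unfolding L_defs by (simp add: power2_eq_square scaleR_add_right)
  have e1: "c\<^sup>2 * (4 * A * (real (k + 1))\<^sup>2) = 2 * s * c ^ 3 * (e * real (k + 2) * real (k + 1))\<^sup>2"
  proof -
    have "c\<^sup>2 * (4 * A * (real (k + 1))\<^sup>2) = 2 * c\<^sup>2 * (2 * A) * (real (k + 1))\<^sup>2" by simp
    also have "\<dots> = 2 * s * c ^ 3 * (e * real (k + 2) * real (k + 1))\<^sup>2"
      unfolding A by (simp add: power2_eq_square power3_eq_cube)
    finally show ?thesis .
  qed
  have e2: "c\<^sup>2 * (N * \<kappa>\<^sup>2) = N"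
    using \<kappa> by (metis mult.commute mult.left_commute mult.right_neutral power_mult_distrib power_one)
  show ?thesis
    unfolding 1 2 3 4 scaleR_diff_right scaleR_scaleR mult_minus_left e1 e2 A by simp
qed

lemma order_ge_residual:
  assumes "2 * A = s * c * (e * real (k + 2))\<^sup>2" "\<kappa> * c = 1"
  shows "order_ge (2 * k + 3) (NN c s (q11 X Y Z) (q12 X Y Z) (q13 X Y Z) (q22 X Y Z) (q23 X Y Z) (q33 X Y Z) - q33 X Y Z)"
proof -
  have LG: "order_ge (2 * k + 3) (p * q)" if "order_ge (k + 1) p" "order_ge (2 * k + 2) q" for p q
    using that by (intro order_ge_multI) auto
  have G': "order_ge (k + 1) G11" "order_ge (k + 1) G12" "order_ge (k + 1) G13"
    "order_ge (k + 1) G22" "order_ge (k + 1) G23" "order_ge (k + 1) (q33 X Y Z)"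
    by (rule order_ge_mono, rule order_ge_G, simp)+
  have det: "order_ge (2 * k + 3) (det3s (L11 + G11) (L12 + G12) (L13 + G13) (- L11 + G22) (L23 + G23) (q33 X Y Z))"
    using order_ge_q2nd unfolding q_split by (rule order_ge_det3s) simp
  show ?thesis
    unfolding q_split NN_split residual_cancel[OF assms] add_0_left
    by (intro order_ge_add order_ge_diff order_ge_scaleR LG det order_ge_L order_ge_G G')
qed

end

end

section \<open>The exact solution by a contraction\<close>

lemma norm_zint_d_le: 
  "norm (zint_d1 p) \<le> norm p" "norm (zint_d2 p) \<le> norm p"
  "norm (zint_d1 (zint_d1 p)) \<le> norm p / 4" "norm (zint_d2 (zint_d2 p)) \<le> norm p / 4"
  "norm (zint_d1 (zint_d2 p)) \<le> norm p"
proof -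
  have 1: "norm (zint_d1 p) \<le> norm p / 2" "norm (zint_d2 p) \<le> norm p / 2" for p
    by (rule norm_zint_d1 norm_zint_d2)+
  show "norm (zint_d1 p) \<le> norm p" "norm (zint_d2 p) \<le> norm p"
    using 1[of p] norm_ge_zero[of p] by linarith+
  show "norm (zint_d1 (zint_d1 p)) \<le> norm p / 4" "norm (zint_d2 (zint_d2 p)) \<le> norm p / 4"
    using 1[of p] 1(1)[of "zint_d1 p"] 1(2)[of "zint_d2 p"] by linarith+
  show "norm (zint_d1 (zint_d2 p)) \<le> norm p"
    using 1(2)[of p] 1(1)[of "zint_d2 p"] norm_ge_zero[of p] by linarith
qed

lemma NN_zero: "NN c s 0 0 0 0 0 0 = 0"
  by (simp add: NN_def det3s_def)

text \<open>The unknown \<open>\<omega>\<close> corrects \<open>w_zz\<close>; the other second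
  derivatives are corrected by \<open>zint_d1\<close> and \<open>zint_d2\<close> applied to it. The
  map \<open>\<omega> \<mapsto> NN (...) - P33\<close> preserves the order condition because the
  residual at \<open>\<omega> = 0\<close> has order at least \<open>d\<close> and \<open>NN\<close>
  respects congruences.\<close>

lemma NN_fixed_point:
  fixes P11 :: wps
  assumes cs: "\<bar>c\<bar> \<le> 1" "\<bar>s\<bar> \<le> 1"
    and P: "norm P11 \<le> \<mu>" "norm P12 \<le> \<mu>" "norm P13 \<le> \<mu>" "norm P22 \<le> \<mu>" "norm P23 \<le> \<mu>" "norm P33 \<le> \<mu>"
    and \<mu>: "\<mu> = 1 / 3200"
    and ord: "order_ge d (NN c s P11 P12 P13 P22 P23 P33 - P33)"
  shows "\<exists>\<omega>. order_ge d \<omega> \<and> NN c s (P11 + zint_d1 (zint_d1 \<omega>)) (P12 + zint_d1 (zint_d2 \<omega>)) (P13 + zint_d1 \<omega>)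
    (P22 + zint_d2 (zint_d2 \<omega>)) (P23 + zint_d2 \<omega>) (P33 + \<omega>) = P33 + \<omega>"
proof -
  define F where "F \<omega> = NN c s (P11 + zint_d1 (zint_d1 \<omega>)) (P12 + zint_d1 (zint_d2 \<omega>)) (P13 + zint_d1 \<omega>)
    (P22 + zint_d2 (zint_d2 \<omega>)) (P23 + zint_d2 \<omega>) (P33 + \<omega>)" for \<omega>
  \<comment> \<open>The radius 1/200 keeps all arguments of \<open>NN\<close> below 1/100, as
    \<open>NN_Lipschitz\<close> demands. With contraction factor 3/4 the ball is mapped into itself
    once 0 is moved by at most 1/800, which is \<open>4 * \<mu>\<close>.\<close>
  define S where "S = {\<omega>. order_ge d \<omega>} \<inter> cball 0 (1 / 200)"
  have "complete S"
    unfolding S_def complete_eq_closed by (intro closed_Int closed_order_ge closed_cball)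
  have F0: "F 0 = NN c s P11 P12 P13 P22 P23 P33" by (simp add: F_def)
  have small: "norm (p + q) \<le> 1 / 100" if "norm p \<le> \<mu>" "norm q \<le> norm \<omega>" "norm \<omega> \<le> 1 / 200" for p q \<omega> :: wps
    using norm_triangle_ineq[of p q] that \<mu> by linarith
  have Lip: "norm (F \<omega> - F \<omega>') \<le> 3 / 4 * norm (\<omega> - \<omega>')"
    if w: "norm \<omega> \<le> 1 / 200" "norm \<omega>' \<le> 1 / 200" for \<omega> \<omega>'
  proof -
    have l: "lip (1 / 100) (norm (\<omega> - \<omega>')) (p + q) (p + q')"
      if "norm p \<le> \<mu>" "norm q \<le> norm \<omega>" "norm q' \<le> norm \<omega>'" "norm (q - q') \<le> norm (\<omega> - \<omega>')" for p q q' :: wps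
      unfolding lip_def using small[OF that(1,2) w(1)] small[OF that(1,3) w(2)] that(4) by simp
    have q4: "norm (zint_d1 (zint_d1 p)) \<le> norm p" "norm (zint_d2 (zint_d2 p)) \<le> norm p" for p :: wps
      using norm_zint_d_le(3,4)[of p] norm_ge_zero[of p] by linarith+
    have "(P11 + zint_d1 (zint_d1 \<omega>) + (P22 + zint_d2 (zint_d2 \<omega>))) - (P11 + zint_d1 (zint_d1 \<omega>') + (P22 + zint_d2 (zint_d2 \<omega>')))
      = zint_d1 (zint_d1 (\<omega> - \<omega>')) + zint_d2 (zint_d2 (\<omega> - \<omega>'))"
      by (simp add: zint_diff algebra_simps)
    then have tr: "norm ((P11 + zint_d1 (zint_d1 \<omega>) + (P22 + zint_d2 (zint_d2 \<omega>))) - (P11 + zint_d1 (zint_d1 \<omega>') + (P22 + zint_d2 (zint_d2 \<omega>'))))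
      \<le> norm (\<omega> - \<omega>') / 2"
      using norm_triangle_ineq[of "zint_d1 (zint_d1 (\<omega> - \<omega>'))" "zint_d2 (zint_d2 (\<omega> - \<omega>'))"]
        norm_zint_d_le(3,4)[of "\<omega> - \<omega>'"] by simp
    show ?thesis
      unfolding F_def
      by (rule NN_Lipschitz[OF cs _ _ _ _ _ _ tr refl]; rule l)
        (simp_all add: P norm_zint_d_le q4 flip: zint_diff)
  qed
  have F0n: "norm (F 0 - P33) \<le> 1 / 800"
  proof -
    \<comment> \<open>The difference bound \<open>D\<close> is taken as \<open>4 * \<mu>\<close>
      because the trace hypothesis asks for \<open>D / 2\<close>, while
      \<open>norm (P11 + P22)\<close> is only known to be at most \<open>2 * \<mu>\<close>.\<close>
    have l: "lip (1 / 100) (4 * \<mu>) p 0" if "norm p \<le> \<mu>" for p :: wps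
      using that norm_ge_zero[of p] \<mu> by (simp add: lip_def)
    have tr: "norm ((P11 + P22) - (0 + 0)) \<le> 4 * \<mu> / 2"
      using norm_triangle_ineq[of P11 P22] P(1) P(4) by simp
    have "norm (F 0 - NN c s 0 0 0 0 0 0) \<le> 3 / 4 * (4 * \<mu>)"
      unfolding F0 by (rule NN_Lipschitz[OF cs _ _ _ _ _ _ tr refl]; rule l; rule P)
    then have "norm (F 0) \<le> 3 * \<mu>" by (simp add: NN_zero)
    then show ?thesis using norm_triangle_ineq4[of "F 0" P33] P(6) \<mu> by linarith
  qed
  have "\<exists>!\<omega>\<in>S. F \<omega> - P33 = \<omega>"
  proof (rule Banach_fix)
    show "complete S" by fact
    have "0 \<in> S" by (simp add: S_def)
    then show "S \<noteq> {}" by blast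
    show "(0::real) \<le> 3 / 4" "3 / 4 < (1::real)" by simp_all
    show "dist (F \<omega> - P33) (F \<omega>' - P33) \<le> 3 / 4 * dist \<omega> \<omega>'" if "\<omega> \<in> S" "\<omega>' \<in> S" for \<omega> \<omega>'
      using Lip[of \<omega> \<omega>'] that by (simp add: S_def dist_norm)
    show "(\<lambda>\<omega>. F \<omega> - P33) ` S \<subseteq> S"
    proof (intro image_subsetI)
      fix \<omega> assume w: "\<omega> \<in> S"
      have o: "order_ge d \<omega>" and n: "norm \<omega> \<le> 1 / 200" using w by (auto simp: S_def)
      have "F \<omega> - P33 = (F \<omega> - F 0) + (F 0 - P33)" by simp
      then have "norm (F \<omega> - P33) \<le> norm (F \<omega> - F 0) + norm (F 0 - P33)" using norm_triangle_ineq by metis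
      also have "\<dots> \<le> 1 / 200" using Lip[of \<omega> 0] n F0n by simp
      finally have 1: "norm (F \<omega> - P33) \<le> 1 / 200" .
      have "order_ge d (F \<omega> - NN c s P11 P12 P13 P22 P23 P33)"
        unfolding F_def by (rule NN_cong_order) (simp_all add: o order_ge_zint)
      from order_ge_add[OF this ord] have "order_ge d (F \<omega> - P33)" by simp
      with 1 show "F \<omega> - P33 \<in> S" by (simp add: S_def)
    qed
  qed
  then obtain \<omega> where "\<omega> \<in> S" "F \<omega> - P33 = \<omega>" by blast
  then show ?thesis
    by (intro exI[of _ \<omega>]) (auto simp: S_def F_def algebra_simps diff_eq_eq)
qed

lemma add_power_le:
  fixes a b :: real
  assumes "a \<ge> 0" "b \<ge> 0"
  shows "(a + b) ^ n \<le> 2 ^ n * (a ^ n + b ^ n)"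
proof -
  have "(a + b) ^ n \<le> (2 * max a b) ^ n" using assms by (intro power_mono) auto
  also have "\<dots> = 2 ^ n * max a b ^ n" by (simp add: power_mult_distrib)
  also have "max a b ^ n \<le> a ^ n + b ^ n" using assms by (auto simp: max_def)
  finally show ?thesis by simp
qed

text \<open>The first term is positive off the z-axis, the second on it. By
  \<open>repow_even_lower\<close> the negative part of the second is at most a multiple of
  \<open>(x^2 + y^2)^(k+1)\<close>, so a small \<open>\<eta>\<close> makes it harmless.\<close>

lemma leading_term_positive:
  fixes \<alpha> N \<kappa> :: real
  assumes "\<alpha> > 0" "N > 0" "\<kappa> > 0"
  shows "\<exists>\<eta>>0. \<exists>c0>0. \<forall>x y z. \<alpha> * (x\<^sup>2 + y\<^sup>2) ^ (k + 1) + \<eta> * N * repow (2 * (k + 1)) z (\<kappa> * x)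
    \<ge> c0 * (x\<^sup>2 + y\<^sup>2 + z\<^sup>2) ^ (k + 1)"
proof -
  obtain C where C: "C > 0" "\<And>z q::real. repow (2 * (k + 1)) z q \<ge> z ^ (2 * (k + 1)) / 2 - C * q ^ (2 * (k + 1))"
    using repow_even_lower[of "k + 1"] by blast
  define D where "D = N * C * \<kappa> ^ (2 * (k + 1))"
  \<comment> \<open>With this value the negative part \<open>\<eta> * D\<close> uses up exactly half
    of \<open>\<alpha>\<close>.\<close>
  define \<eta> where "\<eta> = \<alpha> / (2 * D)"
  have D: "D > 0" using assms C unfolding D_def by (intro mult_pos_pos zero_less_power) auto
  have \<eta>: "\<eta> > 0" using D assms by (simp add: \<eta>_def)
  define b where "b = min (\<alpha> / 2) (\<eta> * N / 2)"
  have b: "b > 0" "b \<le> \<alpha> / 2" "b \<le> \<eta> * N / 2" using assms \<eta> by (auto simp: b_def)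
  have "\<alpha> * (x\<^sup>2 + y\<^sup>2) ^ (k + 1) + \<eta> * N * repow (2 * (k + 1)) z (\<kappa> * x)
      \<ge> (b / 2 ^ (k + 1)) * (x\<^sup>2 + y\<^sup>2 + z\<^sup>2) ^ (k + 1)" for x y z :: real
  proof -
    let ?r = "(x\<^sup>2 + y\<^sup>2) ^ (k + 1)" and ?z = "(z\<^sup>2) ^ (k + 1)"
    have "(\<kappa> * x) ^ (2 * (k + 1)) = \<kappa> ^ (2 * (k + 1)) * (x\<^sup>2) ^ (k + 1)"
      by (simp only: power_mult_distrib power_mult)
    also have "\<dots> \<le> \<kappa> ^ (2 * (k + 1)) * ?r"
      using assms by (intro mult_left_mono power_mono) auto
    finally have q: "(\<kappa> * x) ^ (2 * (k + 1)) \<le> \<kappa> ^ (2 * (k + 1)) * ?r" .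
    have "repow (2 * (k + 1)) z (\<kappa> * x) \<ge> ?z / 2 - C * (\<kappa> * x) ^ (2 * (k + 1))"
      using C(2)[of z "\<kappa> * x"] by (simp only: power_mult)
    then have "repow (2 * (k + 1)) z (\<kappa> * x) \<ge> ?z / 2 - C * (\<kappa> ^ (2 * (k + 1)) * ?r)"
      using mult_left_mono[OF q, of C] C(1) by linarith
    then have "\<eta> * N * repow (2 * (k + 1)) z (\<kappa> * x) \<ge> \<eta> * N * (?z / 2 - C * (\<kappa> ^ (2 * (k + 1)) * ?r))"
      using \<eta> assms by (intro mult_left_mono) auto
    also have "\<eta> * N * (?z / 2 - C * (\<kappa> ^ (2 * (k + 1)) * ?r)) = \<eta> * N / 2 * ?z - \<eta> * D * ?r"
      by (simp add: D_def algebra_simps)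
    also have "\<eta> * D = \<alpha> / 2" using D by (simp add: \<eta>_def)
    finally have "\<alpha> * ?r + \<eta> * N * repow (2 * (k + 1)) z (\<kappa> * x) \<ge> \<alpha> / 2 * ?r + \<eta> * N / 2 * ?z"
      by (simp add: field_simps)
    moreover have "b * ?r \<le> \<alpha> / 2 * ?r" "b * ?z \<le> \<eta> * N / 2 * ?z"
      using b by (intro mult_right_mono; simp)+
    moreover have "(b / 2 ^ (k + 1)) * (x\<^sup>2 + y\<^sup>2 + z\<^sup>2) ^ (k + 1) \<le> b * ?r + b * ?z"
    proof -
      have "(b / 2 ^ (k + 1)) * (x\<^sup>2 + y\<^sup>2 + z\<^sup>2) ^ (k + 1) \<le> (b / 2 ^ (k + 1)) * (2 ^ (k + 1) * (?r + ?z))"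
        using b by (intro mult_left_mono add_power_le) auto
      then show ?thesis by (simp add: algebra_simps)
    qed
    ultimately show ?thesis by linarith
  qed
  moreover have "b / 2 ^ (k + 1) > 0" using b by simp
  ultimately show ?thesis using \<eta> by blast
qed

text \<open>The condition on \<open>A\<close> in \<open>residual_cancel\<close> forces
  \<open>A\<close> to scale like \<open>e^2\<close>. Scaling \<open>B\<close> alike preserves the
  ratio found in \<open>leading_term_positive\<close>, and all second derivatives tend to 0 with
  \<open>e\<close>.\<close>

lemma small_parameter:
  fixes X Y Z :: wps
  assumes "\<mu> > 0"
  shows "\<exists>e>0. norm (approx_terms.q11 k e (a * e\<^sup>2) (b * e\<^sup>2) \<kappa> X Y Z) \<le> \<mu> \<and>
    norm (approx_terms.q12 k e (a * e\<^sup>2) X Y Z) \<le> \<mu> \<and>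
    norm (approx_terms.q13 k e (a * e\<^sup>2) (b * e\<^sup>2) \<kappa> X Y Z) \<le> \<mu> \<and>
    norm (approx_terms.q22 k e (a * e\<^sup>2) X Y Z) \<le> \<mu> \<and>
    norm (approx_terms.q23 k e (a * e\<^sup>2) X Y Z) \<le> \<mu> \<and>
    norm (approx_terms.q33 k (a * e\<^sup>2) (b * e\<^sup>2) \<kappa> X Y Z) \<le> \<mu>"
proof -
  have ev: "\<forall>\<^sub>F e in at_right 0. norm (f e) \<le> \<mu>" if "(f \<longlongrightarrow> 0) (at_right 0)" for f :: "real \<Rightarrow> wps"
    using tendstoD[OF that assms] by eventually_elim (simp add: dist_norm)
  have t: "((\<lambda>e::real. e) \<longlongrightarrow> 0) (at_right 0)" by (rule tendsto_ident_at)
  note q = approx_terms.q11_def approx_terms.q12_def approx_terms.q13_def approx_terms.q22_def approx_terms.q23_def approx_terms.q33_def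
  have "\<forall>\<^sub>F e::real in at_right 0. 0 < e"
    by (rule eventually_at_right_less)
  moreover have "\<forall>\<^sub>F e in at_right 0. norm (approx_terms.q11 k e (a * e\<^sup>2) (b * e\<^sup>2) \<kappa> X Y Z) \<le> \<mu>"
    by (rule ev) (unfold q, auto intro!: tendsto_eq_intros t)
  moreover have "\<forall>\<^sub>F e in at_right 0. norm (approx_terms.q12 k e (a * e\<^sup>2) X Y Z) \<le> \<mu>"
    by (rule ev) (unfold q, auto intro!: tendsto_eq_intros t)
  moreover have "\<forall>\<^sub>F e in at_right 0. norm (approx_terms.q13 k e (a * e\<^sup>2) (b * e\<^sup>2) \<kappa> X Y Z) \<le> \<mu>"
    by (rule ev) (unfold q, auto intro!: tendsto_eq_intros t)
  moreover have "\<forall>\<^sub>F e in at_right 0. norm (approx_terms.q22 k e (a * e\<^sup>2) X Y Z) \<le> \<mu>"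
    by (rule ev) (unfold q, auto intro!: tendsto_eq_intros t)
  moreover have "\<forall>\<^sub>F e in at_right 0. norm (approx_terms.q23 k e (a * e\<^sup>2) X Y Z) \<le> \<mu>"
    by (rule ev) (unfold q, auto intro!: tendsto_eq_intros t)
  moreover have "\<forall>\<^sub>F e in at_right 0. norm (approx_terms.q33 k (a * e\<^sup>2) (b * e\<^sup>2) \<kappa> X Y Z) \<le> \<mu>"
    by (rule ev) (unfold q, auto intro!: tendsto_eq_intros t)
  ultimately have "\<forall>\<^sub>F e in at_right 0. 0 < e \<and> norm (approx_terms.q11 k e (a * e\<^sup>2) (b * e\<^sup>2) \<kappa> X Y Z) \<le> \<mu> \<and>
    norm (approx_terms.q12 k e (a * e\<^sup>2) X Y Z) \<le> \<mu> \<and>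
    norm (approx_terms.q13 k e (a * e\<^sup>2) (b * e\<^sup>2) \<kappa> X Y Z) \<le> \<mu> \<and>
    norm (approx_terms.q22 k e (a * e\<^sup>2) X Y Z) \<le> \<mu> \<and>
    norm (approx_terms.q23 k e (a * e\<^sup>2) X Y Z) \<le> \<mu> \<and>
    norm (approx_terms.q33 k (a * e\<^sup>2) (b * e\<^sup>2) \<kappa> X Y Z) \<le> \<mu>"
    by eventually_elim blast
  then show ?thesis using eventually_happens[of _ "at_right (0::real)"] by auto
qed

lemma has_grad_ev_add:
  assumes x: "x \<in> dom0" and ev: "\<And>y. y \<in> dom0 \<Longrightarrow> ev P y = q y"
    and "has_grad q (ev P1 x) (ev P2 x) (ev P3 x) x"
    and "has_grad (ev R) (ev R1 x) (ev R2 x) (ev R3 x) x"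
  shows "has_grad (ev (P + R)) (ev (P1 + R1) x) (ev (P2 + R2) x) (ev (P3 + R3) x) x"
proof -
  have "has_grad (\<lambda>x. q x + ev R x) (ev (P1 + R1) x) (ev (P2 + R2) x) (ev (P3 + R3) x) x"
    using has_grad_add[OF assms(3,4)] by (simp only: ev_add[OF x])
  then show ?thesis
    unfolding has_grad_def gderiv_def
    by (subst has_derivative_cong_open[OF open_ball x, of _ "\<lambda>x. q x + ev R x"]) (simp_all add: ev_add ev)
qed

text \<open>The data from which the transform is built. The lower bound for \<open>ev K33\<close>
  will yield the Hoelder exponent, and the upper bound for \<open>ev W3\<close> on the axis its
  sharpness.\<close>

lemma slag_series:
  fixes c s :: real and k :: nat
  assumes c: "0 < c" "c \<le> 1" and s: "0 < s" "s \<le> 1"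
  obtains W W1 W2 W3 K11 K12 K13 K22 K23 K33 :: wps and c0 r0 C :: real
  where "\<And>x. x \<in> dom0 \<Longrightarrow> has_grad (ev W) (ev W1 x) (ev W2 x) (ev W3 x) x"
    and "\<And>x. x \<in> dom0 \<Longrightarrow> has_grad (ev W1) (ev K11 x) (ev K12 x) (ev K13 x) x"
    and "\<And>x. x \<in> dom0 \<Longrightarrow> has_grad (ev W2) (ev K12 x) (ev K22 x) (ev K23 x) x"
    and "\<And>x. x \<in> dom0 \<Longrightarrow> has_grad (ev W3) (ev K13 x) (ev K23 x) (ev K33 x) x"
    and "\<And>x. x \<in> dom0 \<Longrightarrow> ev K33 x = NN c s (ev K11 x) (ev K12 x) (ev K13 x) (ev K22 x) (ev K23 x) (ev K33 x)"
    and "order_ge 3 W" "order_ge 2 W3"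
    and "order_ge 1 K11" "order_ge 1 K12" "order_ge 1 K13" "order_ge 1 K22" "order_ge 1 K23" "order_ge 1 K33"
    and "0 < c0" "0 < r0" "r0 \<le> 1 / 16" "\<And>x. norm x < r0 \<Longrightarrow> c0 * norm x ^ (2 * k + 2) \<le> ev K33 x"
    and "0 < C" "\<And>x. x \<in> dom0 \<Longrightarrow> x $ 1 = 0 \<Longrightarrow> x $ 2 = 0 \<Longrightarrow> \<bar>ev W3 x\<bar> \<le> C * norm x ^ (2 * k + 3)"
proof -
  define \<kappa> where "\<kappa> = 1 / c"
  have \<kappa>: "\<kappa> > 0" "\<kappa> * c = 1" using c by (auto simp: \<kappa>_def)
  define \<alpha> where "\<alpha> = s * c * (real (k + 2))\<^sup>2"
  define N where "N = real (2 * k + 4) * real (2 * k + 3)"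
  have "\<alpha> > 0" "N > 0" using c s by (auto simp: \<alpha>_def N_def)
  from leading_term_positive[OF this \<kappa>(1), of k] obtain \<eta> b where
    \<eta>: "\<eta> > 0" and b: "b > 0" and lead: "\<And>x y z. \<alpha> * (x\<^sup>2 + y\<^sup>2) ^ (k + 1) + \<eta> * N * repow (2 * (k + 1)) z (\<kappa> * x)
    \<ge> b * (x\<^sup>2 + y\<^sup>2 + z\<^sup>2) ^ (k + 1)" by blast
  let ?X = "var 1" and ?Y = "var 2" and ?Z = "var 3"
  from small_parameter[of "1 / 3200" k "\<alpha> / 2" \<eta> \<kappa> ?X ?Y ?Z] obtain e where e: "e > 0" and
    sm: "norm (approx_terms.q11 k e (\<alpha> / 2 * e\<^sup>2) (\<eta> * e\<^sup>2) \<kappa> ?X ?Y ?Z) \<le> 1 / 3200"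
    "norm (approx_terms.q12 k e (\<alpha> / 2 * e\<^sup>2) ?X ?Y ?Z) \<le> 1 / 3200"
    "norm (approx_terms.q13 k e (\<alpha> / 2 * e\<^sup>2) (\<eta> * e\<^sup>2) \<kappa> ?X ?Y ?Z) \<le> 1 / 3200"
    "norm (approx_terms.q22 k e (\<alpha> / 2 * e\<^sup>2) ?X ?Y ?Z) \<le> 1 / 3200"
    "norm (approx_terms.q23 k e (\<alpha> / 2 * e\<^sup>2) ?X ?Y ?Z) \<le> 1 / 3200"
    "norm (approx_terms.q33 k (\<alpha> / 2 * e\<^sup>2) (\<eta> * e\<^sup>2) \<kappa> ?X ?Y ?Z) \<le> 1 / 3200" by auto
  define A where "A = \<alpha> / 2 * e\<^sup>2"
  define B where "B = \<eta> * e\<^sup>2"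
  interpret approx_terms k e A B \<kappa> .
  note sm = sm[folded A_def B_def]
  have v: "order_ge 1 ?X" "order_ge 1 ?Y" "order_ge 1 ?Z" by (rule order_ge_var)+
  have "2 * A = s * c * (e * real (k + 2))\<^sup>2" by (simp add: A_def \<alpha>_def power_mult_distrib)
  note res = order_ge_residual[OF v this \<kappa>(2)]
  have "\<bar>c\<bar> \<le> 1" "\<bar>s\<bar> \<le> 1" using c s by auto
  from NN_fixed_point[OF this sm refl res] obtain \<omega> where
    \<omega>: "order_ge (2 * k + 3) \<omega>" and
    fixp: "NN c s (q11 ?X ?Y ?Z + zint_d1 (zint_d1 \<omega>)) (q12 ?X ?Y ?Z + zint_d1 (zint_d2 \<omega>)) (q13 ?X ?Y ?Z + zint_d1 \<omega>)
    (q22 ?X ?Y ?Z + zint_d2 (zint_d2 \<omega>)) (q23 ?X ?Y ?Z + zint_d2 \<omega>) (q33 ?X ?Y ?Z + \<omega>) = q33 ?X ?Y ?Z + \<omega>"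
    by blast
  define P where "P q = q ?X ?Y ?Z" for q :: "wps \<Rightarrow> wps \<Rightarrow> wps \<Rightarrow> wps"
  have evP: "ev (P q0) x = q0 (x $ 1) (x $ 2) (x $ 3)" "ev (P q1) x = q1 (x $ 1) (x $ 2) (x $ 3)"
    "ev (P q2) x = q2 (x $ 1) (x $ 2) (x $ 3)" "ev (P q3) x = q3 (x $ 1) (x $ 2) (x $ 3)"
    "ev (P q11) x = q11 (x $ 1) (x $ 2) (x $ 3)" "ev (P q12) x = q12 (x $ 1) (x $ 2) (x $ 3)"
    "ev (P q13) x = q13 (x $ 1) (x $ 2) (x $ 3)" "ev (P q22) x = q22 (x $ 1) (x $ 2) (x $ 3)"
    "ev (P q23) x = q23 (x $ 1) (x $ 2) (x $ 3)" "ev (P q33) x = q33 (x $ 1) (x $ 2) (x $ 3)"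
    if "x \<in> dom0" for x
    unfolding P_def by (simp_all only: ev_q[OF that] ev_var)
  have zg: "has_grad (ev (zint p)) (ev (zint_d1 p) x) (ev (zint_d2 p) x) (ev p x) x" if "x \<in> dom0" for x p
    unfolding has_grad_def by (rule GDERIV_ev_zint[OF that])
  \<comment> \<open>Each function is a polynomial plus the matching iterated integral of
    \<open>\<omega>\<close>; the correction of the solution has zero Cauchy data on the plane z =
    0.\<close>
  let ?W = "P q0 + zint (zint \<omega>)" and ?W1 = "P q1 + zint (zint_d1 \<omega>)"
    and ?W2 = "P q2 + zint (zint_d2 \<omega>)" and ?W3 = "P q3 + zint \<omega>"
    and ?K11 = "P q11 + zint_d1 (zint_d1 \<omega>)" and ?K12 = "P q12 + zint_d1 (zint_d2 \<omega>)"
    and ?K13 = "P q13 + zint_d1 \<omega>" and ?K22 = "P q22 + zint_d2 (zint_d2 \<omega>)"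
    and ?K23 = "P q23 + zint_d2 \<omega>" and ?K33 = "P q33 + \<omega>"
  have g: "has_grad (ev ?W) (ev ?W1 x) (ev ?W2 x) (ev ?W3 x) x"
    "has_grad (ev ?W1) (ev ?K11 x) (ev ?K12 x) (ev ?K13 x) x"
    "has_grad (ev ?W2) (ev ?K12 x) (ev ?K22 x) (ev ?K23 x) x"
    "has_grad (ev ?W3) (ev ?K13 x) (ev ?K23 x) (ev ?K33 x) x" if x: "x \<in> dom0" for x
  proof -
    show "has_grad (ev ?W) (ev ?W1 x) (ev ?W2 x) (ev ?W3 x) x"
      by (rule has_grad_ev_add[OF x evP(1)], assumption)
        (use has_grad_q(1) zg[OF x, of "zint \<omega>"] in \<open>simp_all add: evP[OF x] zint_d_zint\<close>)
    show "has_grad (ev ?W1) (ev ?K11 x) (ev ?K12 x) (ev ?K13 x) x"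
      by (rule has_grad_ev_add[OF x evP(2)], assumption)
        (use has_grad_q(2) zg[OF x, of "zint_d1 \<omega>"] in \<open>simp_all add: evP[OF x] zint_d_zint\<close>)
    show "has_grad (ev ?W2) (ev ?K12 x) (ev ?K22 x) (ev ?K23 x) x"
      by (rule has_grad_ev_add[OF x evP(3)], assumption)
        (use has_grad_q(3) zg[OF x, of "zint_d2 \<omega>"] in \<open>simp_all add: evP[OF x] zint_d_zint\<close>)
    show "has_grad (ev ?W3) (ev ?K13 x) (ev ?K23 x) (ev ?K33 x) x"
      by (rule has_grad_ev_add[OF x evP(4)], assumption)
        (use has_grad_q(4) zg[OF x, of "\<omega>"] in \<open>simp_all add: evP[OF x] zint_d_zint\<close>)
  qed
  have eq: "ev ?K33 x = NN c s (ev ?K11 x) (ev ?K12 x) (ev ?K13 x) (ev ?K22 x) (ev ?K23 x) (ev ?K33 x)"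
    if x: "x \<in> dom0" for x
    using arg_cong[OF fixp, of "\<lambda>p. ev p x"] unfolding ev_NN[OF x] P_def by simp
  have o\<omega>: "order_ge n \<omega>" if "n \<le> 2 * k + 3" for n using order_ge_mono[OF \<omega> that] .
  have oz: "order_ge n (zint \<omega>)" if "n \<le> 2 * k + 4" for n
    using order_ge_mono[OF order_ge_zint(1)[OF \<omega>]] that by simp
  have ozz: "order_ge n (zint (zint \<omega>))" if "n \<le> 2 * k + 5" for n
    using order_ge_mono[OF order_ge_zint(1)[OF order_ge_zint(1)[OF \<omega>]]] that by simp
  have ords: "order_ge 3 ?W" "order_ge 2 ?W3"
    "order_ge 1 ?K11" "order_ge 1 ?K12" "order_ge 1 ?K13" "order_ge 1 ?K22" "order_ge 1 ?K23" "order_ge 1 ?K33"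
    unfolding P_def
    by (intro order_ge_add order_ge_mono[OF order_ge_q0[OF v]] order_ge_mono[OF order_ge_q3[OF v]]
        order_ge_q2nd[OF v, THEN order_ge_mono] oz ozz order_ge_zint(2,3) o\<omega>; simp)+
  obtain K where K: "K > 0" "\<And>x. x \<in> dom0 \<Longrightarrow> \<bar>ev \<omega> x\<bar> \<le> K * norm x ^ (2 * k + 3)"
    using ev_order_bound[OF \<omega>] by blast
  \<comment> \<open>The leading part is at least \<open>2 * c0 * norm x ^ (2 * k + 2)\<close>. One
    half is kept, the other absorbs \<open>ev \<omega>\<close>, which is one order smaller and hence
    negligible once \<open>K * norm x \<le> c0\<close>.\<close>
  define c0 where "c0 = e\<^sup>2 * b / 2"
  define r0 where "r0 = min (1 / 16) (c0 / K)"
  have c0: "c0 > 0" and r0: "r0 > 0" "r0 \<le> 1 / 16" using e b K by (auto simp: c0_def r0_def)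
  have pos: "c0 * norm x ^ (2 * k + 2) \<le> ev ?K33 x" if n: "norm x < r0" for x
  proof -
    have x: "x \<in> dom0" using n r0 by simp
    have nx: "(x $ 1)\<^sup>2 + (x $ 2)\<^sup>2 + (x $ 3)\<^sup>2 = (norm x)\<^sup>2"
      by (simp add: norm_vec_def L2_set_def sum_3 real_sqrt_pow2)
    have "ev (P q33) x = e\<^sup>2 * (\<alpha> * ((x $ 1)\<^sup>2 + (x $ 2)\<^sup>2) ^ (k + 1) + \<eta> * N * repow (2 * (k + 1)) (x $ 3) (\<kappa> * x $ 1))"
      unfolding evP[OF x] q33_def real_scaleR_def unfolding A_def B_def N_def
      by (simp add: algebra_simps del: repow.simps)
    also have "\<dots> \<ge> e\<^sup>2 * (b * ((norm x)\<^sup>2) ^ (k + 1))"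
      using lead[of "x $ 1" "x $ 2" "x $ 3"] unfolding nx by (intro mult_left_mono) auto
    also have "((norm x)\<^sup>2) ^ (k + 1) = norm x ^ (2 * k + 2)"
      by (simp only: power_mult[symmetric] distrib_left mult_1_right)
    finally have 1: "ev (P q33) x \<ge> 2 * c0 * norm x ^ (2 * k + 2)"
      by (simp add: c0_def)
    have "\<bar>ev \<omega> x\<bar> \<le> K * norm x * norm x ^ (2 * k + 2)"
      using K(2)[OF x] by (simp add: power_add mult_ac power3_eq_cube power2_eq_square)
    also have "\<dots> \<le> c0 * norm x ^ (2 * k + 2)"
    proof (rule mult_right_mono)
      have "norm x \<le> c0 / K" using n by (simp add: r0_def)
      then show "K * norm x \<le> c0" using K(1) by (simp add: field_simps)
    qed simp
    finally show ?thesis using 1 unfolding ev_add[OF x] by linarith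
  qed
  obtain K1 where K1: "K1 > 0" "\<And>x. x \<in> dom0 \<Longrightarrow> \<bar>ev (zint \<omega>) x\<bar> \<le> K1 * norm x ^ (2 * k + 3)"
    using ev_order_bound[OF oz, of "2 * k + 3"] by auto
  define C where "C = K1 + \<bar>B * real (2 * k + 4)\<bar>"
  have C: "C > 0" using K1 by (simp add: C_def)
  have axis: "\<bar>ev ?W3 x\<bar> \<le> C * norm x ^ (2 * k + 3)"
    if x: "x \<in> dom0" and 0: "x $ 1 = 0" "x $ 2 = 0" for x
  proof -
    have p: "\<bar>x $ 3 ^ n\<bar> \<le> norm x ^ n" for n by (rule abs_pow_component_le)
    \<comment> \<open>On the axis \<open>Re (x + i y)^m\<close> and the \<open>A\<close> term
      vanish, so only the \<open>B\<close> term remains.\<close>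
    have "ev (P q3) x = (B * real (2 * k + 4)) * x $ 3 ^ (2 * k + 3)"
      unfolding evP[OF x] by (simp add: q3_def 0 repow_one_zero)
    then have "\<bar>ev (P q3) x\<bar> \<le> \<bar>B * real (2 * k + 4)\<bar> * norm x ^ (2 * k + 3)"
      using mult_left_mono[OF p[of "2 * k + 3"] abs_ge_zero, of "B * real (2 * k + 4)"]
      by (simp only: abs_mult)
    then have "\<bar>ev ?W3 x\<bar> \<le> (\<bar>B * real (2 * k + 4)\<bar> + K1) * norm x ^ (2 * k + 3)"
      using K1(2)[OF x] unfolding ev_add[OF x] distrib_right by linarith
    also have "\<dots> \<le> C * norm x ^ (2 * k + 3)"
      by (intro mult_right_mono) (auto simp: C_def)
    finally show "\<bar>ev ?W3 x\<bar> \<le> C * norm x ^ (2 * k + 3)" .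
  qed
  show thesis
    by (rule that[OF g(1) g(2) g(3) g(4) eq ords c0 r0 pos C axis])
qed

section \<open>Sums of arctangents of eigenvalues\<close>

lemma symmetric_inner:
  fixes M :: "real ^ 'n ^ 'n"
  assumes "transpose M = M"
  shows "x \<bullet> (M *v y) = (M *v x) \<bullet> y"
  by (metis assms dot_lmul_matrix inner_commute transpose_matrix_vector)

text \<open>A minimiser \<open>v\<close> of the Rayleigh quotient in \<open>S\<close> is an
  eigenvector. For the defect \<open>u = M v - l v\<close>, minimality at \<open>v + t u\<close>
  reads \<open>0 \<le> 2 t (u \<bullet> u) + t^2 b\<close> for all \<open>t\<close>, and a suitable
  negative \<open>t\<close> violates this unless \<open>u = 0\<close>.\<close>

lemma eigen_min:
  fixes M :: "real ^ 'n ^ 'n"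
  assumes sym: "transpose M = M" and S: "subspace S" and inv: "\<And>x. x \<in> S \<Longrightarrow> M *v x \<in> S"
    and ne: "\<exists>x\<in>S. x \<noteq> 0"
  shows "\<exists>v\<in>S. \<exists>l. norm v = 1 \<and> M *v v = l *\<^sub>R v \<and> (\<forall>w\<in>S. norm w = 1 \<longrightarrow> l \<le> w \<bullet> (M *v w))"
proof -
  define q where "q x = x \<bullet> (M *v x)" for x
  have cont: "continuous_on A q" for A
    unfolding q_def by (intro continuous_intros linear_continuous_on linear_linear[THEN iffD1] matrix_vector_mul_linear) auto
  obtain y where y: "y \<in> S" "y \<noteq> 0" using ne by blast
  have "y /\<^sub>R norm y \<in> S \<inter> sphere 0 1" using y S by (auto simp: subspace_scale)
  moreover have "compact (S \<inter> sphere 0 1)" using closed_subspace[OF S] by (intro closed_Int_compact) auto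
  ultimately obtain v where v: "v \<in> S" "norm v = 1" and min: "\<And>w. w \<in> S \<Longrightarrow> norm w = 1 \<Longrightarrow> q v \<le> q w"
    using continuous_attains_inf[of "S \<inter> sphere 0 1" q] cont by fastforce
  define l where "l = q v"
  have scale: "q (r *\<^sub>R x) = r\<^sup>2 * q x" for r x
    by (simp add: q_def scaleR_matrix_vector_assoc[symmetric] matrix_vector_mult_scaleR power2_eq_square)
  have ge: "l * (x \<bullet> x) \<le> q x" if "x \<in> S" for x
  proof (cases "x = 0")
    case False
    have "l \<le> q (x /\<^sub>R norm x)"
      unfolding l_def by (rule min) (use that False S in \<open>auto simp: subspace_scale\<close>)
    then have "l \<le> q x / (norm x)\<^sup>2" by (simp add: scale power_inverse divide_inverse mult.commute)
    then show ?thesis using False by (simp add: field_simps dot_square_norm)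
  qed (simp add: q_def)
  define u where "u = M *v v - l *\<^sub>R v"
  have uS: "u \<in> S" unfolding u_def using v inv S by (intro subspace_diff subspace_scale) auto
  have vv: "v \<bullet> v = 1" using v by (simp add: dot_square_norm)
  have "u \<bullet> v = (M *v v) \<bullet> v - l * (v \<bullet> v)" by (simp add: u_def inner_diff_left)
  then have uv: "u \<bullet> v = 0" by (simp add: vv l_def q_def inner_commute)
  have uMv: "u \<bullet> (M *v v) = u \<bullet> u"
    by (metis add.right_neutral diff_add_cancel inner_add_right inner_scaleR_right mult_zero_right u_def uv)
  define b where "b = q u - l * (u \<bullet> u)"
  have t: "0 \<le> 2 * t * (u \<bullet> u) + t\<^sup>2 * b" for t
  proof -
    have "v + t *\<^sub>R u \<in> S" using v uS S by (intro subspace_add subspace_scale) auto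
    from ge[OF this] have 1: "l * ((v + t *\<^sub>R u) \<bullet> (v + t *\<^sub>R u)) \<le> q (v + t *\<^sub>R u)" .
    have 2: "(v + t *\<^sub>R u) \<bullet> (v + t *\<^sub>R u) = 1 + t\<^sup>2 * (u \<bullet> u)"
      by (simp add: inner_add_left inner_add_right vv uv inner_commute[of v u] power2_eq_square)
    have 3: "q (v + t *\<^sub>R u) = l + 2 * t * (u \<bullet> u) + t\<^sup>2 * q u"
      unfolding q_def matrix_vector_right_distrib matrix_vector_mult_scaleR
      using symmetric_inner[OF sym, of v u] uMv
      by (simp add: inner_add_left inner_add_right l_def q_def inner_commute power2_eq_square algebra_simps)
    show ?thesis using 1 unfolding 2 3 b_def by (simp add: algebra_simps)
  qed
  have "u \<bullet> u = 0"
  proof (rule ccontr)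
    assume "u \<bullet> u \<noteq> 0"
    then have p: "u \<bullet> u > 0" by simp
    define d where "d = \<bar>b\<bar> + 1"
    have d: "d > 0" "b < d" by (auto simp: d_def)
    have "0 \<le> 2 * (- ((u \<bullet> u) / d)) * (u \<bullet> u) + (- ((u \<bullet> u) / d))\<^sup>2 * b" by (rule t)
    also have "\<dots> = (u \<bullet> u)\<^sup>2 / d\<^sup>2 * (b - 2 * d)" using d by (simp add: field_simps power2_eq_square)
    also have "\<dots> < 0" using p d by (intro mult_pos_neg) auto
    finally show False by simp
  qed
  then have "M *v v = l *\<^sub>R v" by (simp add: u_def)
  then show ?thesis using v min by (auto simp: l_def q_def)
qed

lemma orthogonal_exists_3:
  fixes a b :: "real ^ 3"
  obtains x where "x \<noteq> 0" "x \<bullet> a = 0" "x \<bullet> b = 0"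
proof -
  have "dim {a, b} \<le> card {a, b}" by (rule dim_le_card') simp
  also have "\<dots> < DIM(real ^ 3)" by (simp add: card_insert_if)
  finally obtain x where "x \<noteq> 0" "\<And>y. y \<in> span {a, b} \<Longrightarrow> orthogonal x y"
    using orthogonal_to_subspace_exists by blast
  then show thesis using that[of x] by (auto simp: orthogonal_def span_base)
qed

text \<open>Minimising on successive orthogonal complements delivers the eigenvalues already in
  increasing order. The factored characteristic polynomial connects them with
  \<open>eigenvalues\<close>, which counts roots with multiplicity.\<close>

lemma spectral_3:
  fixes M :: "real ^ 3 ^ 3"
  assumes sym: "transpose M = M"
  obtains v1 v2 v3 l1 l2 l3 where
    "\<And>x. (x \<bullet> v1)\<^sup>2 + (x \<bullet> v2)\<^sup>2 + (x \<bullet> v3)\<^sup>2 = x \<bullet> x"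
    "\<And>x. x \<bullet> (M *v x) = l1 * (x \<bullet> v1)\<^sup>2 + l2 * (x \<bullet> v2)\<^sup>2 + l3 * (x \<bullet> v3)\<^sup>2"
    "v1 \<bullet> v1 = 1" "v2 \<bullet> v2 = 1" "v3 \<bullet> v3 = 1" "v1 \<bullet> v2 = 0" "v1 \<bullet> v3 = 0" "v2 \<bullet> v3 = 0"
    "l1 \<le> l2" "l2 \<le> l3"
    "\<And>t. det (mat t - M) = (t - l1) * (t - l2) * (t - l3)"
proof -
  have M0: "M *v (c *\<^sub>R x) = c *\<^sub>R (M *v x)" for c x by (rule matrix_vector_mult_scaleR)
  obtain v1 l1 where v1: "norm v1 = 1" "M *v v1 = l1 *\<^sub>R v1"
    and min1: "\<And>w. norm w = 1 \<Longrightarrow> l1 \<le> w \<bullet> (M *v w)"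
    using eigen_min[OF sym subspace_UNIV] by (metis UNIV_I axis_eq_0_iff zero_neq_one)
  define S2 where "S2 = {x. x \<bullet> v1 = 0}"
  have S2: "subspace S2" unfolding S2_def by (auto simp: subspace_def inner_add_left)
  have inv2: "M *v x \<in> S2" if "x \<in> S2" for x
    using that symmetric_inner[OF sym, of x v1] v1(2) by (simp add: S2_def)
  have "\<exists>x\<in>S2. x \<noteq> 0" using orthogonal_exists_3[of v1 v1] by (auto simp: S2_def)
  from eigen_min[OF sym S2 inv2 this] obtain v2 l2 where v2: "v2 \<in> S2" "norm v2 = 1" "M *v v2 = l2 *\<^sub>R v2"
    and min2: "\<And>w. w \<in> S2 \<Longrightarrow> norm w = 1 \<Longrightarrow> l2 \<le> w \<bullet> (M *v w)" by blast
  define S3 where "S3 = {x. x \<bullet> v1 = 0 \<and> x \<bullet> v2 = 0}"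
  have S3: "subspace S3" unfolding S3_def by (auto simp: subspace_def inner_add_left)
  have inv3: "M *v x \<in> S3" if "x \<in> S3" for x
    using that symmetric_inner[OF sym, of x v1] symmetric_inner[OF sym, of x v2] v1(2) v2(3)
    by (simp add: S3_def)
  have "\<exists>x\<in>S3. x \<noteq> 0" using orthogonal_exists_3[of v1 v2] by (auto simp: S3_def)
  from eigen_min[OF sym S3 inv3 this] obtain v3 l3 where v3: "v3 \<in> S3" "norm v3 = 1" "M *v v3 = l3 *\<^sub>R v3"
    by blast
  have n: "v1 \<bullet> v1 = 1" "v2 \<bullet> v2 = 1" "v3 \<bullet> v3 = 1" using v1 v2 v3 by (simp_all add: dot_square_norm)
  have o: "v1 \<bullet> v2 = 0" "v1 \<bullet> v3 = 0" "v2 \<bullet> v3 = 0" "v2 \<bullet> v1 = 0" "v3 \<bullet> v1 = 0" "v3 \<bullet> v2 = 0"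
    using v2(1) v3(1) by (auto simp: S2_def S3_def inner_commute)
  have l: "l1 \<le> l2" "l2 \<le> l3"
    using min1[OF v2(2)] min2[of v3] v2 v3 n by (auto simp: S2_def S3_def)
  define P :: "real ^ 3 ^ 3" where "P = (\<chi> i j. if j = 1 then v1 $ i else if j = 2 then v2 $ i else v3 $ i)"
  define D :: "real ^ 3 ^ 3" where "D = (\<chi> i j. if i = j then (if j = 1 then l1 else if j = 2 then l2 else l3) else 0)"
  have "transpose P ** P = mat 1"
    using n o by (simp add: vec_eq_iff forall_3 P_def matrix_matrix_mult_def transpose_def mat_def sum_3 inner_vec_def)
  then have PP: "P ** transpose P = mat 1" using matrix_left_right_inverse by blast
  have MP: "M ** P = P ** D"
    using v1(2) v2(3) v3(3)
    by (simp add: vec_eq_iff forall_3 P_def D_def matrix_matrix_mult_def matrix_vector_mult_def sum_3 mult.commute)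
  have M: "M = P ** D ** transpose P"
    by (metis MP PP matrix_mul_assoc matrix_mul_rid)
  have PT: "transpose P *v x = vector [x \<bullet> v1, x \<bullet> v2, x \<bullet> v3]" for x
    by (simp add: vec_eq_iff forall_3 P_def transpose_def matrix_vector_mult_def inner_vec_def sum_3 mult.commute)
  have adj: "x \<bullet> (P *v y) = (transpose P *v x) \<bullet> y" for x y
    by (simp add: dot_lmul_matrix transpose_matrix_vector)
  have nrm: "(x \<bullet> v1)\<^sup>2 + (x \<bullet> v2)\<^sup>2 + (x \<bullet> v3)\<^sup>2 = x \<bullet> x" for x
  proof -
    have "x \<bullet> x = x \<bullet> (P *v (transpose P *v x))"
      by (simp only: matrix_vector_mul_assoc PP matrix_vector_mul_lid)
    also have "\<dots> = (transpose P *v x) \<bullet> (transpose P *v x)" by (rule adj)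
    also have "\<dots> = (x \<bullet> v1)\<^sup>2 + (x \<bullet> v2)\<^sup>2 + (x \<bullet> v3)\<^sup>2"
      unfolding PT by (simp add: inner_vec_def[where x = "vector _"] sum_3 power2_eq_square)
    finally show ?thesis by simp
  qed
  have q: "x \<bullet> (M *v x) = l1 * (x \<bullet> v1)\<^sup>2 + l2 * (x \<bullet> v2)\<^sup>2 + l3 * (x \<bullet> v3)\<^sup>2" for x
  proof -
    have "x \<bullet> (M *v x) = x \<bullet> (P *v (D *v (transpose P *v x)))"
      by (subst M) (simp only: matrix_vector_mul_assoc matrix_mul_assoc)
    also have "\<dots> = (transpose P *v x) \<bullet> (D *v (transpose P *v x))" by (rule adj)
    also have "\<dots> = l1 * (x \<bullet> v1)\<^sup>2 + l2 * (x \<bullet> v2)\<^sup>2 + l3 * (x \<bullet> v3)\<^sup>2"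
      unfolding PT by (simp add: inner_vec_def[where x = "vector _"] matrix_vector_mult_def D_def sum_3 power2_eq_square algebra_simps)
    finally show ?thesis .
  qed
  have d: "det (mat t - M) = (t - l1) * (t - l2) * (t - l3)" for t
  proof -
    have "P ** mat t = mat t ** P"
      by (simp add: vec_eq_iff forall_3 matrix_matrix_mult_def mat_def sum_3)
    then have "P ** mat t ** transpose P = mat t"
      using PP by (metis matrix_mul_assoc matrix_mul_rid)
    then have "mat t - M = P ** mat t ** transpose P - P ** D ** transpose P" using M by simp
    also have "\<dots> = P ** (mat t - D) ** transpose P"
      by (simp add: vec_eq_iff forall_3 matrix_matrix_mult_def sum_3 algebra_simps)
    finally have "mat t - M = P ** (mat t - D) ** transpose P" .
    then have "det (mat t - M) = det P * det (mat t - D) * det (transpose P)" by (simp add: det_mul)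
    also have "\<dots> = det (mat t - D) * det (P ** transpose P)" by (simp add: det_mul)
    also have "\<dots> = (t - l1) * (t - l2) * (t - l3)" by (simp add: PP det_3 D_def mat_def)
    finally show ?thesis .
  qed
  show thesis by (rule that[OF nrm q n o(1-3) l d])
qed

lemma poly_charpoly_3:
  fixes M :: "real ^ 3 ^ 3"
  shows "poly (charpoly M) t = det (mat t - M)"
  unfolding charpoly_def det_3 by (simp add: mat_def algebra_simps)

lemma eigenvalues_eq:
  fixes M :: "real ^ 3 ^ 3"
  assumes "\<And>t. det (mat t - M) = (t - l1) * (t - l2) * (t - l3)"
  shows "eigenvalues M = {#l1, l2, l3#}"
proof -
  have "poly (charpoly M) = poly ([:- l1, 1:] * [:- l2, 1:] * [:- l3, 1:])"
    by (rule ext) (simp add: poly_charpoly_3 assms algebra_simps)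
  then have "charpoly M = [:- l1, 1:] * [:- l2, 1:] * [:- l3, 1:]"
    by (simp only: poly_eq_poly_eq_iff)
  then show ?thesis
    unfolding eigenvalues_def by (simp add: proots_mult del: mult_pCons_left mult_pCons_right)
qed

lemma sum_arctan_eigenvalues_eq:
  fixes M :: "real ^ 3 ^ 3"
  assumes "\<And>t. det (mat t - M) = (t - l1) * (t - l2) * (t - l3)"
  shows "sum_arctan_eigenvalues M = arctan l1 + arctan l2 + arctan l3"
  unfolding sum_arctan_eigenvalues_def eigenvalues_eq[OF assms] by simp

text \<open>The dimension count behind the min-max arguments: a plane contains a unit vector
  orthogonal to any one given vector.\<close>

lemma plane_kernel:
  fixes a b :: real
  obtains p q where "p * a + q * b = 0" "p\<^sup>2 + q\<^sup>2 = (1::real)"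
proof (cases "a = 0 \<and> b = 0")
  case True
  then show ?thesis using that[of 1 0] by simp
next
  case False
  then have n: "a\<^sup>2 + b\<^sup>2 > 0" by (simp add: sum_power2_gt_zero_iff)
  let ?r = "sqrt (a\<^sup>2 + b\<^sup>2)"
  have r: "?r > 0" "?r\<^sup>2 = a\<^sup>2 + b\<^sup>2" using n by simp_all
  show ?thesis
  proof (rule that[of "b / ?r" "- a / ?r"])
    show "b / ?r * a + - a / ?r * b = 0" by simp
    have "(b / ?r)\<^sup>2 + (- a / ?r)\<^sup>2 = (a\<^sup>2 + b\<^sup>2) / ?r\<^sup>2"
      by (simp only: power_divide add_divide_distrib power2_minus add.commute)
    also have "\<dots> = 1" unfolding r(2) by (metis divide_self less_irrefl n)
    finally show "(b / ?r)\<^sup>2 + (- a / ?r)\<^sup>2 = 1" .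
  qed
qed

text \<open>By the Courant-Fischer principle the ordered eigenvalues are monotone one by one, and
  \<open>arctan\<close> is increasing.\<close>

lemma sum_arctan_mono:
  fixes A B :: "real ^ 3 ^ 3"
  assumes "transpose A = A" "transpose B = B" and le: "\<And>x. x \<bullet> (A *v x) \<le> x \<bullet> (B *v x)"
  shows "sum_arctan_eigenvalues A \<le> sum_arctan_eigenvalues B"
proof -
  obtain v1 v2 v3 l1 l2 l3 where
    v: "\<And>x. (x \<bullet> v1)\<^sup>2 + (x \<bullet> v2)\<^sup>2 + (x \<bullet> v3)\<^sup>2 = x \<bullet> x"
    "\<And>x. x \<bullet> (A *v x) = l1 * (x \<bullet> v1)\<^sup>2 + l2 * (x \<bullet> v2)\<^sup>2 + l3 * (x \<bullet> v3)\<^sup>2"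
    "v1 \<bullet> v1 = 1" "v2 \<bullet> v2 = 1" "v3 \<bullet> v3 = 1" "v1 \<bullet> v2 = 0" "v1 \<bullet> v3 = 0" "v2 \<bullet> v3 = 0"
    "l1 \<le> l2" "l2 \<le> l3"
    and dA: "\<And>t. det (mat t - A) = (t - l1) * (t - l2) * (t - l3)"
    by (rule spectral_3[OF assms(1)]) blast
  obtain w1 w2 w3 m1 m2 m3 where
    w: "\<And>x. (x \<bullet> w1)\<^sup>2 + (x \<bullet> w2)\<^sup>2 + (x \<bullet> w3)\<^sup>2 = x \<bullet> x"
    "\<And>x. x \<bullet> (B *v x) = m1 * (x \<bullet> w1)\<^sup>2 + m2 * (x \<bullet> w2)\<^sup>2 + m3 * (x \<bullet> w3)\<^sup>2"
    "w1 \<bullet> w1 = 1" "w2 \<bullet> w2 = 1" "w3 \<bullet> w3 = 1" "w1 \<bullet> w2 = 0" "w1 \<bullet> w3 = 0" "w2 \<bullet> w3 = 0"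
    "m1 \<le> m2" "m2 \<le> m3"
    and dB: "\<And>t. det (mat t - B) = (t - m1) * (t - m2) * (t - m3)"
    by (rule spectral_3[OF assms(2)]) blast
  have comb: "l * (a\<^sup>2 + b\<^sup>2 + c\<^sup>2) \<le> p * a\<^sup>2 + q * b\<^sup>2 + r * c\<^sup>2"
    if "l \<le> p" "l \<le> q" "l \<le> r" for l p q r a b c :: real
    unfolding distrib_left by (intro add_mono mult_right_mono that) auto
  have comb': "p * a\<^sup>2 + q * b\<^sup>2 + r * c\<^sup>2 \<le> l * (a\<^sup>2 + b\<^sup>2 + c\<^sup>2)"
    if "p \<le> l" "q \<le> l" "r \<le> l" for l p q r a b c :: real
    unfolding distrib_left by (intro add_mono mult_right_mono that) auto
  have 1: "l1 \<le> m1"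
  proof -
    have "l1 * (w1 \<bullet> w1) \<le> w1 \<bullet> (A *v w1)" unfolding v(2) v(1)[of w1, symmetric] by (rule comb) (use v in auto)
    also have "\<dots> \<le> w1 \<bullet> (B *v w1)" by (rule le)
    finally show ?thesis using w by simp
  qed
  have 3: "l3 \<le> m3"
  proof -
    have "v3 \<bullet> v1 = 0" "v3 \<bullet> v2 = 0" using v(7,8) by (simp_all only: inner_commute)
    then have "l3 = v3 \<bullet> (A *v v3)" using v(5) unfolding v(2) by simp
    also have "\<dots> \<le> v3 \<bullet> (B *v v3)" by (rule le)
    also have "\<dots> \<le> m3 * (v3 \<bullet> v3)" unfolding w(2) w(1)[of v3, symmetric] by (rule comb') (use w in auto)
    finally show ?thesis using v by simp
  qed
  \<comment> \<open>The test vector lies in the span of \<open>w1\<close> and \<open>w2\<close> and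
    is orthogonal to \<open>v1\<close>: there the form of \<open>A\<close> is at least
    \<open>l2\<close> and the form of \<open>B\<close> at most \<open>m2\<close>.\<close>
  have 2: "l2 \<le> m2"
  proof -
    obtain p q where pq: "p * (w1 \<bullet> v1) + q * (w2 \<bullet> v1) = 0" "p\<^sup>2 + q\<^sup>2 = 1" by (rule plane_kernel)
    define x where "x = p *\<^sub>R w1 + q *\<^sub>R w2"
    have x1: "x \<bullet> v1 = 0" using pq by (simp add: x_def inner_add_left)
    have xw: "x \<bullet> w1 = p" "x \<bullet> w2 = q" "x \<bullet> w3 = 0"
      using w(3-8) inner_commute[of w1 w2] by (simp_all add: x_def inner_add_left)
    have xx: "x \<bullet> x = 1" using w(1)[of x] pq xw by simp
    have "l2 * (x \<bullet> x) = l2 * (0\<^sup>2 + (x \<bullet> v2)\<^sup>2 + (x \<bullet> v3)\<^sup>2)" using v(1)[of x] x1 by simp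
    also have "\<dots> \<le> l2 * 0\<^sup>2 + l2 * (x \<bullet> v2)\<^sup>2 + l3 * (x \<bullet> v3)\<^sup>2" by (rule comb) (use v in auto)
    also have "\<dots> = x \<bullet> (A *v x)" unfolding v(2) x1 by simp
    also have "\<dots> \<le> x \<bullet> (B *v x)" by (rule le)
    also have "\<dots> = m1 * p\<^sup>2 + m2 * q\<^sup>2 + m2 * 0\<^sup>2" unfolding w(2) xw by simp
    also have "\<dots> \<le> m2 * (p\<^sup>2 + q\<^sup>2 + 0\<^sup>2)" by (rule comb') (use w in auto)
    finally show ?thesis using pq xx by simp
  qed
  show ?thesis
    unfolding sum_arctan_eigenvalues_eq[OF dA] sum_arctan_eigenvalues_eq[OF dB]
    by (intro add_mono) (use 1 2 3 in \<open>auto simp: arctan_le_iff\<close>)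
qed

text \<open>A unit vector of the plane orthogonal to \<open>v3\<close> shows that the two larger
  eigenvalues are at least \<open>a\<close>. Nothing is known about the smallest one, except that
  its arctangent exceeds \<open>- pi / 2\<close>.\<close>

lemma sum_arctan_ge_plane:
  fixes A :: "real ^ 3 ^ 3"
  assumes "transpose A = A"
    and ge: "\<And>p q. a * (p\<^sup>2 + q\<^sup>2) \<le> vector [p, q, 0] \<bullet> (A *v vector [p, q, 0])"
  shows "2 * arctan a - pi / 2 \<le> sum_arctan_eigenvalues A"
proof -
  obtain v1 v2 v3 l1 l2 l3 where
    v: "\<And>x. (x \<bullet> v1)\<^sup>2 + (x \<bullet> v2)\<^sup>2 + (x \<bullet> v3)\<^sup>2 = x \<bullet> x"
    "\<And>x. x \<bullet> (A *v x) = l1 * (x \<bullet> v1)\<^sup>2 + l2 * (x \<bullet> v2)\<^sup>2 + l3 * (x \<bullet> v3)\<^sup>2"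
    "l1 \<le> l2" "l2 \<le> l3"
    and dA: "\<And>t. det (mat t - A) = (t - l1) * (t - l2) * (t - l3)"
    by (rule spectral_3[OF assms(1)]) blast
  define X where "X p q = (vector [p, q, 0] :: real ^ 3)" for p q
  have lin: "X p q \<bullet> w = p * (X 1 0 \<bullet> w) + q * (X 0 1 \<bullet> w)" for p q w
    by (simp add: X_def inner_vec_def sum_3)
  obtain p q where pq: "p * (X 1 0 \<bullet> v3) + q * (X 0 1 \<bullet> v3) = 0" "p\<^sup>2 + q\<^sup>2 = 1" by (rule plane_kernel)
  define x where "x = X p q"
  have xx: "x \<bullet> x = 1" using pq by (simp add: x_def X_def inner_vec_def sum_3 power2_eq_square)
  have x3: "x \<bullet> v3 = 0" unfolding x_def using lin[of p q v3] pq(1) by simp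
  have "a \<le> x \<bullet> (A *v x)" using ge[of p q] pq by (simp add: x_def X_def)
  also have "\<dots> = l1 * (x \<bullet> v1)\<^sup>2 + l2 * (x \<bullet> v2)\<^sup>2" unfolding v(2) x3 by simp
  also have "\<dots> \<le> l2 * (x \<bullet> v1)\<^sup>2 + l2 * (x \<bullet> v2)\<^sup>2" by (intro add_right_mono mult_right_mono v) simp
  also have "\<dots> = l2 * (x \<bullet> x)" using v(1)[of x] x3 by (simp flip: distrib_left)
  finally have l2: "a \<le> l2" using xx by simp
  have "arctan a \<le> arctan l2" "arctan a \<le> arctan l3" using l2 v by (auto simp: arctan_le_iff)
  then show ?thesis
    unfolding sum_arctan_eigenvalues_eq[OF dA] using arctan_lbound[of l1] by linarith
qed

text \<open>Real and imaginary part of the product of the \<open>1 + i l_j\<close> are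
  \<open>1 - s2\<close> and \<open>s1 - det M\<close>; up to a positive factor they are cosine and
  sine of the sum \<open>S\<close> of the arctangents. So \<open>eq\<close> says
  \<open>sin (S - \<Theta>) = 0\<close> and fixes \<open>S\<close> modulo pi. The other hypotheses
  select the branch: a negative determinant and a positive direction give
  \<open>l1 < 0 < l2 \<le> l3\<close>, hence \<open>S > - pi / 2\<close>, and the bound by
  \<open>b\<close> gives \<open>S < \<Theta> + pi\<close>.\<close>

lemma sum_arctan_eq_phase:
  fixes M :: "real ^ 3 ^ 3"
  assumes sym: "transpose M = M" and \<Theta>: "- (pi / 2) < \<Theta>" "\<Theta> < pi / 2"
    and s1: "s1 = M $ 1 $ 1 + M $ 2 $ 2 + M $ 3 $ 3"
    and s2: "s2 = M $ 1 $ 1 * M $ 2 $ 2 - (M $ 1 $ 2)\<^sup>2 + M $ 1 $ 1 * M $ 3 $ 3 - (M $ 1 $ 3)\<^sup>2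
      + M $ 2 $ 2 * M $ 3 $ 3 - (M $ 2 $ 3)\<^sup>2"
    and eq: "cos \<Theta> * (s1 - det M) = sin \<Theta> * (1 - s2)"
    and neg: "det M < 0" and pos: "0 < x0 \<bullet> (M *v x0)"
    and bound: "\<And>x. x \<bullet> (M *v x) \<le> b * (x \<bullet> x)" and b: "2 * arctan b < \<Theta> + pi"
  shows "sum_arctan_eigenvalues M = \<Theta>"
proof -
  obtain v1 v2 v3 l1 l2 l3 where
    v: "\<And>x. (x \<bullet> v1)\<^sup>2 + (x \<bullet> v2)\<^sup>2 + (x \<bullet> v3)\<^sup>2 = x \<bullet> x"
    "\<And>x. x \<bullet> (M *v x) = l1 * (x \<bullet> v1)\<^sup>2 + l2 * (x \<bullet> v2)\<^sup>2 + l3 * (x \<bullet> v3)\<^sup>2"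
    "v1 \<bullet> v1 = 1" "v2 \<bullet> v2 = 1" "v3 \<bullet> v3 = 1" "v1 \<bullet> v2 = 0" "v1 \<bullet> v3 = 0" "v2 \<bullet> v3 = 0"
    "l1 \<le> l2" "l2 \<le> l3"
    and d: "\<And>t. det (mat t - M) = (t - l1) * (t - l2) * (t - l3)"
    by (rule spectral_3[OF sym]) blast
  have symc: "M $ i $ j = M $ j $ i" for i j
  proof -
    have "M $ i $ j = transpose M $ i $ j" by (simp only: sym)
    then show ?thesis by (simp add: transpose_def)
  qed
  have sy: "M $ 2 $ 1 = M $ 1 $ 2" "M $ 3 $ 1 = M $ 1 $ 3" "M $ 3 $ 2 = M $ 2 $ 3" by (rule symc)+
  have ch: "det (mat t - M) = t ^ 3 - s1 * t\<^sup>2 + s2 * t - det M" for t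
    unfolding det_3 s1 s2 by (simp add: mat_def sy power2_eq_square power3_eq_cube algebra_simps)
  \<comment> \<open>The values of the characteristic polynomial at 0, 1 and -1 identify its
    coefficients with the elementary symmetric functions of the eigenvalues.\<close>
  have detM: "det M = l1 * l2 * l3" using ch[of 0] d[of 0] by simp
  have e1: "1 - s1 + s2 - det M = (1 - l1) * (1 - l2) * (1 - l3)"
    using ch[of 1] d[of 1] by simp
  have e2: "- 1 - s1 - s2 - det M = (- 1 - l1) * (- 1 - l2) * (- 1 - l3)"
    using ch[of "-1"] d[of "-1"] by simp
  have e3: "(1 - l1) * (1 - l2) * (1 - l3) = 1 - (l1 + l2 + l3) + (l1 * l2 + l1 * l3 + l2 * l3) - l1 * l2 * l3"
    by (simp add: algebra_simps)
  have e4: "(- 1 - l1) * (- 1 - l2) * (- 1 - l3) = - 1 - (l1 + l2 + l3) - (l1 * l2 + l1 * l3 + l2 * l3) - l1 * l2 * l3"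
    by (simp add: algebra_simps)
  have s1': "s1 = l1 + l2 + l3" and s2': "s2 = l1 * l2 + l1 * l3 + l2 * l3"
    using e1 e2 unfolding e3 e4 detM by linarith+
  have l3: "l3 > 0"
  proof (rule ccontr)
    assume "\<not> l3 > 0"
    then have "l1 \<le> 0" "l2 \<le> 0" "l3 \<le> 0" using v by linarith+
    then have "x0 \<bullet> (M *v x0) \<le> 0" unfolding v(2)
      by (intro add_nonpos_nonpos mult_nonpos_nonneg) auto
    then show False using pos by simp
  qed
  have "l1 * l2 < 0" using neg detM l3 by (simp add: mult_less_0_iff)
  then have l12: "l1 < 0" "l2 > 0" using v(9) by (auto simp: mult_less_0_iff)
  have "v3 \<bullet> v1 = 0" "v3 \<bullet> v2 = 0" "v2 \<bullet> v1 = 0" using v(6-8) by (simp_all only: inner_commute)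
  then have lb: "l2 \<le> b" "l3 \<le> b"
    using bound[of v2] bound[of v3] v(3-8) unfolding v(2) by simp_all
  have at: "arctan l1 < 0" "0 < arctan l2" "0 < arctan l3" "arctan l2 \<le> arctan b" "arctan l3 \<le> arctan b"
    using l12 l3 lb by (auto simp: arctan_le_iff)
  define S where "S = arctan l1 + arctan l2 + arctan l3"
  define C where "C = cos (arctan l1) * cos (arctan l2) * cos (arctan l3)"
  have si: "sin (arctan x) = x * cos (arctan x)" for x by (simp add: sin_arctan cos_arctan)
  have SC: "sin S = C * (s1 - det M)" "cos S = C * (1 - s2)"
    unfolding S_def C_def s1' s2' detM sin_add cos_add si by (simp_all add: algebra_simps)
  have sd: "sin (S - \<Theta>) = C * (cos \<Theta> * (s1 - det M) - sin \<Theta> * (1 - s2))"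
    unfolding sin_diff SC by algebra
  have "sin (S - \<Theta>) = 0" unfolding sd eq by simp
  moreover have "- pi < S - \<Theta>" "S - \<Theta> < pi"
    using at \<Theta> b arctan_lbound[of l1] unfolding S_def by linarith+
  ultimately have "S - \<Theta> = 0" by (rule sin_eq_0_pi[rotated 2])
  then show ?thesis unfolding sum_arctan_eigenvalues_eq[OF d] S_def by simp
qed

section \<open>The partial Legendre transform\<close>

lemma superadditive_power:
  fixes x y :: real
  assumes "x \<ge> 0" "y \<ge> 0"
  shows "x ^ Suc n + y ^ Suc n \<le> (x + y) ^ Suc n"
proof (induction n)
  case (Suc n)
  have "x ^ Suc (Suc n) + y ^ Suc (Suc n) \<le> (x + y) * (x ^ Suc n + y ^ Suc n)"
    using assms by (simp add: algebra_simps)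
  also have "\<dots> \<le> (x + y) * (x + y) ^ Suc n" using assms Suc by (intro mult_left_mono) auto
  finally show ?case by simp
qed simp

text \<open>For equal signs, superadditivity of the power gives even \<open>(b - a) ^ n\<close>. For
  opposite signs one of the absolute values is at least half the distance, which explains the
  2.\<close>

lemma odd_power_diff_ge:
  fixes a b :: real
  assumes "a \<le> b" "odd n"
  shows "((b - a) / 2) ^ n \<le> b ^ n - a ^ n"
proof -
  obtain l where n: "n = Suc l" using assms(2) by (cases n) auto
  have half: "((b - a) / 2) ^ n \<le> (b - a) ^ n" using assms by (intro power_mono) auto
  consider "a \<ge> 0" | "b \<le> 0" | "a \<le> 0" "b \<ge> 0" by linarith
  then show ?thesis
  proof cases
    case 1
    then show ?thesis using superadditive_power[of a "b - a" l] half assms(1) unfolding n by simp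
  next
    case 2
    then have "(- b) ^ n + (b - a) ^ n \<le> (- a) ^ n"
      using superadditive_power[of "- b" "b - a" l] assms(1) unfolding n by simp
    then show ?thesis using half assms(2) by simp
  next
    case 3
    have a: "(- a) ^ n \<ge> 0" "b ^ n \<ge> 0" using 3 by auto
    have "(b - a) / 2 \<le> b \<or> (b - a) / 2 \<le> - a" by (cases "- a \<le> b") (auto simp: field_simps)
    then have "((b - a) / 2) ^ n \<le> b ^ n \<or> ((b - a) / 2) ^ n \<le> (- a) ^ n"
      using 3 by (auto intro: power_mono)
    then show ?thesis using a assms(2) by auto
  qed
qed

lemma norm_vector_3_le: "norm (vector [a, b, c] :: real ^ 3) \<le> \<bar>a\<bar> + \<bar>b\<bar> + \<bar>c\<bar>"
  using norm_le_l1_cart[of "vector [a, b, c] :: real ^ 3"] by (simp add: sum_3)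

lemma vector_3_eta: "vector [x $ 1, x $ 2, x $ 3] = (x :: real ^ 3)"
  by (simp add: vec_eq_iff forall_3)

lemma has_grad_DERIV_line:
  assumes "has_grad f a b c (x + t *\<^sub>R \<xi>)"
  shows "((\<lambda>t. f (x + t *\<^sub>R \<xi>)) has_real_derivative (a * \<xi> $ 1 + b * \<xi> $ 2 + c * \<xi> $ 3)) (at t)"
proof -
  have 1: "((\<lambda>t. x + t *\<^sub>R \<xi>) has_derivative (\<lambda>h. h *\<^sub>R \<xi>)) (at t)"
    by (auto intro!: derivative_eq_intros)
  have "(f \<circ> (\<lambda>t. x + t *\<^sub>R \<xi>) has_derivative (\<lambda>h. h \<bullet> vector [a, b, c]) \<circ> (\<lambda>h. h *\<^sub>R \<xi>)) (at t)"
    using assms by (intro diff_chain_at[OF 1]) (simp add: has_grad_def gderiv_def)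
  moreover have "(\<lambda>h. h \<bullet> vector [a, b, c]) \<circ> (\<lambda>h. h *\<^sub>R \<xi>) = (*) (a * \<xi> $ 1 + b * \<xi> $ 2 + c * \<xi> $ 3)"
    by (auto simp: fun_eq_iff inner_vec_def sum_3 algebra_simps)
  ultimately show ?thesis by (simp add: has_field_derivative_def comp_def)
qed

lemma has_grad_DERIV_3:
  assumes "has_grad f a b c (vector [p, q, z])"
  shows "((\<lambda>z. f (vector [p, q, z])) has_real_derivative c) (at z)"
proof -
  have eq: "vector [p, q, z] = vector [p, q, 0] + z *\<^sub>R (axis 3 1 :: real ^ 3)" for z
    by (simp add: vec_eq_iff forall_3 axis_def)
  show ?thesis
    using has_grad_DERIV_line[of f a b c "vector [p, q, 0]" z "axis 3 1"] assms
    unfolding eq[symmetric] by (simp add: axis_def)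
qed

lemma has_grad_continuous: "has_grad f a b c x \<Longrightarrow> isCont f x"
  unfolding has_grad_def gderiv_def by (rule has_derivative_continuous)

lemma has_grad_Lipschitz:
  assumes S: "convex S" "x \<in> S" "y \<in> S"
    and f: "\<And>x. x \<in> S \<Longrightarrow> has_grad f (a x) (b x) (c x) x"
    and bd: "\<And>x. x \<in> S \<Longrightarrow> \<bar>a x\<bar> \<le> 1/4 \<and> \<bar>b x\<bar> \<le> 1/4 \<and> \<bar>c x\<bar> \<le> 1/4"
  shows "\<bar>f x - f y\<bar> \<le> norm (x - y)"
proof -
  have "norm (f x - f y) \<le> 1 * norm (x - y)"
  proof (rule differentiable_bound[OF S(1) _ _ S(2,3)])
    show "(f has_derivative (\<lambda>h. h \<bullet> vector [a x, b x, c x])) (at x within S)" if "x \<in> S" for x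
      using f[OF that] unfolding has_grad_def gderiv_def by (rule has_derivative_at_withinI)
    show "onorm (\<lambda>h. h \<bullet> (vector [a x, b x, c x] :: real ^ 3)) \<le> 1" if "x \<in> S" for x
    proof (rule onorm_le)
      fix h :: "real ^ 3"
      have "norm (vector [a x, b x, c x] :: real ^ 3) \<le> 1"
        using norm_vector_3_le[of "a x" "b x" "c x"] bd[OF that] by linarith
      then show "norm (h \<bullet> (vector [a x, b x, c x] :: real ^ 3)) \<le> 1 * norm h"
        using Cauchy_Schwarz_ineq2[of h "vector [a x, b x, c x]"]
          mult_left_mono[of "norm (vector [a x, b x, c x] :: real ^ 3)" 1 "norm h"] by simp
    qed
  qed
  then show ?thesis by simp
qed

text \<open>\<open>v = tan \<theta> (x\<^sup>2 + y\<^sup>2) / 2 + w\<close> solves the equation of phase \<open>2\<theta>\<close> on the ball of radius \<open>r0\<close>, where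
  \<open>c = cos \<theta>\<close>, \<open>s = sin \<theta>\<close> and \<open>2\<theta> = \<Theta> + \<pi>/2\<close>. Its partial Legendre transform in the third variable
  has phase \<open>\<Theta>\<close>; \<open>\<rho>\<close> scales its domain to the unit ball.\<close>

locale slag_graph =
  fixes \<Theta> c s :: real and k :: nat
    and w w1 w2 w3 k11 k12 k13 k22 k23 k33 :: "real ^ 3 \<Rightarrow> real"
    and c0 r0 C :: real
  assumes Theta: "- (pi / 2) < \<Theta>" "\<Theta> < pi / 2"
    and cs: "c > 0" "s > 0" "c\<^sup>2 + s\<^sup>2 = 1" "cos \<Theta> = 2 * s * c" "sin \<Theta> = s\<^sup>2 - c\<^sup>2"
      "2 * arctan (s / c) = \<Theta> + pi / 2"
    and grad: "\<And>x. x \<in> ball 0 r0 \<Longrightarrow> has_grad w (w1 x) (w2 x) (w3 x) x"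
      "\<And>x. x \<in> ball 0 r0 \<Longrightarrow> has_grad w1 (k11 x) (k12 x) (k13 x) x"
      "\<And>x. x \<in> ball 0 r0 \<Longrightarrow> has_grad w2 (k12 x) (k22 x) (k23 x) x"
      "\<And>x. x \<in> ball 0 r0 \<Longrightarrow> has_grad w3 (k13 x) (k23 x) (k33 x) x"
    and pde: "\<And>x. x \<in> ball 0 r0 \<Longrightarrow> k33 x = NN c s (k11 x) (k12 x) (k13 x) (k22 x) (k23 x) (k33 x)"
    and smooth: "C_infinity_on (ball 0 r0) w"
    and small: "\<And>x. x \<in> ball 0 r0 \<Longrightarrow> \<bar>k11 x\<bar> \<le> min (1/4) (s / c / 4)"
      "\<And>x. x \<in> ball 0 r0 \<Longrightarrow> \<bar>k12 x\<bar> \<le> min (1/4) (s / c / 4)"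
      "\<And>x. x \<in> ball 0 r0 \<Longrightarrow> \<bar>k13 x\<bar> \<le> min (1/4) (s / c / 4)"
      "\<And>x. x \<in> ball 0 r0 \<Longrightarrow> \<bar>k22 x\<bar> \<le> min (1/4) (s / c / 4)"
      "\<And>x. x \<in> ball 0 r0 \<Longrightarrow> \<bar>k23 x\<bar> \<le> min (1/4) (s / c / 4)"
      "\<And>x. x \<in> ball 0 r0 \<Longrightarrow> \<bar>k33 x\<bar> \<le> min (1/4) (s / c / 4)"
    and c0: "c0 > 0" and r0: "r0 > 0" and C: "C > 0"
    and k33_lower: "\<And>x. x \<in> ball 0 r0 \<Longrightarrow> c0 * norm x ^ (2 * k + 2) \<le> k33 x"
    and w_order: "\<And>x. x \<in> ball 0 r0 \<Longrightarrow> \<bar>w x\<bar> \<le> C * norm x ^ 3"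
    and w3_order: "\<And>x. x \<in> ball 0 r0 \<Longrightarrow> \<bar>w3 x\<bar> \<le> C * norm x ^ 2"
    and w3_axis: "\<And>x. x \<in> ball 0 r0 \<Longrightarrow> x $ 1 = 0 \<Longrightarrow> x $ 2 = 0 \<Longrightarrow> \<bar>w3 x\<bar> \<le> C * norm x ^ (2 * k + 3)"
begin

abbreviation N :: nat where "N \<equiv> 2 * k + 3"

definition a :: real where "a = s / c"
definition r :: real where "r = r0 / 2"
text \<open>Integrating the lower bound of \<open>k33\<close> in the third variable gives
  \<open>c0 / real N\<close>; the factor \<open>2 ^ N\<close> comes from
  \<open>odd_power_diff_ge\<close>.\<close>

definition c1 :: real where "c1 = c0 / real N / 2 ^ N"
text \<open>The first entry keeps the points used below inside the ball, see
  \<open>box_in_ball\<close>. The second leaves room for the horizontal displacement in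
  \<open>w3_surj\<close>.\<close>

definition \<rho> :: real where "\<rho> = min (r0 / 4) (c1 * r ^ N / 4)"

lemma a_pos: "a > 0" using cs by (simp add: a_def)
lemma r_pos: "r > 0" using r0 by (simp add: r_def)
lemma c1_pos: "c1 > 0" using c0 by (simp add: c1_def)
lemma rho_pos: "\<rho> > 0" using c1_pos r_pos r0 by (simp add: \<rho>_def)

text \<open>The l1 bound \<open>r0 / 4 + r0 / 4 + r0 / 2\<close> just reaches \<open>r0\<close>. The
  disjunction for \<open>q\<close> makes the sum strictly smaller.\<close>

lemma box_in_ball:
  assumes "\<bar>p\<bar> \<le> \<rho>" "\<bar>q\<bar> < \<rho> \<or> q = 0" "\<bar>z\<bar> \<le> r"
  shows "vector [p, q, z] \<in> ball (0 :: real ^ 3) r0"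
proof -
  have "\<rho> \<le> r0 / 4" by (simp add: \<rho>_def)
  then show ?thesis using norm_vector_3_le[of p q z] assms r0 by (auto simp: r_def)
qed

lemma norm_ge_z: "\<bar>z\<bar> \<le> norm (vector [p, q, z] :: real ^ 3)"
  using component_le_norm_cart[of "vector [p, q, z] :: real ^ 3" 3] by simp

text \<open>By \<open>k33_lower\<close>, \<open>w3\<close> minus \<open>c0 / N * z^N\<close> is
  nondecreasing along vertical lines. Injectivity, surjectivity and the Hoelder exponent
  \<open>1 / N\<close> of the inverse all come from this inequality.\<close>

lemma w3_diff_ge:
  assumes pq: "\<bar>p\<bar> \<le> \<rho>" "\<bar>q\<bar> < \<rho> \<or> q = 0" and z: "- r \<le> z" "z \<le> z'" "z' \<le> r"
  shows "c1 * (z' - z) ^ N \<le> w3 (vector [p, q, z']) - w3 (vector [p, q, z])"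
proof -
  define g where "g z = w3 (vector [p, q, z]) - c0 / real N * z ^ N" for z
  have "g z \<le> g z'"
  proof (rule DERIV_nonneg_imp_nondecreasing[OF z(2)])
    fix t assume t: "z \<le> t" "t \<le> z'"
    have b: "vector [p, q, t] \<in> ball (0 :: real ^ 3) r0" using pq t z by (intro box_in_ball) auto
    have "(g has_real_derivative (k33 (vector [p, q, t]) - c0 / real N * (real N * t ^ (N - 1)))) (at t)"
      unfolding g_def
      by (rule derivative_eq_intros has_grad_DERIV_3[OF grad(4)[OF b]] refl)+ simp
    moreover have "c0 / real N * (real N * t ^ (N - 1)) = c0 * \<bar>t\<bar> ^ (2 * k + 2)"
    proof -
      have "t ^ (2 * k + 2) = \<bar>t\<bar> ^ (2 * k + 2)" by (metis even_add even_mult_iff even_numeral power_even_abs)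
      moreover have "N - 1 = 2 * k + 2" by simp
      ultimately show ?thesis by simp
    qed
    moreover have "c0 * \<bar>t\<bar> ^ (2 * k + 2) \<le> c0 * norm (vector [p, q, t] :: real ^ 3) ^ (2 * k + 2)"
      using c0 norm_ge_z by (intro mult_left_mono power_mono) auto
    ultimately show "\<exists>y. (g has_real_derivative y) (at t) \<and> 0 \<le> y"
      using k33_lower[OF b] by force
  qed
  then have "c0 / real N * (z' ^ N - z ^ N) \<le> w3 (vector [p, q, z']) - w3 (vector [p, q, z])"
    by (simp add: g_def right_diff_distrib)
  moreover have "c0 / real N * ((z' - z) / 2) ^ N \<le> c0 / real N * (z' ^ N - z ^ N)"
    using c0 z by (intro mult_left_mono odd_power_diff_ge) auto
  moreover have "c0 / real N * ((z' - z) / 2) ^ N = c1 * (z' - z) ^ N"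
    by (simp add: c1_def power_divide)
  ultimately show ?thesis by linarith
qed

lemma w_Lipschitz:
  assumes "x \<in> ball 0 r0" "y \<in> ball 0 r0"
  shows "\<bar>w1 x - w1 y\<bar> \<le> norm (x - y)" "\<bar>w2 x - w2 y\<bar> \<le> norm (x - y)" "\<bar>w3 x - w3 y\<bar> \<le> norm (x - y)"
  using small
  by (intro has_grad_Lipschitz[OF convex_ball assms grad(2)] has_grad_Lipschitz[OF convex_ball assms grad(3)]
      has_grad_Lipschitz[OF convex_ball assms grad(4)]; fastforce)+

lemma w3_zero: "w3 0 = 0" and w_zero: "w 0 = 0"
  using w3_order[of 0] w_order[of 0] r0 by auto

lemma w3_inj:
  assumes pq: "\<bar>p\<bar> \<le> \<rho>" "\<bar>q\<bar> < \<rho> \<or> q = 0" and z: "\<bar>z\<bar> \<le> r" "\<bar>z'\<bar> \<le> r"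
    and eq: "w3 (vector [p, q, z]) = w3 (vector [p, q, z'])"
  shows "z = z'"
proof -
  have *: "z' \<le> z" if z: "\<bar>z\<bar> \<le> r" "\<bar>z'\<bar> \<le> r" and eq: "w3 (vector [p, q, z]) = w3 (vector [p, q, z'])" for z z'
  proof (rule ccontr)
    assume "\<not> z' \<le> z"
    then have "c1 * (z' - z) ^ N > 0" "z \<le> z'" using c1_pos by simp_all
    then show False using w3_diff_ge[OF pq, of z z'] z eq by (auto simp: abs_le_iff)
  qed
  show ?thesis using *[OF z eq] *[OF z(2,1) eq[symmetric]] by simp
qed

lemma w3_surj:
  assumes pq: "\<bar>p\<bar> \<le> \<rho>" "\<bar>q\<bar> < \<rho> \<or> q = 0" and y: "\<bar>y\<bar> \<le> \<rho>"
  shows "\<exists>z. \<bar>z\<bar> \<le> r \<and> w3 (vector [p, q, z]) = y"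
proof -
  have q: "\<bar>q\<bar> \<le> \<rho>" using pq rho_pos by auto
  \<comment> \<open>Above the origin \<open>w3\<close> is at least \<open>4 * \<rho>\<close> at
    height \<open>r\<close> and at most \<open>- 4 * \<rho>\<close> at height \<open>- r\<close>. A
    horizontal displacement changes this by at most \<open>2 * \<rho>\<close>, so the values still
    cover the interval from \<open>- \<rho>\<close> to \<open>\<rho>\<close>.\<close>
  have "4 * \<rho> \<le> c1 * r ^ N" by (simp add: \<rho>_def)
  moreover have "c1 * r ^ N \<le> w3 (vector [0, 0, r])"
    using w3_diff_ge[of 0 0 0 r] rho_pos r_pos w3_zero vector_3_eta[of "0 :: real ^ 3"] by simp
  moreover have "w3 (vector [0, 0, - r]) \<le> - (c1 * r ^ N)"
    using w3_diff_ge[of 0 0 "- r" 0] rho_pos r_pos w3_zero vector_3_eta[of "0 :: real ^ 3"] by simp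
  moreover have "\<bar>w3 (vector [p, q, z]) - w3 (vector [0, 0, z])\<bar> \<le> 2 * \<rho>" if "\<bar>z\<bar> \<le> r" for z
  proof -
    have "vector [p, q, z] - vector [0, 0, z] = (vector [p, q, 0] :: real ^ 3)"
      by (simp add: vec_eq_iff forall_3)
    then have "norm (vector [p, q, z] - vector [0, 0, z] :: real ^ 3) \<le> 2 * \<rho>"
      using norm_vector_3_le[of p q 0] pq(1) q by simp
    then show ?thesis
      using w_Lipschitz(3)[OF box_in_ball[OF pq that] box_in_ball[of 0 0 z]] that rho_pos by simp
  qed
  from this[of r] this[of "- r"] r_pos calculation
  have "w3 (vector [p, q, - r]) \<le> y" "y \<le> w3 (vector [p, q, r])" using y rho_pos by (auto simp: abs_le_iff)
  moreover have "isCont (\<lambda>z. w3 (vector [p, q, z])) z" if "- r \<le> z \<and> z \<le> r" for z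
    by (rule DERIV_isCont[OF has_grad_DERIV_3[OF grad(4)[OF box_in_ball[OF pq]]]]) (use that in auto)
  ultimately obtain z where "- r \<le> z" "z \<le> r" "w3 (vector [p, q, z]) = y"
    using IVT[of "\<lambda>z. w3 (vector [p, q, z])" "- r" y r] r_pos by auto
  then show ?thesis by (intro exI[of _ z]) auto
qed

text \<open>The third component of the inverse of
  \<open>x \<mapsto> (x $ 1, x $ 2, w3 x) / \<rho>\<close>. Here \<open>w3\<close> is also the third
  partial derivative of \<open>v\<close>, whose quadratic part does not involve z.\<close>

definition h :: "real ^ 3 \<Rightarrow> real" where
  "h X = (THE z. \<bar>z\<bar> \<le> r \<and> w3 (vector [\<rho> * X $ 1, \<rho> * X $ 2, z]) = \<rho> * X $ 3)"

definition \<Psi> :: "real ^ 3 \<Rightarrow> real ^ 3" where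
  "\<Psi> X = vector [\<rho> * X $ 1, \<rho> * X $ 2, h X]"

abbreviation B :: "(real ^ 3) set" where "B \<equiv> ball 0 1"

lemma component_less:
  assumes "X \<in> B"
  shows "\<bar>\<rho> * X $ i\<bar> < \<rho>"
proof -
  have "\<bar>X $ i\<bar> < 1" using component_le_norm_cart[of X i] assms by simp
  then show ?thesis using rho_pos by (simp add: abs_mult)
qed

lemma h_works:
  assumes X: "X \<in> B"
  shows "\<bar>h X\<bar> \<le> r" "w3 (\<Psi> X) = \<rho> * X $ 3"
proof -
  have p: "\<bar>\<rho> * X $ 1\<bar> \<le> \<rho>" "\<bar>\<rho> * X $ 2\<bar> < \<rho> \<or> \<rho> * X $ 2 = 0" and y: "\<bar>\<rho> * X $ 3\<bar> \<le> \<rho>"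
    using component_less[OF X] by (auto intro: less_imp_le)
  have "\<exists>!z. \<bar>z\<bar> \<le> r \<and> w3 (vector [\<rho> * X $ 1, \<rho> * X $ 2, z]) = \<rho> * X $ 3"
    using w3_surj[OF p y] w3_inj[OF p] by metis
  from theI'[OF this] show "\<bar>h X\<bar> \<le> r" "w3 (\<Psi> X) = \<rho> * X $ 3"
    by (simp_all add: h_def \<Psi>_def)
qed

lemma h_unique:
  assumes X: "X \<in> B" and z: "\<bar>z\<bar> \<le> r" "w3 (vector [\<rho> * X $ 1, \<rho> * X $ 2, z]) = \<rho> * X $ 3"
  shows "h X = z"
proof (rule w3_inj)
  show "w3 (vector [\<rho> * X $ 1, \<rho> * X $ 2, h X]) = w3 (vector [\<rho> * X $ 1, \<rho> * X $ 2, z])"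
    using h_works(2)[OF X] z by (simp add: \<Psi>_def)
qed (use component_less[OF X] h_works[OF X] z in \<open>auto intro: less_imp_le\<close>)

lemma Psi_in_ball: "X \<in> B \<Longrightarrow> \<Psi> X \<in> ball 0 r0"
  unfolding \<Psi>_def using component_less[of X] h_works[of X] by (intro box_in_ball) (auto intro: less_imp_le)

lemma h_zero: "h 0 = 0"
  using w3_zero vector_3_eta[of "0 :: real ^ 3"] r_pos by (intro h_unique) auto

lemma Psi_nonzero:
  assumes "X \<in> B" "X \<noteq> 0"
  shows "\<Psi> X \<noteq> 0"
proof
  assume 0: "\<Psi> X = 0"
  then have "\<rho> * X $ 1 = 0" "\<rho> * X $ 2 = 0" by (auto simp: \<Psi>_def vec_eq_iff forall_3)
  moreover have "\<rho> * X $ 3 = 0" using h_works(2)[OF assms(1)] 0 w3_zero by simp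
  ultimately show False using assms(2) rho_pos by (simp add: vec_eq_iff forall_3)
qed

text \<open>The point \<open>?Z\<close> above the horizontal position of \<open>X\<close>, at the
  height of \<open>Y\<close>, splits the comparison into a vertical step, bounded below by
  \<open>w3_diff_ge\<close>, and a horizontal step, bounded above by the Lipschitz estimate for
  \<open>w3\<close>.\<close>

lemma h_Hoelder:
  assumes X: "X \<in> B" and Y: "Y \<in> B"
  shows "c1 * \<bar>h X - h Y\<bar> ^ N \<le> 3 * \<rho> * norm (X - Y)"
proof -
  have *: "c1 * (h X - h Y) ^ N \<le> 3 * \<rho> * norm (X - Y)" if X: "X \<in> B" and Y: "Y \<in> B" and le: "h Y \<le> h X" for X Y
  proof -
    let ?Z = "vector [\<rho> * X $ 1, \<rho> * X $ 2, h Y] :: real ^ 3"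
    have comp: "\<bar>X $ i - Y $ i\<bar> \<le> norm (X - Y)" for i
      using component_le_norm_cart[of "X - Y" i] by simp
    have p: "\<bar>\<rho> * X $ 1\<bar> \<le> \<rho>" "\<bar>\<rho> * X $ 2\<bar> < \<rho> \<or> \<rho> * X $ 2 = 0"
      using component_less[OF X] by (auto intro: less_imp_le)
    have Z: "?Z \<in> ball 0 r0" using p h_works(1)[OF Y] by (rule box_in_ball)
    have "c1 * (h X - h Y) ^ N \<le> w3 (\<Psi> X) - w3 ?Z"
      unfolding \<Psi>_def using h_works(1)[OF X] h_works(1)[OF Y] le by (intro w3_diff_ge p) auto
    also have "\<dots> = \<rho> * (X $ 3 - Y $ 3) + (w3 (\<Psi> Y) - w3 ?Z)"
      by (simp add: h_works(2)[OF X] h_works(2)[OF Y] algebra_simps)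
    also have "\<rho> * (X $ 3 - Y $ 3) \<le> \<rho> * norm (X - Y)"
      using comp[of 3] rho_pos by (intro mult_left_mono) auto
    also have "w3 (\<Psi> Y) - w3 ?Z \<le> norm (\<Psi> Y - ?Z)"
      using w_Lipschitz(3)[OF Psi_in_ball[OF Y] Z] by simp
    also have "\<Psi> Y - ?Z = vector [\<rho> * (Y $ 1 - X $ 1), \<rho> * (Y $ 2 - X $ 2), 0]"
      by (simp add: \<Psi>_def vec_eq_iff forall_3 algebra_simps)
    also have "norm (vector [\<rho> * (Y $ 1 - X $ 1), \<rho> * (Y $ 2 - X $ 2), 0] :: real ^ 3)
        \<le> \<rho> * \<bar>Y $ 1 - X $ 1\<bar> + \<rho> * \<bar>Y $ 2 - X $ 2\<bar>"
      using norm_vector_3_le[of "\<rho> * (Y $ 1 - X $ 1)" "\<rho> * (Y $ 2 - X $ 2)" 0] rho_pos by (simp add: abs_mult)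
    also have "\<dots> \<le> \<rho> * norm (X - Y) + \<rho> * norm (X - Y)"
      using comp[of 1] comp[of 2] rho_pos by (intro add_mono mult_left_mono) (auto simp: abs_minus_commute)
    finally show ?thesis by (simp add: mult_ac)
  qed
  show ?thesis
    using *[OF X Y] *[OF Y X] by (cases "h Y \<le> h X") (auto simp: norm_minus_commute abs_if)
qed

definition L :: real where "L = (3 * \<rho> / c1) powr (1 / real N)"

lemma h_Hoelder_powr:
  assumes X: "X \<in> B" and Y: "Y \<in> B"
  shows "\<bar>h X - h Y\<bar> \<le> L * norm (X - Y) powr (1 / real N)"
proof -
  have "\<bar>h X - h Y\<bar> ^ N \<le> 3 * \<rho> / c1 * norm (X - Y)"
    using h_Hoelder[OF assms] c1_pos by (simp add: field_simps)
  then have "(\<bar>h X - h Y\<bar> ^ N) powr (1 / real N) \<le> (3 * \<rho> / c1 * norm (X - Y)) powr (1 / real N)"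
    by (intro powr_mono2) auto
  also have "\<dots> = L * norm (X - Y) powr (1 / real N)"
    unfolding L_def by (rule powr_mult)
  also have "(\<bar>h X - h Y\<bar> ^ N) powr (1 / real N) = \<bar>h X - h Y\<bar>"
    by (cases "h X = h Y") (auto simp: powr_powr simp flip: powr_realpow)
  finally show ?thesis .
qed

end

lemma vector_3_axis: "vector [p, q, z] = p *\<^sub>R axis 1 1 + q *\<^sub>R axis 2 1 + z *\<^sub>R (axis 3 1 :: real ^ 3)"
  by (simp add: vec_eq_iff forall_3 axis_def)

text \<open>The mean value theorem on the segment from 0 to \<open>y\<close> evaluates the gradient
  at an interior point, which differs from 0; continuity of \<open>g\<close> at 0 then gives the
  derivative there.\<close>

lemma GDERIV_removable:
  assumes "open S" "convex S" "0 \<in> S" and cont: "continuous_on S f"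
    and g: "\<And>x. x \<in> S \<Longrightarrow> x \<noteq> 0 \<Longrightarrow> GDERIV f x :> g x"
    and gc: "continuous_on S g"
  shows "GDERIV f 0 :> g 0"
  unfolding gderiv_def has_derivative_at_alt
proof (intro conjI allI impI)
  show "bounded_linear (\<lambda>h. h \<bullet> g 0)" by (rule bounded_linear_inner_left)
  fix e :: real assume e: "e > 0"
  have "isCont g 0" using gc assms(1,3) continuous_on_eq_continuous_at by blast
  then obtain d1 where d1: "d1 > 0" "\<And>y. dist y 0 < d1 \<Longrightarrow> dist (g y) (g 0) < e"
    using e unfolding continuous_at_eps_delta by blast
  obtain d2 where d2: "d2 > 0" "ball 0 d2 \<subseteq> S" using assms(1,3) open_contains_ball by blast
  have "norm (f y - f 0 - (y - 0) \<bullet> g 0) \<le> e * norm (y - 0)" if y: "norm (y - 0) < min d1 d2" for y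
  proof (cases "y = 0")
    case False
    have yS: "y \<in> S" using y d2 by auto
    have seg: "t *\<^sub>R y \<in> S" if "0 \<le> t" "t \<le> 1" for t
      using convexD_alt[OF assms(2,3) yS that] by simp
    have cont': "continuous_on {0..1} (\<lambda>t. f (t *\<^sub>R y))"
      by (rule continuous_on_compose2[OF cont]) (use seg in \<open>auto intro!: continuous_intros\<close>)
    have der: "((\<lambda>t. f (t *\<^sub>R y)) has_derivative (\<lambda>h. (h *\<^sub>R y) \<bullet> g (t *\<^sub>R y))) (at t)"
      if t: "0 < t" "t < 1" for t
    proof -
      have 1: "((\<lambda>t. t *\<^sub>R y) has_derivative (\<lambda>h. h *\<^sub>R y)) (at t)" by (auto intro!: derivative_eq_intros)
      have 2: "(f has_derivative (\<lambda>h. h \<bullet> g (t *\<^sub>R y))) (at (t *\<^sub>R y))"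
        using g[of "t *\<^sub>R y"] seg[of t] t False by (simp add: gderiv_def)
      show ?thesis using diff_chain_at[OF 1 2] by (simp add: comp_def)
    qed
    obtain t where t: "0 < t" "t < 1" "f y - f 0 = y \<bullet> g (t *\<^sub>R y)"
      using mvt[OF zero_less_one cont' der] by auto
    have "f y - f 0 - (y - 0) \<bullet> g 0 = y \<bullet> (g (t *\<^sub>R y) - g 0)" using t by (simp add: inner_diff_right)
    also have "norm \<dots> \<le> norm y * norm (g (t *\<^sub>R y) - g 0)" by (rule Cauchy_Schwarz_ineq2[folded real_norm_def])
    also have "\<dots> \<le> norm y * e"
    proof (rule mult_left_mono)
      have "t * norm y \<le> norm y" using t by (intro mult_left_le_one_le) auto
      then have "dist (t *\<^sub>R y) 0 < d1" using y t by simp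
      then show "norm (g (t *\<^sub>R y) - g 0) \<le> e" using d1(2)[of "t *\<^sub>R y"] by (simp add: dist_norm)
    qed simp
    finally show ?thesis by (simp add: mult.commute)
  qed simp
  then show "\<exists>d>0. \<forall>y. norm (y - 0) < d \<longrightarrow> norm (f y - f 0 - (y - 0) \<bullet> g 0) \<le> e * norm (y - 0)"
    using d1 d2 by (intro exI[of _ "min d1 d2"]) auto
qed

section \<open>Regularity of the inverse coordinate map\<close>

context slag_graph
begin

lemma k33_pos: "x \<in> ball 0 r0 \<Longrightarrow> x \<noteq> 0 \<Longrightarrow> k33 x > 0"
  using k33_lower[of x] c0 by (smt (verit) mult_pos_pos zero_less_norm_iff zero_less_power)

lemma h_continuous: "continuous_on B h"
  unfolding continuous_on_iff
proof (intro ballI allI impI)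
  fix X :: "real ^ 3" and e :: real assume X: "X \<in> B" and e: "e > 0"
  define d where "d = c1 * e ^ N / (3 * \<rho>)"
  have "dist (h Y) (h X) < e" if "Y \<in> B" "dist Y X < d" for Y
  proof -
    have "3 * \<rho> * norm (Y - X) < 3 * \<rho> * d" using that rho_pos by (simp add: dist_norm)
    also have "3 * \<rho> * d = c1 * e ^ N" using rho_pos by (simp add: d_def)
    finally have "c1 * \<bar>h Y - h X\<bar> ^ N < c1 * e ^ N" using h_Hoelder[OF that(1) X] by linarith
    then have "\<bar>h Y - h X\<bar> ^ N < e ^ N" using c1_pos by simp
    then show ?thesis using e by (auto simp: dist_real_def intro: power_less_imp_less_base)
  qed
  moreover have "d > 0" using c1_pos rho_pos e by (simp add: d_def)
  ultimately show "\<exists>d>0. \<forall>Y\<in>B. dist Y X < d \<longrightarrow> dist (h Y) (h X) < e" by blast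
qed

lemma Psi_continuous: "continuous_on B \<Psi>"
  unfolding \<Psi>_def[abs_def] vector_3_axis by (intro continuous_intros h_continuous)

lemma compose_continuous: "continuous_on (ball 0 r0) F \<Longrightarrow> continuous_on B (\<lambda>X. F (\<Psi> X))"
  by (rule continuous_on_compose2[OF _ Psi_continuous]) (use Psi_in_ball in auto)

text \<open>The derivative of the forward map is triangular with last diagonal entry
  \<open>k33 / \<rho>\<close>, positive away from the origin. Its explicit inverse, together with
  the continuity of \<open>\<Psi>\<close>, gives the derivative of the inverse map.\<close>

lemma Psi_has_derivative:
  assumes X: "X \<in> B" "X \<noteq> 0"
  shows "(\<Psi> has_derivative (\<lambda>H. vector [\<rho> * H $ 1, \<rho> * H $ 2,
    (\<rho> * H $ 3 - k13 (\<Psi> X) * (\<rho> * H $ 1) - k23 (\<Psi> X) * (\<rho> * H $ 2)) / k33 (\<Psi> X)])) (at X)"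
proof (rule has_derivative_inverse_basic)
  let ?x = "\<Psi> X"
  have x: "?x \<in> ball 0 r0" "?x \<noteq> 0" using Psi_in_ball Psi_nonzero X by auto
  have k: "k33 ?x > 0" using k33_pos[OF x] .
  have comp: "((\<lambda>x. x $ i) has_derivative (\<lambda>h. h $ i)) (at ?x)" for i :: 3
    by (rule bounded_linear.has_derivative[OF bounded_linear_vec_nth has_derivative_ident])
  have w: "(w3 has_derivative (\<lambda>h. h \<bullet> vector [k13 ?x, k23 ?x, k33 ?x])) (at ?x)"
    using grad(4)[OF x(1)] by (simp add: has_grad_def gderiv_def)
  show "((\<lambda>x. (inverse \<rho> * x $ 1) *\<^sub>R axis 1 1 + (inverse \<rho> * x $ 2) *\<^sub>R axis 2 1 + (inverse \<rho> * w3 x) *\<^sub>R (axis 3 1 :: real ^ 3))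
     has_derivative (\<lambda>h. (inverse \<rho> * h $ 1) *\<^sub>R axis 1 1 + (inverse \<rho> * h $ 2) *\<^sub>R axis 2 1 +
       (inverse \<rho> * (h \<bullet> vector [k13 ?x, k23 ?x, k33 ?x])) *\<^sub>R axis 3 1)) (at ?x)"
    by (intro has_derivative_add has_derivative_scaleR_left has_derivative_mult_right comp w)
  show "bounded_linear (\<lambda>H. vector [\<rho> * H $ 1, \<rho> * H $ 2,
    (\<rho> * H $ 3 - k13 ?x * (\<rho> * H $ 1) - k23 ?x * (\<rho> * H $ 2)) / k33 ?x] :: real ^ 3)"
    unfolding linear_conv_bounded_linear[symmetric]
    by (rule linearI) (use k in \<open>simp_all add: vec_eq_iff forall_3 field_simps\<close>)
  show "(\<lambda>H. vector [\<rho> * H $ 1, \<rho> * H $ 2,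
    (\<rho> * H $ 3 - k13 ?x * (\<rho> * H $ 1) - k23 ?x * (\<rho> * H $ 2)) / k33 ?x]) \<circ>
    (\<lambda>h. (inverse \<rho> * h $ 1) *\<^sub>R axis 1 1 + (inverse \<rho> * h $ 2) *\<^sub>R axis 2 1 +
       (inverse \<rho> * (h \<bullet> vector [k13 ?x, k23 ?x, k33 ?x])) *\<^sub>R (axis 3 1 :: real ^ 3)) = (id :: real ^ 3 \<Rightarrow> real ^ 3)"
    (is "?g \<circ> ?f = id")
  proof
    fix h :: "real ^ 3"
    have "?f h $ 1 = inverse \<rho> * h $ 1" "?f h $ 2 = inverse \<rho> * h $ 2"
      "?f h $ 3 = inverse \<rho> * (h $ 1 * k13 ?x + h $ 2 * k23 ?x + h $ 3 * k33 ?x)"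
      by (simp_all add: axis_def inner_vec_def sum_3)
    then have "?g (?f h) = vector [\<rho> * (inverse \<rho> * h $ 1), \<rho> * (inverse \<rho> * h $ 2),
      (\<rho> * (inverse \<rho> * (h $ 1 * k13 ?x + h $ 2 * k23 ?x + h $ 3 * k33 ?x)) - k13 ?x * (\<rho> * (inverse \<rho> * h $ 1))
        - k23 ?x * (\<rho> * (inverse \<rho> * h $ 2))) / k33 ?x]" by (simp only:)
    also have "\<dots> = h" using k rho_pos by (simp add: vec_eq_iff forall_3 field_simps)
    finally show "(?g \<circ> ?f) h = id h" by simp
  qed
  show "isCont \<Psi> X" using Psi_continuous X continuous_on_eq_continuous_at open_ball by blast
  show "open B" by simp
  show "X \<in> B" by fact
  show "(inverse \<rho> * \<Psi> z $ 1) *\<^sub>R axis 1 1 + (inverse \<rho> * \<Psi> z $ 2) *\<^sub>R axis 2 1 + (inverse \<rho> * w3 (\<Psi> z)) *\<^sub>R axis 3 1 = z" if "z \<in> B" for z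
    using h_works(2)[OF that] rho_pos by (simp add: vec_eq_iff forall_3 axis_def \<Psi>_def)
qed

lemma has_grad_compose:
  assumes X: "X \<in> B" "X \<noteq> 0" and F: "has_grad F \<alpha> \<beta> \<gamma> (\<Psi> X)"
  shows "has_grad (\<lambda>X. F (\<Psi> X)) (\<rho> * (\<alpha> - \<gamma> * k13 (\<Psi> X) / k33 (\<Psi> X)))
    (\<rho> * (\<beta> - \<gamma> * k23 (\<Psi> X) / k33 (\<Psi> X))) (\<rho> * \<gamma> / k33 (\<Psi> X)) X"
proof -
  have k: "k33 (\<Psi> X) > 0" using k33_pos[OF Psi_in_ball Psi_nonzero] X by auto
  have "(F has_derivative (\<lambda>h. h \<bullet> vector [\<alpha>, \<beta>, \<gamma>])) (at (\<Psi> X))"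
    using F by (simp add: has_grad_def gderiv_def)
  from diff_chain_at[OF Psi_has_derivative[OF X] this, unfolded comp_def] show ?thesis
    unfolding has_grad_def gderiv_def
    by (rule has_derivative_eq_rhs)
      (use k in \<open>simp add: fun_eq_iff comp_def inner_vec_def sum_3 field_simps\<close>)
qed

lemma has_grad_h:
  assumes X: "X \<in> B" "X \<noteq> 0"
  shows "has_grad h (\<rho> * (- k13 (\<Psi> X) / k33 (\<Psi> X))) (\<rho> * (- k23 (\<Psi> X) / k33 (\<Psi> X))) (\<rho> / k33 (\<Psi> X)) X"
  using has_grad_compose[OF X has_grad_component(3)] by (simp add: \<Psi>_def)

section \<open>The transformed function and its regularity\<close>

definition v :: "real ^ 3 \<Rightarrow> real" where "v x = a / 2 * ((x $ 1)\<^sup>2 + (x $ 2)\<^sup>2) + w x"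
definition v1 :: "real ^ 3 \<Rightarrow> real" where "v1 x = a * x $ 1 + w1 x"
definition v2 :: "real ^ 3 \<Rightarrow> real" where "v2 x = a * x $ 2 + w2 x"

lemma has_grad_v:
  assumes "x \<in> ball 0 r0"
  shows "has_grad v (v1 x) (v2 x) (w3 x) x" "has_grad v1 (a + k11 x) (k12 x) (k13 x) x"
    "has_grad v2 (k12 x) (a + k22 x) (k23 x) x"
proof -
  note I = has_grad_add has_grad_cmult has_grad_component has_grad_power
  show "has_grad v (v1 x) (v2 x) (w3 x) x"
    unfolding v_def[abs_def] v1_def v2_def
    by (rule has_grad_eqI, (rule I grad[OF assms])+) simp_all
  show "has_grad v1 (a + k11 x) (k12 x) (k13 x) x"
    unfolding v1_def[abs_def]
    by (rule has_grad_eqI, (rule I grad[OF assms])+) simp_all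
  show "has_grad v2 (k12 x) (a + k22 x) (k23 x) x"
    unfolding v2_def[abs_def]
    by (rule has_grad_eqI, (rule I grad[OF assms])+) simp_all
qed

text \<open>Division by \<open>\<rho>\<^sup>2\<close> compensates the dilation by
  \<open>\<rho>\<close>, so that the second derivatives are those of the undilated
  transform.\<close>

definition u :: "real ^ 3 \<Rightarrow> real" where "u X = (v (\<Psi> X) - \<rho> * X $ 3 * h X) / \<rho>\<^sup>2"

definition G :: "real ^ 3 \<Rightarrow> real ^ 3" where
  "G X = vector [v1 (\<Psi> X) / \<rho>, v2 (\<Psi> X) / \<rho>, - h X / \<rho>]"

lemma v_continuous: "continuous_on (ball 0 r0) v" "continuous_on (ball 0 r0) v1" "continuous_on (ball 0 r0) v2"
  using has_grad_v[THEN has_grad_continuous] by (auto intro: continuous_at_imp_continuous_on)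

lemma u_continuous: "continuous_on B u"
  unfolding u_def[abs_def] using rho_pos
  by (intro continuous_intros compose_continuous v_continuous h_continuous) auto

lemma G_continuous: "continuous_on B G"
  unfolding G_def[abs_def] vector_3_axis using rho_pos
  by (intro continuous_intros compose_continuous v_continuous h_continuous) auto

text \<open>As in every Legendre transform, the terms with derivatives of \<open>h\<close> cancel,
  because \<open>w3 (\<Psi> X) = \<rho> * X $ 3\<close>. What remains involves only
  \<open>v1\<close>, \<open>v2\<close> and \<open>h\<close> and is continuous up to the
  origin.\<close>

lemma GDERIV_u_nonzero:
  assumes X: "X \<in> B" "X \<noteq> 0"
  shows "GDERIV u X :> G X"
proof -
  have k: "k33 (\<Psi> X) > 0" using k33_pos[OF Psi_in_ball Psi_nonzero] X by auto
  have "has_grad (\<lambda>X. (1 / \<rho>\<^sup>2) * (v (\<Psi> X) - (\<rho> * X $ 3) * h X)) (v1 (\<Psi> X) / \<rho>) (v2 (\<Psi> X) / \<rho>) (- h X / \<rho>) X"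
    by (rule has_grad_eqI, (rule has_grad_cmult has_grad_diff has_grad_mult has_grad_component
          has_grad_compose[OF X has_grad_v(1)[OF Psi_in_ball[OF X(1)]]] has_grad_h[OF X])+)
      (use k rho_pos in \<open>simp_all add: h_works(2)[OF X(1)] field_simps power2_eq_square\<close>)
  then show ?thesis by (simp add: has_grad_def u_def[abs_def] G_def)
qed

lemma GDERIV_u:
  assumes "X \<in> B"
  shows "GDERIV u X :> G X"
proof (cases "X = 0")
  case True
  show ?thesis unfolding True
    by (rule GDERIV_removable[OF open_ball convex_ball _ u_continuous GDERIV_u_nonzero G_continuous]) auto
qed (use GDERIV_u_nonzero assms in blast)

lemma G_Hoelder:
  assumes X: "X \<in> B" and Y: "Y \<in> B"
  shows "norm (G X - G Y) \<le> (2 * ((a + 1) * (4 * \<rho> + L)) + L) / \<rho> * norm (X - Y) powr (1 / real N)"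
proof -
  define D where "D = norm (X - Y) powr (1 / real N)"
  have hD: "\<bar>h X - h Y\<bar> \<le> L * D" unfolding D_def by (rule h_Hoelder_powr[OF X Y])
  have D0: "D \<ge> 0" by (simp add: D_def)
  have L0: "L \<ge> 0" by (simp add: L_def)
  \<comment> \<open>Distances in the unit ball are at most 2, so Lipschitz terms are dominated by
    the Hoelder modulus \<open>D\<close>.\<close>
  have XY: "norm (X - Y) \<le> 2 * D"
  proof (cases "X = Y")
    case False
    then have p: "norm (X - Y) > 0" by simp
    have "norm (X - Y) \<le> 2" using norm_triangle_ineq4[of X Y] X Y by simp
    have "norm (X - Y) = norm (X - Y) powr (1 / real N) * norm (X - Y) powr (1 - 1 / real N)"
      using p by (simp flip: powr_add)
    also have "\<dots> \<le> D * 2 powr (1 - 1 / real N)"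
      unfolding D_def using \<open>norm (X - Y) \<le> 2\<close> by (intro mult_left_mono powr_mono2) auto
    also have "\<dots> \<le> D * 2 powr 1" using D0 by (intro mult_left_mono powr_mono) auto
    finally show ?thesis by simp
  qed (simp add: D0)
  have comp: "\<bar>X $ i - Y $ i\<bar> \<le> 2 * D" for i
    using component_le_norm_cart[of "X - Y" i] XY by simp
  have "\<Psi> X - \<Psi> Y = vector [\<rho> * (X $ 1 - Y $ 1), \<rho> * (X $ 2 - Y $ 2), h X - h Y]"
    by (simp add: \<Psi>_def vec_eq_iff forall_3 algebra_simps)
  then have "norm (\<Psi> X - \<Psi> Y) \<le> \<rho> * \<bar>X $ 1 - Y $ 1\<bar> + \<rho> * \<bar>X $ 2 - Y $ 2\<bar> + \<bar>h X - h Y\<bar>"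
    using norm_vector_3_le[of "\<rho> * (X $ 1 - Y $ 1)" "\<rho> * (X $ 2 - Y $ 2)" "h X - h Y"] rho_pos
    by (simp add: abs_mult)
  also have "\<dots> \<le> \<rho> * (2 * D) + \<rho> * (2 * D) + L * D"
    using comp rho_pos hD by (intro add_mono mult_left_mono) auto
  finally have P: "norm (\<Psi> X - \<Psi> Y) \<le> (4 * \<rho> + L) * D" by (simp add: algebra_simps)
  have vL: "\<bar>v1 (\<Psi> X) - v1 (\<Psi> Y)\<bar> \<le> (a + 1) * ((4 * \<rho> + L) * D)"
    "\<bar>v2 (\<Psi> X) - v2 (\<Psi> Y)\<bar> \<le> (a + 1) * ((4 * \<rho> + L) * D)"
  proof -
    have ai: "\<bar>a * \<Psi> X $ i - a * \<Psi> Y $ i\<bar> \<le> a * ((4 * \<rho> + L) * D)" for i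
    proof -
      have "\<bar>a * \<Psi> X $ i - a * \<Psi> Y $ i\<bar> = a * \<bar>(\<Psi> X - \<Psi> Y) $ i\<bar>"
        using a_pos by (simp add: abs_mult flip: right_diff_distrib)
      also have "\<dots> \<le> a * ((4 * \<rho> + L) * D)"
        using a_pos order_trans[OF component_le_norm_cart P] by (intro mult_left_mono) auto
      finally show ?thesis .
    qed
    have "\<bar>v1 (\<Psi> X) - v1 (\<Psi> Y)\<bar> \<le> \<bar>a * \<Psi> X $ 1 - a * \<Psi> Y $ 1\<bar> + \<bar>w1 (\<Psi> X) - w1 (\<Psi> Y)\<bar>"
      "\<bar>v2 (\<Psi> X) - v2 (\<Psi> Y)\<bar> \<le> \<bar>a * \<Psi> X $ 2 - a * \<Psi> Y $ 2\<bar> + \<bar>w2 (\<Psi> X) - w2 (\<Psi> Y)\<bar>"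
      unfolding v1_def v2_def by linarith+
    moreover have "\<bar>w1 (\<Psi> X) - w1 (\<Psi> Y)\<bar> \<le> (4 * \<rho> + L) * D" "\<bar>w2 (\<Psi> X) - w2 (\<Psi> Y)\<bar> \<le> (4 * \<rho> + L) * D"
      using w_Lipschitz(1,2)[OF Psi_in_ball[OF X] Psi_in_ball[OF Y]] P by (auto intro: order_trans)
    moreover have "(a + 1) * ((4 * \<rho> + L) * D) = a * ((4 * \<rho> + L) * D) + (4 * \<rho> + L) * D"
      by (simp add: algebra_simps)
    ultimately show "\<bar>v1 (\<Psi> X) - v1 (\<Psi> Y)\<bar> \<le> (a + 1) * ((4 * \<rho> + L) * D)"
      "\<bar>v2 (\<Psi> X) - v2 (\<Psi> Y)\<bar> \<le> (a + 1) * ((4 * \<rho> + L) * D)"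
      using ai[of 1] ai[of 2] by simp_all
  qed
  have "G X - G Y = vector [(v1 (\<Psi> X) - v1 (\<Psi> Y)) / \<rho>, (v2 (\<Psi> X) - v2 (\<Psi> Y)) / \<rho>, (h Y - h X) / \<rho>]"
    by (simp add: G_def vec_eq_iff forall_3 diff_divide_distrib)
  then have "norm (G X - G Y) \<le> (\<bar>v1 (\<Psi> X) - v1 (\<Psi> Y)\<bar> + \<bar>v2 (\<Psi> X) - v2 (\<Psi> Y)\<bar> + \<bar>h X - h Y\<bar>) / \<rho>"
    using norm_vector_3_le[of "(v1 (\<Psi> X) - v1 (\<Psi> Y)) / \<rho>" "(v2 (\<Psi> X) - v2 (\<Psi> Y)) / \<rho>" "(h Y - h X) / \<rho>"] rho_pos
    by (simp add: add_divide_distrib abs_minus_commute)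
  also have "\<dots> \<le> ((a + 1) * ((4 * \<rho> + L) * D) + (a + 1) * ((4 * \<rho> + L) * D) + L * D) / \<rho>"
    using vL hD rho_pos by (intro divide_right_mono add_mono) auto
  also have "\<dots> = (2 * ((a + 1) * (4 * \<rho> + L)) + L) / \<rho> * D" by (simp add: algebra_simps)
  finally show ?thesis by (simp add: D_def)
qed

lemma C1_Hoelder_u: "C1_Hoelder_on (1 / real N) B u"
  unfolding C1_Hoelder_on_def using GDERIV_u G_continuous G_Hoelder by blast

abbreviation B0 :: "(real ^ 3) set" where "B0 \<equiv> ball 0 r0 - {0}"

lemma open_punctured: "open (ball x e - {y :: real ^ 3})"
  by (intro open_Diff) auto

lemma smooth_grad:
  assumes f: "C_infinity_on (ball 0 r0) f" and g: "\<And>x. x \<in> ball 0 r0 \<Longrightarrow> has_grad f (f1 x) (f2 x) (f3 x) x"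
  shows "C_infinity_on (ball 0 r0) f1" "C_infinity_on (ball 0 r0) f2" "C_infinity_on (ball 0 r0) f3"
proof -
  have pd: "partial_deriv i f x = vector [f1 x, f2 x, f3 x] $ i" if "x \<in> ball 0 r0" for i x
    using g[OF that] unfolding has_grad_def by (rule partial_deriv_GDERIV)
  have ci: "C_infinity_on (ball 0 r0) (partial_deriv i f)" for i
    by (rule C_infinity_on_partial_deriv[OF f])
  have "C_infinity_on (ball 0 r0) (partial_deriv 1 f) = C_infinity_on (ball 0 r0) f1"
    "C_infinity_on (ball 0 r0) (partial_deriv 2 f) = C_infinity_on (ball 0 r0) f2"
    "C_infinity_on (ball 0 r0) (partial_deriv 3 f) = C_infinity_on (ball 0 r0) f3"
    by (rule C_infinity_on_cong[OF open_ball], simp add: pd)+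
  then show "C_infinity_on (ball 0 r0) f1" "C_infinity_on (ball 0 r0) f2" "C_infinity_on (ball 0 r0) f3"
    using ci by simp_all
qed

lemma smooth_k:
  "C_infinity_on B0 w1" "C_infinity_on B0 w2" "C_infinity_on B0 k13" "C_infinity_on B0 k23"
  "C_infinity_on B0 (\<lambda>x. inverse (k33 x))"
proof -
  note W = smooth_grad[OF smooth grad(1)]
  note K = smooth_grad[OF W(3) grad(4)]
  have sub: "B0 \<subseteq> ball 0 r0" by auto
  show "C_infinity_on B0 w1" "C_infinity_on B0 w2" "C_infinity_on B0 k13" "C_infinity_on B0 k23"
    using W K by (auto intro: C_infinity_on_subset[OF _ sub])
  have "C_infinity_on B0 k33" using K(3) by (rule C_infinity_on_subset[OF _ sub])
  then show "C_infinity_on B0 (\<lambda>x. inverse (k33 x))"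
    by (rule C_infinity_on_intros(6)[OF open_punctured]) (use k33_pos in force)
qed

text \<open>Induction on \<open>n\<close> for all \<open>F\<close> at once: by
  \<open>has_grad_compose\<close> the gradient of \<open>F\<close> after \<open>\<Psi>\<close> again
  consists of functions after \<open>\<Psi>\<close>, and these are smooth away from the origin
  because \<open>k33\<close> is positive there.\<close>

lemma Ck_on_compose_Psi:
  assumes "C_infinity_on B0 F"
  shows "Ck_on n (B - {0}) (\<lambda>X. F (\<Psi> X))"
  using assms
proof (induction n arbitrary: F)
  case 0
  have "continuous_on (B - {0}) (\<lambda>X. F (\<Psi> X))"
    by (rule continuous_on_compose2[OF C_infinity_on_continuous[OF 0] continuous_on_subset[OF Psi_continuous]])
      (use Psi_in_ball Psi_nonzero in auto)
  then show ?case by simp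
next
  case (Suc n)
  define D where "D i = partial_deriv i F" for i
  have D: "C_infinity_on B0 (D i)" for i
    unfolding D_def by (rule C_infinity_on_partial_deriv[OF Suc.prems])
  have g: "has_grad F (D 1 x) (D 2 x) (D 3 x) x" if "x \<in> B0" for x
  proof -
    have "(\<chi> i. partial_deriv i F x) = vector [D 1 x, D 2 x, D 3 x]" by (simp add: vec_eq_iff forall_3 D_def)
    then show ?thesis
      using GDERIV_partial_deriv[OF C_infinity_on_differentiable[OF Suc.prems that]] by (simp add: has_grad_def)
  qed
  define F1 where "F1 x = \<rho> * (D 1 x - D 3 x * k13 x * inverse (k33 x))" for x
  define F2 where "F2 x = \<rho> * (D 2 x - D 3 x * k23 x * inverse (k33 x))" for x
  define F3 where "F3 x = \<rho> * D 3 x * inverse (k33 x)" for x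
  have sm: "C_infinity_on B0 F1" "C_infinity_on B0 F2" "C_infinity_on B0 F3"
    unfolding F1_def F2_def F3_def
    by (intro C_infinity_on_intros(1-5)[OF open_punctured] D smooth_k)+
  show ?case
  proof (rule Ck_on_SucI[OF open_punctured])
    show "GDERIV (\<lambda>X. F (\<Psi> X)) X :> vector [F1 (\<Psi> X), F2 (\<Psi> X), F3 (\<Psi> X)]" if "X \<in> B - {0}" for X
      using has_grad_compose[of X, OF _ _ g[of "\<Psi> X"]] that Psi_in_ball Psi_nonzero
      by (simp add: has_grad_def F1_def F2_def F3_def divide_inverse)
    show "Ck_on n (B - {0}) (\<lambda>X. vector [F1 (\<Psi> X), F2 (\<Psi> X), F3 (\<Psi> X)] $ i)" for i :: 3
      using exhaust_3[of i] Suc.IH[OF sm(1)] Suc.IH[OF sm(2)] Suc.IH[OF sm(3)] by auto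
  qed
qed

lemma C_infinity_u: "C_infinity_on (B - {0}) u"
  unfolding C_infinity_on_def
proof
  fix n
  note I = C_infinity_on_intros(1-5)[OF open_punctured]
  have sm: "C_infinity_on B0 (\<lambda>x. inverse \<rho> * v1 x)" "C_infinity_on B0 (\<lambda>x. inverse \<rho> * v2 x)"
    "C_infinity_on B0 (\<lambda>x. - inverse \<rho> * x $ 3)"
    unfolding v1_def v2_def by (intro I smooth_k)+
  have "Ck_on (Suc n) (B - {0}) u"
  proof (rule Ck_on_SucI[OF open_punctured])
    show "GDERIV u X :> G X" if "X \<in> B - {0}" for X using that GDERIV_u by simp
    show "Ck_on n (B - {0}) (\<lambda>X. G X $ i)" for i
      using exhaust_3[of i] Ck_on_compose_Psi[OF sm(1), of n] Ck_on_compose_Psi[OF sm(2), of n] Ck_on_compose_Psi[OF sm(3), of n]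
      by (auto simp: G_def \<Psi>_def divide_inverse mult.commute)
  qed
  then show "Ck_on n (B - {0}) u" by (rule Ck_on_Suc_imp)
qed

end

section \<open>The Hessian away from the origin and its phase\<close>

lemma second_derivative_nonneg:
  fixes \<phi> \<phi>' :: "real \<Rightarrow> real"
  assumes d: "d > 0" and der: "\<And>t. \<bar>t\<bar> < d \<Longrightarrow> (\<phi> has_real_derivative \<phi>' t) (at t)"
    and der2: "(\<phi>' has_real_derivative l) (at 0)" and min: "\<And>t. \<bar>t\<bar> < d \<Longrightarrow> \<phi> 0 \<le> \<phi> t"
  shows "0 \<le> l"
proof (rule ccontr)
  assume "\<not> 0 \<le> l"
  then have "l < 0" by simp
  have z: "\<phi>' 0 = 0" by (rule DERIV_local_min[OF der[of 0] d]) (use d min in auto)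
  obtain e where e: "e > 0" "\<And>h. 0 < h \<Longrightarrow> h < e \<Longrightarrow> \<phi>' (0 + h) < \<phi>' 0"
    using DERIV_neg_dec_right[OF der2 \<open>l < 0\<close>] by blast
  define t where "t = min d e / 2"
  have t: "0 < t" "t < d" "t < e" using d e by (auto simp: t_def)
  obtain x where x: "0 < x" "x < t" "\<phi> t - \<phi> 0 = (t - 0) * \<phi>' x"
    using MVT2[OF t(1), of \<phi> \<phi>'] der t by auto
  have "\<phi>' x < 0" using e(2)[of x] x t z by simp
  then have "\<phi> t - \<phi> 0 < 0" using x t by (simp add: mult_pos_neg)
  then show False using min[of t] t by simp
qed

lemma GDERIV_quadratic:
  fixes A :: "real ^ 'n ^ 'n"
  shows "GDERIV (\<lambda>x. c + b \<bullet> x + x \<bullet> (A *v x)) x :> b + (A + transpose A) *v x"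
proof -
  have A: "((\<lambda>x. A *v x) has_derivative (\<lambda>h. A *v h)) (at x)"
    by (rule bounded_linear.has_derivative[OF matrix_vector_mul_bounded_linear has_derivative_ident])
  have "((\<lambda>x. c + b \<bullet> x + x \<bullet> (A *v x)) has_derivative
      (\<lambda>h. 0 + b \<bullet> h + (x \<bullet> (A *v h) + h \<bullet> (A *v x)))) (at x)"
    by (intro has_derivative_add has_derivative_const has_derivative_inner A
        has_derivative_inner_right has_derivative_ident)
  moreover have "x \<bullet> (A *v h) = h \<bullet> (transpose A *v x)" for h
    by (simp add: dot_lmul_matrix[symmetric] transpose_matrix_vector inner_commute)
  ultimately show ?thesis
    by (simp add: gderiv_def inner_add_right matrix_vector_mult_add_rdistrib inner_commute[of b] algebra_simps)
qed

lemma hessian_quadratic: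
  fixes A :: "real ^ 'n ^ 'n"
  assumes "\<And>x. Q x = c + b \<bullet> x + x \<bullet> (A *v x)"
  shows "hessian Q x = A + transpose A"
proof -
  have Q: "Q = (\<lambda>x. c + b \<bullet> x + x \<bullet> (A *v x))" using assms by auto
  let ?S = "A + transpose A"
  have 1: "partial_deriv j Q = (\<lambda>x. (b + ?S *v x) $ j)" for j
    unfolding Q by (rule ext, rule partial_deriv_GDERIV[OF GDERIV_quadratic])
  have 2: "GDERIV (\<lambda>x. (b + ?S *v x) $ j) x :> ?S $ j" for j x
  proof -
    have "((\<lambda>x. (b + ?S *v x) $ j) has_derivative (\<lambda>h. (0 + ?S *v h) $ j)) (at x)"
      by (intro bounded_linear.has_derivative[OF bounded_linear_vec_nth] has_derivative_add has_derivative_const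
          bounded_linear.has_derivative[OF matrix_vector_mul_bounded_linear has_derivative_ident])
    moreover have "(\<lambda>h. (0 + ?S *v h) $ j) = (\<lambda>h. h \<bullet> ?S $ j)"
      by (simp add: fun_eq_iff matrix_vector_mult_def inner_vec_def mult.commute)
    ultimately show ?thesis by (simp add: gderiv_def)
  qed
  have "partial_deriv i (partial_deriv j Q) x = ?S $ j $ i" for i j
    unfolding 1 by (rule partial_deriv_GDERIV[OF 2])
  then show ?thesis by (simp add: hessian_def vec_eq_iff transpose_def add.commute)
qed

lemma arctan_add_half_le: "arctan (x + 1/2) \<le> arctan x + 1/2"
proof -
  obtain z where "arctan (x + 1/2) - arctan x = (x + 1/2 - x) * inverse (1 + z\<^sup>2)"
    using MVT2[of x "x + 1/2" arctan "\<lambda>z. inverse (1 + z\<^sup>2)"] DERIV_arctan by auto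
  moreover have "inverse (1 + z\<^sup>2) \<le> 1" by (simp add: inverse_le_1_iff)
  ultimately show ?thesis by simp
qed

text \<open>This identity is the origin of \<open>NN\<close>. Multiplied by \<open>n\<close>, the
  phase equation for the Hessian of the transform becomes \<open>E = 0\<close>. Expanding in the
  constant part, \<open>n\<close>, \<open>T\<close>, \<open>F\<close>, \<open>D\<close> and the
  determinant, and evaluating the first four coefficients by \<open>e0\<close> to \<open>e3\<close>,
  turns \<open>c^2 * E\<close> into \<open>n - NN c s K11 K12 K13 K22 K23 n\<close>.\<close>

lemma phase_identity:
  fixes a c s K11 K12 K13 K22 K23 n :: real
  assumes ac: "a * c = s" and cs1: "c\<^sup>2 + s\<^sup>2 = 1" and c: "c \<noteq> 0"
    and n: "n = NN c s K11 K12 K13 K22 K23 n"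
  defines "V11 \<equiv> a + K11" and "V22 \<equiv> a + K22"
  defines "dV \<equiv> V11 * V22 - K12\<^sup>2"
  shows "2 * s * c * (n * (V11 + V22) - (K13\<^sup>2 + K23\<^sup>2) - 1 + dV)
    = (s\<^sup>2 - c\<^sup>2) * (n - (n * dV - (V22 * K13\<^sup>2 - 2 * K12 * K13 * K23 + V11 * K23\<^sup>2)) + (V11 + V22))"
proof -
  define T where "T = K11 + K22"
  define D where "D = K11 * K22 - K12\<^sup>2"
  define F where "F = n * T - (K13\<^sup>2 + K23\<^sup>2)"
  define E where "E = 2 * s * c * (n * (V11 + V22) - (K13\<^sup>2 + K23\<^sup>2) - 1 + dV)
    - (s\<^sup>2 - c\<^sup>2) * (n - (n * dV - (V22 * K13\<^sup>2 - 2 * K12 * K13 * K23 + V11 * K23\<^sup>2)) + (V11 + V22))"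
  have e0: "c\<^sup>2 * (2 * s * c * (a\<^sup>2 - 1) + (c\<^sup>2 - s\<^sup>2) * (2 * a)) = 0"
    unfolding ac[symmetric] by (simp add: power2_eq_square algebra_simps)
  have "c\<^sup>2 * (2 * s * c * (2 * a) + (c\<^sup>2 - s\<^sup>2) * (1 - a\<^sup>2)) = (c\<^sup>2 + s\<^sup>2)\<^sup>2"
    unfolding ac[symmetric] by (simp add: power2_eq_square algebra_simps)
  then have e1: "c\<^sup>2 * (2 * s * c * (2 * a) + (c\<^sup>2 - s\<^sup>2) * (1 - a\<^sup>2)) = 1" unfolding cs1 by simp
  have "c\<^sup>2 * (2 * s * c * a + (c\<^sup>2 - s\<^sup>2)) = c\<^sup>2 * (c\<^sup>2 + s\<^sup>2)"
    unfolding ac[symmetric] by (simp add: power2_eq_square algebra_simps)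
  then have e2: "c\<^sup>2 * (2 * s * c * a + (c\<^sup>2 - s\<^sup>2)) = c\<^sup>2" unfolding cs1 by simp
  have "c\<^sup>2 * (2 * s * c - (c\<^sup>2 - s\<^sup>2) * a) = s * c * (c\<^sup>2 + s\<^sup>2)"
    unfolding ac[symmetric] by (simp add: power2_eq_square algebra_simps)
  then have e3: "c\<^sup>2 * (2 * s * c - (c\<^sup>2 - s\<^sup>2) * a) = s * c" unfolding cs1 by simp
  have "c\<^sup>2 * E = c\<^sup>2 * (2 * s * c * (a\<^sup>2 - 1) + (c\<^sup>2 - s\<^sup>2) * (2 * a))
    + c\<^sup>2 * (2 * s * c * (2 * a) + (c\<^sup>2 - s\<^sup>2) * (1 - a\<^sup>2)) * n
    + c\<^sup>2 * (2 * s * c * a + (c\<^sup>2 - s\<^sup>2)) * T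
    + c\<^sup>2 * (2 * s * c - (c\<^sup>2 - s\<^sup>2) * a) * F
    + 2 * s * c ^ 3 * D - c\<^sup>2 * (c\<^sup>2 - s\<^sup>2) * det3s K11 K12 K13 K22 K23 n"
    unfolding E_def T_def D_def F_def dV_def V11_def V22_def det3s_def by algebra
  also have "\<dots> = n + c\<^sup>2 * T + s * c * F + 2 * s * c ^ 3 * D - c\<^sup>2 * (c\<^sup>2 - s\<^sup>2) * det3s K11 K12 K13 K22 K23 n"
    unfolding e0 e1 e2 e3 by simp
  also have "\<dots> = n - NN c s K11 K12 K13 K22 K23 n"
    unfolding NN_def T_def D_def F_def by (simp add: power2_eq_square algebra_simps)
  also have "\<dots> = 0" using n by simp
  finally have "E = 0" using c by simp
  then show ?thesis by (simp add: E_def)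
qed

context slag_graph
begin

text \<open>The Hessian of \<open>u\<close> in terms of the Hessian of \<open>v\<close>: the upper
  left block is the Schur complement of the entry \<open>k33\<close>, and the corner is its negative
  inverse.\<close>

definition M :: "real ^ 3 \<Rightarrow> real ^ 3 ^ 3" where
  "M X = (let x = \<Psi> X; n = k33 x in vector
    [vector [a + k11 x - (k13 x)\<^sup>2 / n, k12 x - k13 x * k23 x / n, k13 x / n],
     vector [k12 x - k13 x * k23 x / n, a + k22 x - (k23 x)\<^sup>2 / n, k23 x / n],
     vector [k13 x / n, k23 x / n, - 1 / n]])"

lemma M_symmetric: "transpose (M X) = M X"
  by (simp add: M_def Let_def transpose_def vec_eq_iff forall_3)

lemma has_grad_G:
  assumes X: "X \<in> B" "X \<noteq> 0"
  shows "has_grad (\<lambda>X. G X $ i) (M X $ i $ 1) (M X $ i $ 2) (M X $ i $ 3) X"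
proof -
  have x: "\<Psi> X \<in> ball 0 r0" using Psi_in_ball X by blast
  have k: "k33 (\<Psi> X) > 0" using k33_pos[OF x Psi_nonzero] X by auto
  have 1: "has_grad (\<lambda>X. (1 / \<rho>) * v1 (\<Psi> X)) (M X $ 1 $ 1) (M X $ 1 $ 2) (M X $ 1 $ 3) X"
    by (rule has_grad_eqI[OF has_grad_cmult[OF has_grad_compose[OF X has_grad_v(2)[OF x]]]])
      (use k rho_pos in \<open>simp_all add: M_def Let_def power2_eq_square\<close>)
  have 2: "has_grad (\<lambda>X. (1 / \<rho>) * v2 (\<Psi> X)) (M X $ 2 $ 1) (M X $ 2 $ 2) (M X $ 2 $ 3) X"
    by (rule has_grad_eqI[OF has_grad_cmult[OF has_grad_compose[OF X has_grad_v(3)[OF x]]]])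
      (use k rho_pos in \<open>simp_all add: M_def Let_def power2_eq_square mult.commute\<close>)
  have 3: "has_grad (\<lambda>X. (- 1 / \<rho>) * h X) (M X $ 3 $ 1) (M X $ 3 $ 2) (M X $ 3 $ 3) X"
    by (rule has_grad_eqI[OF has_grad_cmult[OF has_grad_h[OF X]]])
      (use k rho_pos in \<open>simp_all add: M_def Let_def\<close>)
  show ?thesis
    using exhaust_3[of i] 1 2 3 by (auto simp: G_def)
qed

text \<open>Completing the square displays the form as that of \<open>v\<close> in the horizontal
  directions minus a square over \<open>k33\<close>. Upper bounds and a positive direction can be
  read off.\<close>

lemma quad_form_M:
  fixes \<xi> :: "real ^ 3"
  defines "p \<equiv> \<xi> $ 1" and "q \<equiv> \<xi> $ 2" and "z \<equiv> \<xi> $ 3"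
  shows "\<xi> \<bullet> (M X *v \<xi>) = (a + k11 (\<Psi> X)) * p\<^sup>2 + 2 * k12 (\<Psi> X) * p * q + (a + k22 (\<Psi> X)) * q\<^sup>2
    - (k13 (\<Psi> X) * p + k23 (\<Psi> X) * q - z)\<^sup>2 / k33 (\<Psi> X)"
  unfolding p_def q_def z_def
  by (simp add: M_def Let_def inner_vec_def matrix_vector_mult_def sum_3 power2_eq_square
      add_divide_distrib diff_divide_distrib algebra_simps)

lemma phase_M:
  assumes X: "X \<in> B" "X \<noteq> 0"
  shows "sum_arctan_eigenvalues (M X) = \<Theta>"
proof -
  define x where "x = \<Psi> X"
  have x: "x \<in> ball 0 r0" "x \<noteq> 0" using Psi_in_ball Psi_nonzero X by (auto simp: x_def)
  define n where "n = k33 x"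
  have n: "n > 0" using k33_pos[OF x] by (simp add: n_def)
  define V11 where "V11 = a + k11 x"
  define V22 where "V22 = a + k22 x"
  define dV where "dV = V11 * V22 - (k12 x)\<^sup>2"
  define tb where "tb = V22 * (k13 x)\<^sup>2 - 2 * k12 x * k13 x * k23 x + V11 * (k23 x)\<^sup>2"
  have sm: "\<bar>k11 x\<bar> \<le> 1/4" "\<bar>k12 x\<bar> \<le> 1/4" "\<bar>k22 x\<bar> \<le> 1/4" "\<bar>k11 x\<bar> \<le> a/4" "\<bar>k12 x\<bar> \<le> a/4" "\<bar>k22 x\<bar> \<le> a/4"
    using small[OF x(1)] by (auto simp: a_def)
  have V: "V11 \<ge> 3/4 * a" "V22 \<ge> 3/4 * a" using sm by (auto simp: V11_def V22_def abs_le_iff)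
  have dV: "dV > 0"
  proof -
    have "(3/4 * a) * (3/4 * a) \<le> V11 * V22" using V a_pos by (intro mult_mono) auto
    moreover have "\<bar>k12 x\<bar>\<^sup>2 \<le> (a/4)\<^sup>2" using sm by (intro power_mono) auto
    moreover have "(a/4)\<^sup>2 < (3/4 * a) * (3/4 * a)" using a_pos by (simp add: power2_eq_square)
    ultimately show ?thesis by (simp add: dV_def)
  qed
  have detM: "det (M X) = - dV / n"
    unfolding det_3 using n
    by (simp add: M_def Let_def x_def[symmetric] n_def[symmetric] dV_def V11_def V22_def power2_eq_square field_simps)
  define s1 where "s1 = (M X) $ 1 $ 1 + (M X) $ 2 $ 2 + (M X) $ 3 $ 3"
  define s2 where "s2 = (M X) $ 1 $ 1 * (M X) $ 2 $ 2 - ((M X) $ 1 $ 2)\<^sup>2 + (M X) $ 1 $ 1 * (M X) $ 3 $ 3 - ((M X) $ 1 $ 3)\<^sup>2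
      + (M X) $ 2 $ 2 * (M X) $ 3 $ 3 - ((M X) $ 2 $ 3)\<^sup>2"
  have s1: "n * s1 = n * (V11 + V22) - ((k13 x)\<^sup>2 + (k23 x)\<^sup>2) - 1"
    using n by (simp add: s1_def M_def Let_def x_def[symmetric] n_def[symmetric] V11_def V22_def field_simps)
  have s2: "n * s2 = n * dV - tb - (V11 + V22)"
    using n by (simp add: s2_def M_def Let_def x_def[symmetric] n_def[symmetric] V11_def V22_def dV_def tb_def
        power2_eq_square field_simps)
  have E: "2 * s * c * (n * (V11 + V22) - ((k13 x)\<^sup>2 + (k23 x)\<^sup>2) - 1 + dV)
    = (s\<^sup>2 - c\<^sup>2) * (n - (n * dV - tb) + (V11 + V22))"
    unfolding tb_def dV_def V11_def V22_def
    by (rule phase_identity) (use pde[OF x(1)] cs in \<open>simp_all add: n_def a_def\<close>)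
  have nd: "n * det (M X) = - dV" using n by (simp add: detM)
  have "n * (cos \<Theta> * (s1 - det (M X))) = 2 * s * c * (n * s1 - n * det (M X))"
    by (simp add: cs algebra_simps)
  also have "\<dots> = (s\<^sup>2 - c\<^sup>2) * (n - n * s2)"
    unfolding s1 s2 nd using E by (simp add: algebra_simps)
  also have "\<dots> = n * (sin \<Theta> * (1 - s2))" by (simp add: cs algebra_simps)
  finally have eq: "cos \<Theta> * (s1 - det (M X)) = sin \<Theta> * (1 - s2)" using n by simp
  \<comment> \<open>The third component makes the square in \<open>quad_form_M\<close> vanish,
    leaving the positive entry \<open>V11\<close>.\<close>
  define x0 :: "real ^ 3" where "x0 = vector [1, 0, k13 x]"
  have pos: "0 < x0 \<bullet> (M X *v x0)"
    unfolding quad_form_M x_def[symmetric] x0_def using V a_pos by (simp add: V11_def)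
  have bound: "\<xi> \<bullet> (M X *v \<xi>) \<le> (a + 1/2) * (\<xi> \<bullet> \<xi>)" for \<xi>
  proof -
    let ?p = "\<xi> $ 1" and ?q = "\<xi> $ 2"
    have "k11 x * ?p\<^sup>2 \<le> 1/4 * ?p\<^sup>2" "k22 x * ?q\<^sup>2 \<le> 1/4 * ?q\<^sup>2"
      using sm by (intro mult_right_mono; simp)+
    moreover have "2 * k12 x * ?p * ?q \<le> 1/4 * ?p\<^sup>2 + 1/4 * ?q\<^sup>2"
    proof -
      have "2 * k12 x * ?p * ?q \<le> \<bar>k12 x\<bar> * (2 * \<bar>?p\<bar> * \<bar>?q\<bar>)"
        using abs_ge_self[of "2 * k12 x * ?p * ?q"] by (simp add: abs_mult mult_ac)
      also have "\<dots> \<le> 1/4 * (2 * \<bar>?p\<bar> * \<bar>?q\<bar>)" using sm by (intro mult_right_mono) auto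
      also have "\<dots> \<le> 1/4 * (?p\<^sup>2 + ?q\<^sup>2)"
        using sum_squares_bound[of "\<bar>?p\<bar>" "\<bar>?q\<bar>"] by simp
      finally show ?thesis by simp
    qed
    moreover have "(k13 x * ?p + k23 x * ?q - \<xi> $ 3)\<^sup>2 / k33 x \<ge> 0" using n by (simp add: n_def)
    ultimately have "\<xi> \<bullet> (M X *v \<xi>) \<le> (a + 1/2) * (?p\<^sup>2 + ?q\<^sup>2)"
      unfolding quad_form_M x_def[symmetric] by (simp add: algebra_simps)
    also have "\<dots> \<le> (a + 1/2) * (\<xi> \<bullet> \<xi>)"
      using a_pos by (intro mult_left_mono) (auto simp: inner_vec_def sum_3 power2_eq_square)
    finally show ?thesis .
  qed
  \<comment> \<open>Since \<open>arctan\<close> has slope at most 1, the left side is at most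
    \<open>\<Theta> + pi / 2 + 1\<close>, and \<open>1 < pi / 2\<close>.\<close>
  have b: "2 * arctan (a + 1/2) < \<Theta> + pi"
    using arctan_add_half_le[of a] cs(6) pi_gt3 by (simp add: a_def)
  show ?thesis
    by (rule sum_arctan_eq_phase[OF M_symmetric Theta s1_def s2_def eq _ pos bound b])
      (use detM dV n in simp)
qed

text \<open>Applied with \<open>\<sigma> = 1\<close> for touching from below and
  \<open>\<sigma> = - 1\<close> for touching from above. On every line through \<open>X\<close> the
  function \<open>\<sigma> * (u - Q)\<close> has a local minimum at \<open>X\<close>, so its second
  derivative there is nonnegative.\<close>

lemma touch_hessian:
  assumes X: "X \<in> B" "X \<noteq> 0" and Q: "\<And>x. Q x = c' + b \<bullet> x + x \<bullet> (A *v x)"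
    and eq: "Q X = u X" and touch: "\<forall>\<^sub>F x in nhds X. 0 \<le> \<sigma> * (u x - Q x)"
  shows "0 \<le> \<sigma> * (\<xi> \<bullet> (M X *v \<xi>) - \<xi> \<bullet> ((A + transpose A) *v \<xi>))"
proof -
  have "\<forall>\<^sub>F x in nhds X. x \<in> B" using X by (intro eventually_nhds_in_open) auto
  with touch have "\<forall>\<^sub>F x in nhds X. x \<in> B \<and> 0 \<le> \<sigma> * (u x - Q x)" by eventually_elim simp
  then obtain d where d: "d > 0" "\<And>x. dist x X < d \<Longrightarrow> x \<in> B \<and> 0 \<le> \<sigma> * (u x - Q x)"
    unfolding eventually_nhds_metric by blast
  define e where "e = d / (norm \<xi> + 1)"
  have e: "e > 0" using d by (simp add: e_def add_nonneg_pos)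
  have near: "dist (X + t *\<^sub>R \<xi>) X < d" if "\<bar>t\<bar> < e" for t
  proof -
    have "\<bar>t\<bar> * (norm \<xi> + 1) < d" using that by (simp add: e_def pos_less_divide_eq add_nonneg_pos)
    then show ?thesis by (simp add: dist_norm distrib_left)
  qed
  let ?S = "A + transpose A"
  define \<phi> where "\<phi> t = \<sigma> * (u (X + t *\<^sub>R \<xi>) - Q (X + t *\<^sub>R \<xi>))" for t
  define \<phi>' where "\<phi>' t = \<sigma> * (\<xi> \<bullet> G (X + t *\<^sub>R \<xi>) - \<xi> \<bullet> (b + ?S *v (X + t *\<^sub>R \<xi>)))" for t
  have Q': "Q = (\<lambda>x. c' + b \<bullet> x + x \<bullet> (A *v x))" using Q by auto
  show ?thesis
  proof (rule second_derivative_nonneg[OF e, of \<phi> \<phi>'])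
    fix t :: real assume t: "\<bar>t\<bar> < e"
    have line: "((\<lambda>t. X + t *\<^sub>R \<xi>) has_derivative (\<lambda>h. h *\<^sub>R \<xi>)) (at t)"
      by (auto intro!: derivative_eq_intros)
    have along: "((\<lambda>t. f (X + t *\<^sub>R \<xi>)) has_real_derivative \<xi> \<bullet> g) (at t)"
      if "GDERIV f (X + t *\<^sub>R \<xi>) :> g" for f g
      unfolding has_field_derivative_def
      using diff_chain_at[OF line that[unfolded gderiv_def], unfolded comp_def]
      by (rule has_derivative_eq_rhs) (simp add: fun_eq_iff mult.commute)
    show "(\<phi> has_real_derivative \<phi>' t) (at t)"
      unfolding \<phi>_def \<phi>'_def
      by (intro DERIV_cmult DERIV_diff along GDERIV_u)
        (use d(2)[OF near[OF t]] GDERIV_quadratic in \<open>auto simp: Q'\<close>)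
    show "\<phi> 0 \<le> \<phi> t" using d(2)[OF near[OF t]] eq by (simp add: \<phi>_def)
  next
    have "((\<lambda>t. \<xi> \<bullet> G (X + t *\<^sub>R \<xi>)) has_real_derivative \<xi> \<bullet> (M X *v \<xi>)) (at 0)"
    proof -
      have "((\<lambda>t. G (X + t *\<^sub>R \<xi>) $ i) has_real_derivative
          (M X $ i $ 1 * \<xi> $ 1 + M X $ i $ 2 * \<xi> $ 2 + M X $ i $ 3 * \<xi> $ 3)) (at 0)" for i
        using has_grad_DERIV_line[of "\<lambda>X. G X $ i" _ _ _ X 0 \<xi>] has_grad_G[OF X] by simp
      then have "((\<lambda>t. \<xi> $ 1 * G (X + t *\<^sub>R \<xi>) $ 1 + \<xi> $ 2 * G (X + t *\<^sub>R \<xi>) $ 2 + \<xi> $ 3 * G (X + t *\<^sub>R \<xi>) $ 3)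
        has_real_derivative (\<xi> $ 1 * (M X $ 1 $ 1 * \<xi> $ 1 + M X $ 1 $ 2 * \<xi> $ 2 + M X $ 1 $ 3 * \<xi> $ 3) +
          \<xi> $ 2 * (M X $ 2 $ 1 * \<xi> $ 1 + M X $ 2 $ 2 * \<xi> $ 2 + M X $ 2 $ 3 * \<xi> $ 3) +
          \<xi> $ 3 * (M X $ 3 $ 1 * \<xi> $ 1 + M X $ 3 $ 2 * \<xi> $ 2 + M X $ 3 $ 3 * \<xi> $ 3))) (at 0)"
        by (intro DERIV_add DERIV_cmult)
      then show ?thesis by (simp add: inner_vec_def matrix_vector_mult_def sum_3)
    qed
    moreover have "((\<lambda>t. \<xi> \<bullet> (b + ?S *v (X + t *\<^sub>R \<xi>))) has_real_derivative \<xi> \<bullet> (?S *v \<xi>)) (at 0)"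
    proof -
      have "(\<lambda>t. \<xi> \<bullet> (b + ?S *v (X + t *\<^sub>R \<xi>))) = (\<lambda>t. \<xi> \<bullet> (b + ?S *v X) + t * (\<xi> \<bullet> (?S *v \<xi>)))"
        by (simp add: fun_eq_iff matrix_vector_right_distrib matrix_vector_mult_scaleR inner_add_right)
      then show ?thesis by (auto intro!: derivative_eq_intros)
    qed
    ultimately show "(\<phi>' has_real_derivative \<sigma> * (\<xi> \<bullet> (M X *v \<xi>) - \<xi> \<bullet> (?S *v \<xi>))) (at 0)"
      unfolding \<phi>'_def by (intro DERIV_cmult DERIV_diff)
  qed
qed

lemma transpose_sum: "transpose (A + transpose A) = (A + transpose A :: real ^ 'n ^ 'n)"
  by (simp add: transpose_def vec_eq_iff add.commute)

text \<open>Away from the origin \<open>u\<close> is a classical solution: contact orders the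
  Hessians of \<open>Q\<close> and \<open>u\<close>, and the sum of arctangents is monotone.\<close>

lemma viscosity_nonzero:
  assumes X: "X \<in> B" "X \<noteq> 0" and Q: "quadratic_polynomial Q"
  shows "touches_from_below Q u X \<Longrightarrow> sum_arctan_eigenvalues (hessian Q X) \<le> \<Theta>"
    and "touches_from_above Q u X \<Longrightarrow> \<Theta> \<le> sum_arctan_eigenvalues (hessian Q X)"
proof -
  obtain c' b A where Q: "\<And>x. Q x = c' + b \<bullet> x + x \<bullet> (A *v x)"
    using Q unfolding quadratic_polynomial_def by blast
  note H = hessian_quadratic[OF Q]
  { assume t: "touches_from_below Q u X"
    have "0 \<le> 1 * (\<xi> \<bullet> (M X *v \<xi>) - \<xi> \<bullet> ((A + transpose A) *v \<xi>))" for \<xi>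
      by (rule touch_hessian[OF X Q]) (use t in \<open>auto simp: touches_from_below_def\<close>)
    then show "sum_arctan_eigenvalues (hessian Q X) \<le> \<Theta>"
      unfolding H phase_M[OF X, symmetric] by (intro sum_arctan_mono transpose_sum M_symmetric) simp }
  { assume t: "touches_from_above Q u X"
    have "0 \<le> (- 1) * (\<xi> \<bullet> (M X *v \<xi>) - \<xi> \<bullet> ((A + transpose A) *v \<xi>))" for \<xi>
      by (rule touch_hessian[OF X Q]) (use t in \<open>auto simp: touches_from_above_def elim: eventually_mono\<close>)
    then show "\<Theta> \<le> sum_arctan_eigenvalues (hessian Q X)"
      unfolding H phase_M[OF X, symmetric] by (intro sum_arctan_mono transpose_sum M_symmetric) simp }
qed

end

section \<open>Behaviour at the origin\<close>

lemma vec_zero_3: "vector [0, 0, 0] = (0 :: real ^ 3)"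
  by (simp add: vec_eq_iff forall_3)

text \<open>The symmetric difference eliminates the unknown linear part, so contact at the origin
  can be tested on the values at \<open>x\<close> and \<open>- x\<close> alone.\<close>

lemma quadratic_second_difference:
  fixes A :: "real ^ 'n ^ 'n"
  assumes "\<And>x. Q x = c + b \<bullet> x + x \<bullet> (A *v x)"
  shows "Q x + Q (- x) - 2 * Q 0 = x \<bullet> ((A + transpose A) *v x)"
proof -
  have "x \<bullet> (transpose A *v x) = x \<bullet> (A *v x)"
    by (metis dot_lmul_matrix inner_commute transpose_matrix_vector)
  moreover have "- x \<bullet> (A *v - x) = x \<bullet> (A *v x)"
    using matrix_vector_mult_scaleR[of A "-1" x] by simp
  ultimately show ?thesis
    by (simp add: assms matrix_vector_mult_add_rdistrib inner_add_right)
qed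

context slag_graph
begin

text \<open>The value of \<open>\<rho>^2 * u\<close> at the axis point whose image under
  \<open>h\<close> is \<open>z\<close>, see \<open>u_axis\<close>.\<close>

definition \<psi> :: "real \<Rightarrow> real" where
  "\<psi> z = w (vector [0, 0, z]) - z * w3 (vector [0, 0, z])"

lemma axis_in_ball: "\<bar>z\<bar> \<le> r \<Longrightarrow> vector [0, 0, z] \<in> ball (0 :: real ^ 3) r0"
  using rho_pos by (intro box_in_ball) auto

lemma DERIV_psi:
  assumes "\<bar>z\<bar> \<le> r"
  shows "(\<psi> has_real_derivative - (z * k33 (vector [0, 0, z]))) (at z)"
  unfolding \<psi>_def
  by (rule derivative_eq_intros has_grad_DERIV_3[OF grad(1)[OF axis_in_ball[OF assms]]]
      has_grad_DERIV_3[OF grad(4)[OF axis_in_ball[OF assms]]] refl)+ simp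

lemma k33_nonneg: "x \<in> ball 0 r0 \<Longrightarrow> k33 x \<ge> 0"
  using k33_lower[of x] c0 by (smt (verit) mult_nonneg_nonneg norm_ge_zero zero_le_power)

lemma psi_zero: "\<psi> 0 = 0"
  by (simp add: \<psi>_def vec_zero_3 w_zero)

text \<open>The derivative \<open>- z * k33\<close> has the sign opposite to \<open>z\<close> or
  vanishes, so \<open>\<psi>\<close> is maximal at 0.\<close>

lemma psi_nonpos:
  assumes "\<bar>z\<bar> \<le> r"
  shows "\<psi> z \<le> 0"
proof (cases "z \<ge> 0")
  case True
  have "\<psi> z \<le> \<psi> 0"
  proof (rule DERIV_nonpos_imp_nonincreasing[OF True])
    fix t assume t: "0 \<le> t" "t \<le> z"
    then have "t * k33 (vector [0, 0, t]) \<ge> 0" using k33_nonneg[OF axis_in_ball, of t] assms by simp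
    then show "\<exists>y. (\<psi> has_real_derivative y) (at t) \<and> y \<le> 0"
      using DERIV_psi[of t] t assms by (intro exI[of _ "- (t * k33 (vector [0, 0, t]))"]) auto
  qed
  then show ?thesis by (simp add: psi_zero)
next
  case False
  have "\<psi> z \<le> \<psi> 0"
  proof (rule DERIV_nonneg_imp_nondecreasing[of z 0 \<psi>])
    show "z \<le> 0" using False by simp
    fix t assume t: "z \<le> t" "t \<le> 0"
    then have "t * k33 (vector [0, 0, t]) \<le> 0"
      using k33_nonneg[OF axis_in_ball, of t] assms by (simp add: mult_nonpos_nonneg)
    then show "\<exists>y. (\<psi> has_real_derivative y) (at t) \<and> 0 \<le> y"
      using DERIV_psi[of t] t assms by (intro exI[of _ "- (t * k33 (vector [0, 0, t]))"]) auto
  qed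
  then show ?thesis by (simp add: psi_zero)
qed

lemma psi_upper:
  assumes "0 \<le> z" "z \<le> r"
  shows "\<psi> z \<le> - (c0 / real (N + 1)) * z ^ (N + 1)"
proof -
  have "\<psi> z + c0 / real (N + 1) * z ^ (N + 1) \<le> \<psi> 0 + c0 / real (N + 1) * 0 ^ (N + 1)"
  proof (rule DERIV_nonpos_imp_nonincreasing[OF assms(1)])
    fix t assume t: "0 \<le> t" "t \<le> z"
    have p: "((\<lambda>z. c0 / real (N + 1) * z ^ (N + 1)) has_real_derivative
        c0 / real (N + 1) * (real (N + 1) * t ^ (N + 1 - Suc 0))) (at t)"
      by (intro DERIV_cmult DERIV_pow)
    have eq: "c0 / real (N + 1) * (real (N + 1) * t ^ (N + 1 - Suc 0)) = c0 * t ^ N"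
      by (simp add: add.commute)
    have tr: "\<bar>t\<bar> \<le> r" using t assms by simp
    have d: "((\<lambda>z. \<psi> z + c0 / real (N + 1) * z ^ (N + 1)) has_real_derivative
        (- (t * k33 (vector [0, 0, t])) + c0 * t ^ N)) (at t)"
      by (rule DERIV_add[OF DERIV_psi[OF tr] p[unfolded eq]])
    have "c0 * t ^ (2 * k + 2) \<le> c0 * norm (vector [0, 0, t] :: real ^ 3) ^ (2 * k + 2)"
      using c0 t norm_ge_z[of t 0 0] by (intro mult_left_mono power_mono) auto
    also have "\<dots> \<le> k33 (vector [0, 0, t])" using t assms by (intro k33_lower axis_in_ball) auto
    finally have "t * (c0 * t ^ (2 * k + 2)) \<le> t * k33 (vector [0, 0, t])" using t by (intro mult_left_mono)
    moreover have "t * (c0 * t ^ (2 * k + 2)) = c0 * t ^ N" by (simp add: power_add power2_eq_square power3_eq_cube)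
    ultimately show "\<exists>y. ((\<lambda>z. \<psi> z + c0 / real (N + 1) * z ^ (N + 1)) has_real_derivative y) (at t) \<and> y \<le> 0"
      using d by (intro exI[of _ "- (t * k33 (vector [0, 0, t])) + c0 * t ^ N"]) linarith
  qed
  then show ?thesis by (simp add: psi_zero power_0_left)
qed

lemma u_axis:
  assumes t: "\<bar>t\<bar> < 1"
  shows "vector [0, 0, t] \<in> B" "u (vector [0, 0, t]) = \<psi> (h (vector [0, 0, t])) / \<rho>\<^sup>2"
proof -
  show X: "vector [0, 0, t] \<in> B" using norm_vector_3_le[of 0 0 t] t by simp
  have P: "\<Psi> (vector [0, 0, t]) = vector [0, 0, h (vector [0, 0, t])]" by (simp add: \<Psi>_def)
  have "w3 (vector [0, 0, h (vector [0, 0, t])]) = \<rho> * t" using h_works(2)[OF X] unfolding P by simp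
  then show "u (vector [0, 0, t]) = \<psi> (h (vector [0, 0, t])) / \<rho>\<^sup>2"
    unfolding u_def v_def P \<psi>_def by simp
qed

lemma u_axis_nonpos: "\<bar>t\<bar> < 1 \<Longrightarrow> u (vector [0, 0, t]) \<le> 0"
  using u_axis[of t] psi_nonpos[OF h_works(1)[of "vector [0, 0, t]"]] by (simp add: divide_nonpos_nonneg)

text \<open>The inverse of \<open>h\<close> along the axis, see \<open>h_T\<close>: the axis
  coordinate in the unit ball that corresponds to the height \<open>z\<close>.\<close>

definition T :: "real \<Rightarrow> real" where "T z = w3 (vector [0, 0, z]) / \<rho>"

lemma T_bounds:
  assumes z: "0 < z" "z \<le> r"
  shows "0 < T z" "T z \<le> C / \<rho> * z ^ N"
proof -
  have "c1 * (z - 0) ^ N \<le> w3 (vector [0, 0, z]) - w3 (vector [0, 0, 0])"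
    by (rule w3_diff_ge) (use z rho_pos in auto)
  then have "w3 (vector [0, 0, z]) > 0"
    using c1_pos z by (simp add: vec_zero_3 w3_zero) (smt (verit) mult_pos_pos zero_less_power)
  then show "0 < T z" using rho_pos by (simp add: T_def)
  have "norm (vector [0, 0, z] :: real ^ 3) \<le> z" using norm_vector_3_le[of 0 0 z] z by simp
  then have "C * norm (vector [0, 0, z] :: real ^ 3) ^ N \<le> C * z ^ N"
    using C by (intro mult_left_mono power_mono) auto
  moreover have "w3 (vector [0, 0, z]) \<le> C * norm (vector [0, 0, z] :: real ^ 3) ^ N"
    using w3_axis[OF axis_in_ball[of z]] z by simp
  ultimately show "T z \<le> C / \<rho> * z ^ N" using rho_pos by (simp add: T_def divide_right_mono)
qed

lemma h_T:
  assumes z: "0 < z" "z \<le> r" and T: "T z < 1"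
  shows "h (vector [0, 0, T z]) = z"
proof (rule h_unique)
  show "vector [0, 0, T z] \<in> B" using u_axis(1)[of "T z"] T_bounds(1)[OF z] T by simp
  show "w3 (vector [\<rho> * (vector [0, 0, T z] :: real ^ 3) $ 1, \<rho> * (vector [0, 0, T z] :: real ^ 3) $ 2, z]) = \<rho> * (vector [0, 0, T z] :: real ^ 3) $ 3"
    using rho_pos by (simp add: T_def)
qed (use z in auto)

lemma T_small:
  assumes "e > 0"
  obtains z0 where "0 < z0" "\<And>z. 0 < z \<Longrightarrow> z < z0 \<Longrightarrow> z \<le> r \<and> z \<le> 1 \<and> T z < e"
proof (rule that)
  let ?z0 = "min (min r 1) (e * \<rho> / C)"
  show "0 < ?z0" using assms r_pos rho_pos C by simp
  fix z assume z: "0 < z" "z < ?z0"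
  then have zr: "z \<le> r" "z \<le> 1" by auto
  have "z ^ N \<le> z ^ 1" using z zr by (intro power_decreasing) auto
  then have "T z \<le> C / \<rho> * z" using T_bounds(2)[OF z(1) zr(1)] C rho_pos
    by (smt (verit) divide_pos_pos mult_left_mono power_one_right)
  also have "\<dots> < C / \<rho> * (e * \<rho> / C)" using z C rho_pos by (intro mult_strict_left_mono) auto
  also have "\<dots> = e" using C rho_pos by simp
  finally show "z \<le> r \<and> z \<le> 1 \<and> T z < e" using zr by simp
qed

text \<open>At the axis coordinate \<open>T z\<close>, which is at most of size \<open>z^N\<close>,
  the value of \<open>u\<close> is below a negative multiple of \<open>z^(N+1)\<close>, while at the
  reflected point \<open>u \<le> 0\<close> suffices. A quadratic polynomial below \<open>u\<close>
  would have a second difference of size at most \<open>z^(2N)\<close>, and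
  \<open>2N > N + 1\<close>.\<close>

lemma no_touch_below_origin:
  assumes Q: "\<And>x. Q x = c' + b \<bullet> x + x \<bullet> (A *v x)" and t: "touches_from_below Q u 0"
  shows False
proof -
  define H where "H = (A + transpose A) $ 3 $ 3"
  have Q0: "Q 0 = 0" using t u_axis(2)[of 0] by (simp add: touches_from_below_def vec_zero_3 h_zero psi_zero)
  obtain d where d: "d > 0" "\<And>x. dist x 0 < d \<Longrightarrow> Q x \<le> u x"
    using t unfolding touches_from_below_def eventually_nhds_metric by blast
  obtain z0 where z0: "0 < z0" "\<And>z. 0 < z \<Longrightarrow> z < z0 \<Longrightarrow> z \<le> r \<and> z \<le> 1 \<and> T z < min d 1"
    using T_small[of "min d 1"] d by auto
  define c2 where "c2 = c0 / real (N + 1)"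
  have c2: "c2 > 0" using c0 by (simp add: c2_def)
  \<comment> \<open>The first entry keeps \<open>T z\<close> within the radius of contact, the
    second makes the final inequality read \<open>c2 \<le> c2 / 2\<close>.\<close>
  define z where "z = min (z0 / 2) (c2 / (2 * (\<bar>H\<bar> * C\<^sup>2 + 1)))"
  have den: "\<bar>H\<bar> * C\<^sup>2 + 1 > 0" by (simp add: add_nonneg_pos)
  have z: "0 < z" "z < z0" using z0 c2 den by (auto simp: z_def)
  have zz: "z \<le> r" "z \<le> 1" "T z < d" "T z < 1" using z0(2)[OF z] by auto
  have T: "0 < T z" "T z \<le> C / \<rho> * z ^ N" by (rule T_bounds[OF z(1) zz(1)])+
  define x where "x = (vector [0, 0, T z] :: real ^ 3)"
  have mx: "- x = vector [0, 0, - T z]" by (simp add: x_def vec_eq_iff forall_3)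
  have nx: "norm x < d" "norm (- x) < d" using norm_vector_3_le[of 0 0 "T z"] T zz by (auto simp: x_def)
  have "\<psi> z \<le> - c2 * z ^ (N + 1)"
    unfolding c2_def by (rule psi_upper) (use z zz in auto)
  then have "\<psi> z / \<rho>\<^sup>2 \<le> - c2 * z ^ (N + 1) / \<rho>\<^sup>2" by (rule divide_right_mono) simp
  moreover have "u x = \<psi> z / \<rho>\<^sup>2"
    unfolding x_def using u_axis(2)[of "T z"] T zz h_T[OF z(1) zz(1,4)] by simp
  ultimately have ux: "u x \<le> - c2 * z ^ (N + 1) / \<rho>\<^sup>2" by simp
  have umx: "u (- x) \<le> 0" unfolding mx using T zz by (intro u_axis_nonpos) auto
  have "x \<bullet> ((A + transpose A) *v x) = H * (T z)\<^sup>2"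
    by (simp add: x_def H_def inner_vec_def matrix_vector_mult_def sum_3 power2_eq_square)
  then have "H * (T z)\<^sup>2 = Q x + Q (- x) - 2 * Q 0" using quadratic_second_difference[OF Q, of x] by simp
  also have "\<dots> \<le> - c2 * z ^ (N + 1) / \<rho>\<^sup>2"
    using d(2)[of x] d(2)[of "- x"] nx ux umx Q0 by simp
  finally have "c2 * z ^ (N + 1) / \<rho>\<^sup>2 \<le> - (H * (T z)\<^sup>2)" by simp
  also have "\<dots> \<le> \<bar>H\<bar> * (T z)\<^sup>2"
    using abs_ge_minus_self[of H] mult_right_mono[of "- H" "\<bar>H\<bar>" "(T z)\<^sup>2"] by simp
  also have "\<dots> \<le> \<bar>H\<bar> * (C / \<rho> * z ^ N)\<^sup>2" using T by (intro mult_left_mono power_mono) auto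
  also have "\<dots> = (\<bar>H\<bar> * C\<^sup>2 * z ^ (N - 1)) * z ^ (N + 1) / \<rho>\<^sup>2"
  proof -
    have "(z ^ N)\<^sup>2 = z ^ (N - 1) * z ^ (N + 1)" by (simp only: power_add[symmetric] power_mult[symmetric]) (simp add: add.commute)
    then show ?thesis by (simp add: power_mult_distrib power_divide)
  qed
  finally have "c2 * z ^ (N + 1) \<le> (\<bar>H\<bar> * C\<^sup>2 * z ^ (N - 1)) * z ^ (N + 1)"
    using rho_pos by (simp add: divide_le_cancel)
  then have "c2 \<le> \<bar>H\<bar> * C\<^sup>2 * z ^ (N - 1)" using z by (simp add: mult_le_cancel_right)
  also have "\<dots> \<le> \<bar>H\<bar> * C\<^sup>2 * z ^ 1"
    using z zz by (intro mult_left_mono power_decreasing) auto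
  also have "\<dots> \<le> (\<bar>H\<bar> * C\<^sup>2 + 1) * z" using z by (simp add: algebra_simps)
  also have "\<dots> \<le> (\<bar>H\<bar> * C\<^sup>2 + 1) * (c2 / (2 * (\<bar>H\<bar> * C\<^sup>2 + 1)))"
    using den by (intro mult_left_mono) (auto simp: z_def)
  also have "\<dots> = c2 / 2" using den by (simp add: field_simps)
  finally show False using c2 by simp
qed

text \<open>Since \<open>w3\<close> is nondecreasing in z, \<open>w\<close> is convex along vertical
  lines and lies above its tangent at height 0. This replaces values at the height \<open>h\<close>,
  which is only known to be Hoelder continuous, by values at height 0.\<close>

lemma w_convex:
  assumes pq: "\<bar>p\<bar> \<le> \<rho>" "\<bar>q\<bar> < \<rho> \<or> q = 0" and z: "\<bar>z\<bar> \<le> r"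
  shows "w (vector [p, q, 0]) + w3 (vector [p, q, 0]) * z \<le> w (vector [p, q, z])"
proof -
  have der: "((\<lambda>z. w (vector [p, q, z])) has_real_derivative w3 (vector [p, q, t])) (at t)" if "\<bar>t\<bar> \<le> r" for t
    by (rule has_grad_DERIV_3[OF grad(1)[OF box_in_ball[OF pq that]]])
  have mono: "w3 (vector [p, q, t]) \<le> w3 (vector [p, q, t'])" if "- r \<le> t" "t \<le> t'" "t' \<le> r" for t t'
  proof -
    have "0 \<le> c1 * (t' - t) ^ N" using c1_pos that by simp
    then show ?thesis using w3_diff_ge[OF pq that] by simp
  qed
  consider "z = 0" | "z > 0" | "z < 0" by linarith
  then show ?thesis
  proof cases
    case 1
    then show ?thesis by simp
  next
    case 2
    obtain t where t: "0 < t" "t < z" "w (vector [p, q, z]) - w (vector [p, q, 0]) = (z - 0) * w3 (vector [p, q, t])"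
      using MVT2[OF 2, of "\<lambda>z. w (vector [p, q, z])" "\<lambda>t. w3 (vector [p, q, t])"] der z by auto
    have "w3 (vector [p, q, 0]) \<le> w3 (vector [p, q, t])" using t z r_pos by (intro mono) auto
    then have "w3 (vector [p, q, 0]) * z \<le> w3 (vector [p, q, t]) * z" using 2 by (intro mult_right_mono) auto
    then show ?thesis using t(3) by (simp add: algebra_simps)
  next
    case 3
    obtain t where t: "z < t" "t < 0" "w (vector [p, q, 0]) - w (vector [p, q, z]) = (0 - z) * w3 (vector [p, q, t])"
      using MVT2[OF 3, of "\<lambda>z. w (vector [p, q, z])" "\<lambda>t. w3 (vector [p, q, t])"] der z by auto
    have "w3 (vector [p, q, t]) \<le> w3 (vector [p, q, 0])" using t z r_pos by (intro mono) auto
    then have "w3 (vector [p, q, 0]) * z \<le> w3 (vector [p, q, t]) * z" using 3 by (intro mult_right_mono_neg) auto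
    then show ?thesis using t(3) by (simp add: algebra_simps)
  qed
qed

text \<open>On the plane \<open>X $ 3 = 0\<close> the Legendre term vanishes, so \<open>u\<close> is
  \<open>v\<close> up to scaling. By \<open>w_convex\<close> only \<open>w\<close> and
  \<open>w3\<close> at height 0 enter, which are of third and second order; as \<open>h\<close>
  tends to 0, the error is \<open>o(t^2)\<close>.\<close>

lemma u_lower_horizontal:
  fixes p q :: real
  defines "\<xi> \<equiv> vector [p, q, 0] :: real ^ 3"
  assumes X: "t *\<^sub>R \<xi> \<in> B"
  shows "a / 2 * t\<^sup>2 * (p\<^sup>2 + q\<^sup>2) - C * (\<rho> * \<bar>t\<bar> * norm \<xi> ^ 3 + \<bar>h (t *\<^sub>R \<xi>)\<bar> * norm \<xi> ^ 2) * t\<^sup>2 \<le> u (t *\<^sub>R \<xi>)"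
proof -
  define z where "z = h (t *\<^sub>R \<xi>)"
  define P where "P = (vector [\<rho> * t * p, \<rho> * t * q, 0] :: real ^ 3)"
  have Psi: "\<Psi> (t *\<^sub>R \<xi>) = vector [\<rho> * t * p, \<rho> * t * q, z]" by (simp add: \<Psi>_def z_def \<xi>_def mult.assoc)
  have P: "P = (\<rho> * t) *\<^sub>R \<xi>" by (simp add: P_def \<xi>_def vec_eq_iff forall_3)
  have nP: "norm P = \<rho> * \<bar>t\<bar> * norm \<xi>" using rho_pos by (simp add: P abs_mult)
  have c: "\<bar>\<rho> * t * p\<bar> \<le> \<rho>" "\<bar>\<rho> * t * q\<bar> < \<rho> \<or> \<rho> * t * q = 0"
    using component_less[OF X, of 1] component_less[OF X, of 2] by (auto simp: \<xi>_def mult.assoc)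
  have zr: "\<bar>z\<bar> \<le> r" unfolding z_def by (rule h_works(1)[OF X])
  have Pb: "P \<in> ball 0 r0" unfolding P_def using c r_pos by (intro box_in_ball) auto
  have "w P + w3 P * z \<le> w (vector [\<rho> * t * p, \<rho> * t * q, z])"
    unfolding P_def by (rule w_convex[OF c zr])
  moreover have "- (C * norm P ^ 3) \<le> w P" using w_order[OF Pb] by linarith
  moreover have "- (C * norm P ^ 2 * \<bar>z\<bar>) \<le> w3 P * z"
  proof -
    have "\<bar>w3 P * z\<bar> \<le> C * norm P ^ 2 * \<bar>z\<bar>"
      unfolding abs_mult using w3_order[OF Pb] by (intro mult_right_mono) auto
    then show ?thesis by linarith
  qed
  ultimately have w: "- (C * norm P ^ 3) - C * norm P ^ 2 * \<bar>z\<bar> \<le> w (vector [\<rho> * t * p, \<rho> * t * q, z])" by linarith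
  have "\<rho>\<^sup>2 * (a / 2 * t\<^sup>2 * (p\<^sup>2 + q\<^sup>2) - C * (\<rho> * \<bar>t\<bar> * norm \<xi> ^ 3 + \<bar>z\<bar> * norm \<xi> ^ 2) * t\<^sup>2)
      = a / 2 * ((\<rho> * t * p)\<^sup>2 + (\<rho> * t * q)\<^sup>2) + (- (C * norm P ^ 3) - C * norm P ^ 2 * \<bar>z\<bar>)"
  proof -
    have "\<bar>t\<bar> ^ 3 = \<bar>t\<bar> * t\<^sup>2" by (simp add: power3_eq_cube power2_eq_square)
    then show ?thesis
      unfolding nP by (cases "t \<ge> 0") (simp_all add: power_mult_distrib power2_eq_square power3_eq_cube algebra_simps)
  qed
  also have "\<dots> \<le> a / 2 * ((\<rho> * t * p)\<^sup>2 + (\<rho> * t * q)\<^sup>2) + w (vector [\<rho> * t * p, \<rho> * t * q, z])"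
    using w by simp
  also have "\<dots> = \<rho>\<^sup>2 * u (t *\<^sub>R \<xi>)"
    unfolding u_def v_def Psi using rho_pos by (simp add: \<xi>_def)
  finally show ?thesis using rho_pos by (simp add: z_def mult_le_cancel_left)
qed

text \<open>The second difference of \<open>Q\<close> along a horizontal direction dominates that of
  \<open>u\<close>, which is at least \<open>t^2 * a * (p^2 + q^2)\<close> up to
  \<open>o(t^2)\<close>. The arbitrary \<open>e\<close> absorbs this error.\<close>

lemma touch_above_origin:
  assumes Q: "\<And>x. Q x = c' + b \<bullet> x + x \<bullet> (A *v x)" and t: "touches_from_above Q u 0"
  shows "a * (p\<^sup>2 + q\<^sup>2) \<le> vector [p, q, 0] \<bullet> ((A + transpose A) *v vector [p, q, 0])"
proof (rule field_le_epsilon)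
  fix e :: real assume e: "e > 0"
  define \<xi> where "\<xi> = (vector [p, q, 0] :: real ^ 3)"
  have Q0: "Q 0 = 0" using t u_axis(2)[of 0] by (simp add: touches_from_above_def vec_zero_3 h_zero psi_zero)
  obtain d where d: "d > 0" "\<And>x. dist x 0 < d \<Longrightarrow> u x \<le> Q x"
    using t unfolding touches_from_above_def eventually_nhds_metric by blast
  define E where "E t = C * (\<rho> * \<bar>t\<bar> * norm \<xi> ^ 3 + \<bar>h (t *\<^sub>R \<xi>)\<bar> * norm \<xi> ^ 2)" for t
  have lin: "((\<lambda>t::real. t *\<^sub>R \<xi>) \<longlongrightarrow> 0 *\<^sub>R \<xi>) (at 0)" by (intro tendsto_intros)
  have "isCont h 0" using h_continuous continuous_on_eq_continuous_at[OF open_ball, of 0 1 h] by simp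
  then have "((\<lambda>t::real. h (t *\<^sub>R \<xi>)) \<longlongrightarrow> h 0) (at 0)"
    using isCont_tendsto_compose[of 0 h "\<lambda>t::real. t *\<^sub>R \<xi>" "at 0"] lin by simp
  then have hl: "((\<lambda>t::real. h (t *\<^sub>R \<xi>)) \<longlongrightarrow> 0) (at 0)" by (simp add: h_zero)
  have El: "(E \<longlongrightarrow> C * (\<rho> * \<bar>0\<bar> * norm \<xi> ^ 3 + \<bar>0\<bar> * norm \<xi> ^ 2)) (at 0)"
    unfolding E_def by (intro tendsto_intros hl)
  then have "\<forall>\<^sub>F t in at 0. E t < e / 2" using e by (intro order_tendstoD) auto
  then have Ee: "\<forall>\<^sub>F t in at (0::real). \<bar>t\<bar> < 1 \<longrightarrow> E t < e / 2" by eventually_elim simp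
  then obtain d1 where d1: "d1 > 0" "\<And>t. t \<noteq> 0 \<Longrightarrow> \<bar>t\<bar> < d1 \<Longrightarrow> \<bar>t\<bar> < 1 \<Longrightarrow> E t < e / 2"
    unfolding eventually_at by (auto simp: dist_real_def)
  define d2 where "d2 = min d 1 / (norm \<xi> + 1)"
  define t where "t = min (min d1 1) d2 / 2"
  have n1: "norm \<xi> + 1 > 0" by (simp add: add_nonneg_pos)
  then have d2: "d2 > 0" using d by (simp add: d2_def)
  have t: "t > 0" "t < d1" "t < 1" "t < d2" using d1 d2 by (auto simp: t_def)
  have "t * (norm \<xi> + 1) < min d 1" using t(4) n1 unfolding d2_def by (simp only: pos_less_divide_eq)
  then have "t * norm \<xi> < min d 1" using t(1) by (simp add: distrib_left)
  then have nt: "norm (t *\<^sub>R \<xi>) < d" "norm (t *\<^sub>R \<xi>) < 1" "norm ((- t) *\<^sub>R \<xi>) < d" "norm ((- t) *\<^sub>R \<xi>) < 1" using t(1) by auto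
  have lower: "a / 2 * t\<^sup>2 * (p\<^sup>2 + q\<^sup>2) - e / 2 * t\<^sup>2 \<le> Q (\<sigma> *\<^sub>R \<xi>)" if "\<sigma> = t \<or> \<sigma> = - t" for \<sigma>
  proof -
    have \<sigma>: "\<sigma> \<noteq> 0" "\<bar>\<sigma>\<bar> < d1" "\<bar>\<sigma>\<bar> < 1" "\<sigma>\<^sup>2 = t\<^sup>2" "norm (\<sigma> *\<^sub>R \<xi>) < d" "norm (\<sigma> *\<^sub>R \<xi>) < 1"
      using that t nt by auto
    have "E \<sigma> * \<sigma>\<^sup>2 \<le> e / 2 * \<sigma>\<^sup>2" using d1(2)[OF \<sigma>(1-3)] by (intro mult_right_mono) auto
    moreover have "a / 2 * \<sigma>\<^sup>2 * (p\<^sup>2 + q\<^sup>2) - E \<sigma> * \<sigma>\<^sup>2 \<le> u (\<sigma> *\<^sub>R \<xi>)"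
      unfolding E_def \<xi>_def by (rule u_lower_horizontal) (use \<sigma>(6) in \<open>simp add: \<xi>_def\<close>)
    moreover have "u (\<sigma> *\<^sub>R \<xi>) \<le> Q (\<sigma> *\<^sub>R \<xi>)" using d(2)[of "\<sigma> *\<^sub>R \<xi>"] \<sigma>(5) by simp
    ultimately show ?thesis using \<sigma>(4) by simp
  qed
  have "t\<^sup>2 * (a * (p\<^sup>2 + q\<^sup>2)) - t\<^sup>2 * e \<le> Q (t *\<^sub>R \<xi>) + Q (- (t *\<^sub>R \<xi>)) - 2 * Q 0"
    using lower[of t] lower[of "- t"] Q0 by (simp add: algebra_simps)
  also have "\<dots> = (t *\<^sub>R \<xi>) \<bullet> ((A + transpose A) *v (t *\<^sub>R \<xi>))" by (rule quadratic_second_difference[OF Q])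
  also have "\<dots> = t\<^sup>2 * (\<xi> \<bullet> ((A + transpose A) *v \<xi>))"
    unfolding matrix_vector_mult_scaleR by (simp add: power2_eq_square)
  finally have "t\<^sup>2 * (a * (p\<^sup>2 + q\<^sup>2) - e) \<le> t\<^sup>2 * (\<xi> \<bullet> ((A + transpose A) *v \<xi>))" by (simp add: right_diff_distrib)
  then show "a * (p\<^sup>2 + q\<^sup>2) \<le> vector [p, q, 0] \<bullet> ((A + transpose A) *v vector [p, q, 0]) + e"
    using t(1) unfolding \<xi>_def by (simp add: mult_le_cancel_left)
qed

lemma viscosity_u: "special_lagrangian_viscosity_solution \<Theta> B u"
  unfolding special_lagrangian_viscosity_solution_def
proof (intro conjI ballI allI impI)
  show "continuous_on B u" by (rule u_continuous)
  fix X :: "real ^ 3" and Q :: "real ^ 3 \<Rightarrow> real"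
  assume X: "X \<in> B" and Q: "quadratic_polynomial Q"
  obtain c' b A where Qe: "\<And>x. Q x = c' + b \<bullet> x + x \<bullet> (A *v x)"
    using Q unfolding quadratic_polynomial_def by blast
  { assume t: "touches_from_below Q u X"
    show "sum_arctan_eigenvalues (hessian Q X) \<le> \<Theta>"
      using viscosity_nonzero(1)[OF X _ Q t] no_touch_below_origin[OF Qe] t by blast }
  { assume t: "touches_from_above Q u X"
    show "\<Theta> \<le> sum_arctan_eigenvalues (hessian Q X)"
    proof (cases "X = 0")
      case True
      \<comment> \<open>By \<open>cs(6)\<close> the left side is exactly \<open>\<Theta>\<close>, so
        the loss of \<open>pi / 2\<close> from the third eigenvalue is just affordable.\<close>
      have "2 * arctan a - pi / 2 \<le> sum_arctan_eigenvalues (A + transpose A)"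
        by (rule sum_arctan_ge_plane[OF transpose_sum touch_above_origin[OF Qe]]) (use t True in simp)
      then show ?thesis using cs(6) by (simp add: hessian_quadratic[OF Qe] a_def)
    qed (use viscosity_nonzero(2)[OF X _ Q t] in blast) }
qed

text \<open>At the axis point \<open>T z\<close> the third component of the gradient differs from
  its value at 0 by \<open>z / \<rho>\<close> in absolute value, while the distance is at most
  \<open>C / \<rho> * z^N\<close>. A Hoelder exponent \<open>\<delta>\<close> would bound
  \<open>z\<close> by a multiple of \<open>z powr (N * \<delta>)\<close>, which is impossible for
  small \<open>z\<close> since \<open>N * \<delta> > 1\<close>.\<close>

lemma not_C1_Hoelder_u:
  assumes \<delta>: "\<delta> > 1 / real N" and r': "0 < r'" "r' \<le> 1"
  shows "\<not> C1_Hoelder_on \<delta> (ball 0 r') u"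
proof
  assume "C1_Hoelder_on \<delta> (ball 0 r') u"
  then obtain g K where g: "\<And>x. x \<in> ball 0 r' \<Longrightarrow> GDERIV u x :> g x"
    and K: "\<And>x y. x \<in> ball 0 r' \<Longrightarrow> y \<in> ball 0 r' \<Longrightarrow> norm (g x - g y) \<le> K * norm (x - y) powr \<delta>"
    unfolding C1_Hoelder_on_def by blast
  have gG: "g x = G x" if "x \<in> ball 0 r'" for x
  proof -
    have "GDERIV u x :> G x" using that r' by (intro GDERIV_u) auto
    from has_derivative_unique[OF g[OF that, unfolded gderiv_def] this[unfolded gderiv_def]]
    have "h \<bullet> g x = h \<bullet> G x" for h by (rule fun_cong)
    then show ?thesis by (metis vector_eq_ldot)
  qed
  have \<delta>0: "\<delta> > 0" using \<delta> by (rule less_trans[rotated]) simp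
  define e where "e = real N * \<delta> - 1"
  have e: "e > 0" using \<delta> by (simp add: e_def field_simps)
  define D where "D = \<rho> * \<bar>K\<bar> * (C / \<rho>) powr \<delta> + 1"
  have D: "D > 0" using rho_pos by (simp add: D_def add_nonneg_pos)
  obtain z0 where z0: "0 < z0" "\<And>z. 0 < z \<Longrightarrow> z < z0 \<Longrightarrow> z \<le> r \<and> z \<le> 1 \<and> T z < r'"
    using T_small[OF r'(1)] by blast
  \<comment> \<open>The first entry keeps the point in the ball, the second makes
    \<open>D * z powr e\<close> at most 1/2.\<close>
  define z where "z = min (z0 / 2) ((1 / (2 * D)) powr (1 / e))"
  have z: "0 < z" "z < z0" using z0 D by (auto simp: z_def)
  have zz: "z \<le> r" "z \<le> 1" "T z < r'" "T z < 1" using z0(2)[OF z] r' by auto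
  have T: "0 < T z" "T z \<le> C / \<rho> * z ^ N" by (rule T_bounds[OF z(1) zz(1)])+
  define x where "x = (vector [0, 0, T z] :: real ^ 3)"
  have nx: "norm x \<le> T z" using norm_vector_3_le[of 0 0 "T z"] T by (simp add: x_def)
  have "z / \<rho> = \<bar>(G x - G 0) $ 3\<bar>"
    using h_T[OF z(1) zz(1,4)] z rho_pos by (simp add: G_def x_def h_zero)
  also have "\<dots> \<le> norm (G x - G 0)" by (rule component_le_norm_cart)
  also have "\<dots> \<le> K * norm (x - 0) powr \<delta>"
    using K[of x 0] gG[of x] gG[of 0] nx zz r' by simp
  also have "\<dots> \<le> \<bar>K\<bar> * (C / \<rho> * z ^ N) powr \<delta>"
    using nx T \<delta>0 by (intro mult_mono powr_mono2) auto
  also have "\<dots> = \<bar>K\<bar> * (C / \<rho>) powr \<delta> * (z * z powr e)"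
  proof -
    have "(z ^ N) powr \<delta> = z powr (1 + e)"
      using z by (simp add: powr_realpow[symmetric] powr_powr e_def)
    moreover have "z powr (1 + e) = z * z powr e" using z by (simp add: powr_add)
    ultimately have "(C / \<rho> * z ^ N) powr \<delta> = (C / \<rho>) powr \<delta> * (z * z powr e)"
      by (simp only: powr_mult)
    then show ?thesis by simp
  qed
  finally have "z / \<rho> \<le> \<bar>K\<bar> * (C / \<rho>) powr \<delta> * (z * z powr e)" .
  then have "1 \<le> \<rho> * \<bar>K\<bar> * (C / \<rho>) powr \<delta> * z powr e" using z rho_pos by (simp add: field_simps)
  also have "\<dots> \<le> D * z powr e" by (intro mult_right_mono) (auto simp: D_def)
  also have "\<dots> \<le> D * ((1 / (2 * D)) powr (1 / e)) powr e"
    using D z e by (intro mult_left_mono powr_mono2) (auto simp: z_def)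
  also have "\<dots> = 1 / 2" using D e by (simp add: powr_powr)
  finally show False by simp
qed

end

section \<open>Choice of the radius and conclusion\<close>

lemma order_ge_small:
  assumes "order_ge 1 p" "e > 0"
  shows "\<exists>d>0. \<forall>x. norm x < d \<longrightarrow> \<bar>ev p x\<bar> \<le> e"
proof -
  obtain K where K: "K > 0" "\<And>x. x \<in> dom0 \<Longrightarrow> \<bar>ev p x\<bar> \<le> K * norm x ^ 1"
    using ev_order_bound[OF assms(1)] by blast
  have "\<bar>ev p x\<bar> \<le> e" if "norm x < min (1/16) (e / K)" for x
  proof -
    have "\<bar>ev p x\<bar> \<le> K * norm x" using K(2)[of x] that by simp
    also have "\<dots> \<le> K * (e / K)" using K(1) that by (intro mult_left_mono) auto
    finally show ?thesis using K(1) by simp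
  qed
  then show ?thesis using K(1) assms(2) by (intro exI[of _ "min (1/16) (e / K)"]) auto
qed

theorem theorem1p1:
  fixes \<Theta> :: real and m :: nat
  assumes "- (pi / 2) < \<Theta>" and "\<Theta> < pi / 2" and "m \<ge> 2"
  shows "\<exists>u :: real ^ 3 \<Rightarrow> real.
    special_lagrangian_viscosity_solution \<Theta> (ball 0 1) u \<and>
    C1_Hoelder_on (1 / (2 * real m - 1)) (ball 0 1) u \<and>
    C_infinity_on (ball 0 1 - {0}) u \<and>
    (\<forall>\<delta> > 1 / (2 * real m - 1). \<forall>r\<in>{0<..1}. \<not> C1_Hoelder_on \<delta> (ball 0 r) u)"
proof -
  define \<theta> where "\<theta> = (\<Theta> + pi / 2) / 2"
  have \<theta>: "0 < \<theta>" "\<theta> < pi / 2" using assms by (auto simp: \<theta>_def)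
  define c where "c = cos \<theta>"
  define s where "s = sin \<theta>"
  have c: "0 < c" "c \<le> 1" using \<theta> by (auto simp: c_def intro: cos_gt_zero)
  have s: "0 < s" "s \<le> 1" using \<theta> by (auto simp: s_def intro: sin_gt_zero2)
  obtain k where m: "m = k + 2" using assms(3) le_Suc_ex by (metis add.commute)
  obtain W W1 W2 W3 K11 K12 K13 K22 K23 K33 c0 r1 C1 where
    g: "\<And>x. x \<in> dom0 \<Longrightarrow> has_grad (ev W) (ev W1 x) (ev W2 x) (ev W3 x) x"
      "\<And>x. x \<in> dom0 \<Longrightarrow> has_grad (ev W1) (ev K11 x) (ev K12 x) (ev K13 x) x"
      "\<And>x. x \<in> dom0 \<Longrightarrow> has_grad (ev W2) (ev K12 x) (ev K22 x) (ev K23 x) x"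
      "\<And>x. x \<in> dom0 \<Longrightarrow> has_grad (ev W3) (ev K13 x) (ev K23 x) (ev K33 x) x"
    and pde: "\<And>x. x \<in> dom0 \<Longrightarrow> ev K33 x = NN c s (ev K11 x) (ev K12 x) (ev K13 x) (ev K22 x) (ev K23 x) (ev K33 x)"
    and ord: "order_ge 3 W" "order_ge 2 W3"
    and ordK: "order_ge 1 K11" "order_ge 1 K12" "order_ge 1 K13" "order_ge 1 K22" "order_ge 1 K23" "order_ge 1 K33"
    and c0: "0 < c0" and r1: "0 < r1" "r1 \<le> 1 / 16"
    and low: "\<And>x. norm x < r1 \<Longrightarrow> c0 * norm x ^ (2 * k + 2) \<le> ev K33 x"
    and C1: "0 < C1"
    and axis: "\<And>x. x \<in> dom0 \<Longrightarrow> x $ 1 = 0 \<Longrightarrow> x $ 2 = 0 \<Longrightarrow> \<bar>ev W3 x\<bar> \<le> C1 * norm x ^ (2 * k + 3)"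
    by (rule slag_series[OF c s]) blast
  obtain C2 where C2: "C2 > 0" "\<And>x. x \<in> dom0 \<Longrightarrow> \<bar>ev W x\<bar> \<le> C2 * norm x ^ 3"
    using ev_order_bound[OF ord(1)] by blast
  obtain C3 where C3: "C3 > 0" "\<And>x. x \<in> dom0 \<Longrightarrow> \<bar>ev W3 x\<bar> \<le> C3 * norm x ^ 2"
    using ev_order_bound[OF ord(2)] by blast
  define C where "C = C1 + C2 + C3"
  \<comment> \<open>The bound 1/4 serves the Lipschitz estimates and the upper bound of the Hessian;
    \<open>s / c / 4\<close> is \<open>tan \<theta> / 4\<close> and keeps the horizontal block of
    the Hessian of \<open>v\<close> positive definite.\<close>
  define e where "e = min (1/4) (s / c / 4)"
  have e: "e > 0" using c s by (simp add: e_def)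
  have "\<exists>d>0. \<forall>p\<in>{K11, K12, K13, K22, K23, K33}. \<forall>x. norm x < d \<longrightarrow> \<bar>ev p x\<bar> \<le> e"
  proof -
    have "\<forall>p\<in>{K11, K12, K13, K22, K23, K33}. \<exists>d>0. \<forall>x. norm x < d \<longrightarrow> \<bar>ev p x\<bar> \<le> e"
      using ordK order_ge_small[OF _ e] by blast
    then obtain d where d: "\<And>p. p \<in> {K11, K12, K13, K22, K23, K33} \<Longrightarrow> d p > 0 \<and> (\<forall>x. norm x < d p \<longrightarrow> \<bar>ev p x\<bar> \<le> e)"
      by metis
    define d0 where "d0 = Min (d ` {K11, K12, K13, K22, K23, K33})"
    have "d0 > 0" unfolding d0_def using d by (subst Min_gr_iff) auto
    moreover have "d0 \<le> d p" if "p \<in> {K11, K12, K13, K22, K23, K33}" for p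
      unfolding d0_def using that by (intro Min_le) auto
    ultimately show ?thesis using d by (meson less_le_trans)
  qed
  then obtain d where d: "d > 0" "\<And>p x. p \<in> {K11, K12, K13, K22, K23, K33} \<Longrightarrow> norm x < d \<Longrightarrow> \<bar>ev p x\<bar> \<le> e"
    by blast
  define r0 where "r0 = min r1 d"
  have dom: "x \<in> dom0" "norm x < r1" "norm x < d" if "x \<in> ball 0 r0" for x
    using that r1 by (auto simp: r0_def)
  interpret slag_graph \<Theta> c s k "ev W" "ev W1" "ev W2" "ev W3" "ev K11" "ev K12" "ev K13" "ev K22" "ev K23" "ev K33" c0 r0 C
  proof
    show "- (pi / 2) < \<Theta>" "\<Theta> < pi / 2" by fact+
    show "c > 0" "s > 0" "c\<^sup>2 + s\<^sup>2 = 1" using c s by (auto simp: c_def s_def)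
    have \<Theta>: "\<Theta> = 2 * \<theta> - pi / 2" by (simp add: \<theta>_def field_simps)
    show "cos \<Theta> = 2 * s * c" unfolding \<Theta> by (simp add: cos_diff sin_double s_def c_def)
    show "sin \<Theta> = s\<^sup>2 - c\<^sup>2" unfolding \<Theta> by (simp add: sin_diff cos_double s_def c_def)
    have "s / c = tan \<theta>" by (simp add: tan_def s_def c_def)
    then have "arctan (s / c) = \<theta>" using \<theta> by (simp add: arctan_tan)
    then show "2 * arctan (s / c) = \<Theta> + pi / 2" by (simp add: \<theta>_def)
    show "C_infinity_on (ball 0 r0) (ev W)"
      by (rule C_infinity_on_subset[OF C_infinity_on_ev]) (use r1 in \<open>auto simp: r0_def\<close>)
    show "r0 > 0" using r1 d by (simp add: r0_def)
    show "C > 0" using C1 C2 C3 by (simp add: C_def)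
    show "c0 > 0" by fact
    fix x :: "real ^ 3" assume x: "x \<in> ball 0 r0"
    note x' = dom[OF x]
    show "has_grad (ev W) (ev W1 x) (ev W2 x) (ev W3 x) x"
      "has_grad (ev W1) (ev K11 x) (ev K12 x) (ev K13 x) x"
      "has_grad (ev W2) (ev K12 x) (ev K22 x) (ev K23 x) x"
      "has_grad (ev W3) (ev K13 x) (ev K23 x) (ev K33 x) x"
      by (rule g[OF x'(1)])+
    show "ev K33 x = NN c s (ev K11 x) (ev K12 x) (ev K13 x) (ev K22 x) (ev K23 x) (ev K33 x)"
      by (rule pde[OF x'(1)])
    show "\<bar>ev K11 x\<bar> \<le> min (1/4) (s / c / 4)" "\<bar>ev K12 x\<bar> \<le> min (1/4) (s / c / 4)"
      "\<bar>ev K13 x\<bar> \<le> min (1/4) (s / c / 4)" "\<bar>ev K22 x\<bar> \<le> min (1/4) (s / c / 4)"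
      "\<bar>ev K23 x\<bar> \<le> min (1/4) (s / c / 4)" "\<bar>ev K33 x\<bar> \<le> min (1/4) (s / c / 4)"
      unfolding e_def[symmetric] by (rule d(2)[OF _ x'(3)], simp)+
    show "c0 * norm x ^ (2 * k + 2) \<le> ev K33 x" by (rule low[OF x'(2)])
    have le: "C1 \<le> C" "C2 \<le> C" "C3 \<le> C" using C1 C2 C3 by (auto simp: C_def)
    show "\<bar>ev W x\<bar> \<le> C * norm x ^ 3"
      by (rule order_trans[OF C2(2)[OF x'(1)] mult_right_mono[OF le(2)]]) simp
    show "\<bar>ev W3 x\<bar> \<le> C * norm x ^ 2"
      by (rule order_trans[OF C3(2)[OF x'(1)] mult_right_mono[OF le(3)]]) simp
    assume a: "x $ 1 = 0" "x $ 2 = 0"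
    show "\<bar>ev W3 x\<bar> \<le> C * norm x ^ (2 * k + 3)"
      by (rule order_trans[OF axis[OF x'(1) a] mult_right_mono[OF le(1)]]) simp
  qed
  have N: "2 * real m - 1 = real (2 * k + 3)" by (simp add: m)
  show ?thesis
    unfolding N
    using viscosity_u C1_Hoelder_u C_infinity_u not_C1_Hoelder_u by (intro exI[of _ u]) auto
qed

end
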